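(* Let $\rho_{\bm\theta}$ be a smooth, locally identifiable $p$-parameter model of density operators on a finite-dimensional Hilbert space $\mathcal H$, with $\bm\theta=0$ an interior point of the parameter set and $\rho=\rho_{\bm 0}>0$ a full-rank state. Then for any real symmetric positive-definite $p\times p$ weight matrix $W$ and each integer $n\ge1$, $$C^{(1)}(W)>C^{\mathrm H}(W)\ \Longrightarrow\ C^{(n)}(W)>C^{\mathrm H}(W),$$ where $C^{(n)}(W)$ is the normalized $n$-copy optimum and $C^{\mathrm H}(W)$ is the Holevo Cramér–Rao bound at $\bm\theta=0$.
   Context: Put $\rho=\rho_{\bm 0}$, $D_\mu=\partial_{\theta_\mu}\rho_{\bm\theta}|_{\bm\theta=0}$, and $D_\mu^{(n)}=\partial_{\theta_\mu}\rho_{\bm\theta}^{\otimes n}|_{\bm\theta=0}$ for $\mu=1,\dots,p$. The model is locally identifiable (at $0$) if $D_1,\dots,D_p$ are linearly independent. Finite-copy optimum. An $n$-copy estimator is a POVM $\mathcal M=\{M_k\}$ on $\mathcal H^{\otimes n}$ (finitely many outcomes; $M_k\ge0$, $\sum_kM_k=\mathbb I$) together with vectors $\widetilde{\bm\theta}(k)\in\mathbb R^p$. It is locally unbiased if $\sum_k\operatorname{Tr}(\rho^{\otimes n}M_k)\,\widetilde\theta_\mu(k)=0$ and $\sum_k\operatorname{Tr}(D^{(n)}_\nu M_k)\,\widetilde\theta_\mu(k)=\delta_{\mu\nu}$ for all $\mu,\nu$. Its mean-square error matrix is $V=\sum_k\operatorname{Tr}(\rho^{\otimes n}M_k)\,\widetilde{\bm\theta}(k)\widetilde{\bm\theta}(k)^T$.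 Then $$C^{(n)}(W)=n\min_{\mathcal M,\widetilde{\bm\theta}}\operatorname{Tr}(WV),$$ the minimum (understood as infimum) being over locally unbiased $n$-copy estimators. Holevo bound. $$C^{\mathrm H}(W)=\min_X\big\{\operatorname{Tr}[W\operatorname{Re}Z(X)]+\|\sqrt W\,\operatorname{Im}Z(X)\,\sqrt W\|_1\big\},$$ where $X=(X_1,\dots,X_p)$ ranges over tuples of Hermitian operators on $\mathcal H$ with $\operatorname{Tr}(\rho X_\mu)=0$ and $\operatorname{Tr}(D_\nu X_\mu)=\delta_{\mu\nu}$, $Z_{\mu\nu}(X)=\operatorname{Tr}(\rho X_\mu X_\nu)$, real and imaginary parts are entrywise, and $\|A\|_1=\operatorname{Tr}\sqrt{A^\dagger A}$. *)

theory Defs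
  imports "HOL-Analysis.Analysis" "Jordan_Normal_Form.Schur_Decomposition"
begin

no_notation vec_index (infixl "$" 100)
no_notation scalar_prod (infix "\<bullet>" 70)

text \<open>
  Operators on a \<open>d\<close>-dimensional Hilbert space are complex \<open>d \<times> d\<close> matrices, operators on its
  \<open>n\<close>-fold tensor power are complex \<open>d ^ n \<times> d ^ n\<close> matrices. Parameters are vectors in
  \<open>real ^ 'p\<close>; the \<open>p \<times> p\<close> matrices indexed by parameters live in \<open>_ ^ 'p ^ 'p\<close>.
\<close>

definition mat_trace :: "complex mat \<Rightarrow> complex" where
  "mat_trace A = (\<Sum>i<dim_row A. A $$ (i, i))"

definition mat_sum :: "nat \<Rightarrow> ('i \<Rightarrow> complex mat) \<Rightarrow> 'i set \<Rightarrow> complex mat" where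
  "mat_sum N A I = Matrix.mat N N (\<lambda>ij. \<Sum>k\<in>I. A k $$ ij)"

definition hermitian_op :: "nat \<Rightarrow> complex mat \<Rightarrow> bool" where
  "hermitian_op N A \<longleftrightarrow> A \<in> carrier_mat N N \<and> mat_adjoint A = A"

definition pos_semidef_op :: "nat \<Rightarrow> complex mat \<Rightarrow> bool" where
  "pos_semidef_op N A \<longleftrightarrow> hermitian_op N A \<and> (\<forall>v\<in>carrier_vec N. 0 \<le> Re ((A *\<^sub>v v) \<bullet>c v))"

definition pos_def_op :: "nat \<Rightarrow> complex mat \<Rightarrow> bool" where
  "pos_def_op N A \<longleftrightarrow>
     hermitian_op N A \<and> (\<forall>v\<in>carrier_vec N. v \<noteq> 0\<^sub>v N \<longrightarrow> 0 < Re ((A *\<^sub>v v) \<bullet>c v))"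

definition density_op :: "nat \<Rightarrow> complex mat \<Rightarrow> bool" where
  "density_op N A \<longleftrightarrow> pos_semidef_op N A \<and> mat_trace A = 1"

definition kronecker :: "complex mat \<Rightarrow> complex mat \<Rightarrow> complex mat" where
  "kronecker A B = Matrix.mat (dim_row A * dim_row B) (dim_col A * dim_col B)
     (\<lambda>(i, j). A $$ (i div dim_row B, j div dim_col B) * B $$ (i mod dim_row B, j mod dim_col B))"

fun tensor_pow :: "complex mat \<Rightarrow> nat \<Rightarrow> complex mat" where
  "tensor_pow A 0 = 1\<^sub>m 1"
| "tensor_pow A (Suc n) = kronecker A (tensor_pow A n)"

fun times_differentiable_on ::
    "nat \<Rightarrow> 'a::real_normed_vector set \<Rightarrow> ('a \<Rightarrow> 'b::real_normed_vector) \<Rightarrow> bool" where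
  "times_differentiable_on 0 S f \<longleftrightarrow> continuous_on S f"
| "times_differentiable_on (Suc k) S f \<longleftrightarrow>
     (\<forall>x\<in>S. f differentiable (at x)) \<and>
     (\<forall>v. times_differentiable_on k S (\<lambda>x. frechet_derivative f (at x) v))"

text \<open>Smoothness is only meant for open \<open>S\<close>.\<close>

definition smooth_on :: "'a::real_normed_vector set \<Rightarrow> ('a \<Rightarrow> 'b::real_normed_vector) \<Rightarrow> bool" where
  "smooth_on S f \<longleftrightarrow> (\<forall>k. times_differentiable_on k S f)"

text \<open>The entrywise partial derivative at the origin in the direction of the coordinate \<open>\<mu>\<close>.\<close>

definition partial_at_0 :: "nat \<Rightarrow> (real ^ 'p \<Rightarrow> complex mat) \<Rightarrow> 'p \<Rightarrow> complex mat" where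
  "partial_at_0 N F \<mu> =
     Matrix.mat N N (\<lambda>ij. vector_derivative (\<lambda>t. F (t *\<^sub>R axis \<mu> 1) $$ ij) (at 0))"

definition locally_identifiable :: "nat \<Rightarrow> (real ^ 'p \<Rightarrow> complex mat) \<Rightarrow> bool" where
  "locally_identifiable d \<rho> \<longleftrightarrow>
     (\<forall>c :: 'p \<Rightarrow> real.
        mat_sum d (\<lambda>\<mu>. complex_of_real (c \<mu>) \<cdot>\<^sub>m partial_at_0 d \<rho> \<mu>) UNIV = 0\<^sub>m d d
          \<longrightarrow> (\<forall>\<mu>. c \<mu> = 0))"

text \<open>Outcomes of a measurement are numbered \<open>0, \<dots>, K - 1\<close>.\<close>

definition povm :: "nat \<Rightarrow> nat \<Rightarrow> (nat \<Rightarrow> complex mat) \<Rightarrow> bool" where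
  "povm N K M \<longleftrightarrow> (\<forall>k<K. pos_semidef_op N (M k)) \<and> mat_sum N M {..<K} = 1\<^sub>m N"

definition locally_unbiased ::
    "nat \<Rightarrow> (real ^ 'p \<Rightarrow> complex mat) \<Rightarrow> nat
      \<Rightarrow> nat \<Rightarrow> (nat \<Rightarrow> complex mat) \<Rightarrow> (nat \<Rightarrow> real ^ 'p) \<Rightarrow> bool" where
  "locally_unbiased d \<rho> n K M est \<longleftrightarrow>
     povm (d ^ n) K M \<and>
     (\<forall>\<mu>. (\<Sum>k<K. mat_trace (tensor_pow (\<rho> 0) n * M k) * complex_of_real (est k $ \<mu>)) = 0) \<and>
     (\<forall>\<mu> \<nu>. (\<Sum>k<K. mat_trace (partial_at_0 (d ^ n) (\<lambda>\<theta>. tensor_pow (\<rho> \<theta>) n) \<nu> * M k)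
                   * complex_of_real (est k $ \<mu>)) = (if \<mu> = \<nu> then 1 else 0))"

text \<open>The real part below only changes the type: the trace of a product of two Hermitian
  matrices is real.\<close>

definition mse_matrix ::
    "complex mat \<Rightarrow> nat \<Rightarrow> nat \<Rightarrow> (nat \<Rightarrow> complex mat) \<Rightarrow> (nat \<Rightarrow> real ^ 'p) \<Rightarrow> real ^ 'p ^ 'p" where
  "mse_matrix \<rho>0 n K M est =
     (\<chi> \<mu> \<nu>. \<Sum>k<K. Re (mat_trace (tensor_pow \<rho>0 n * M k)) * est k $ \<mu> * est k $ \<nu>)"

text \<open>Infima are taken in the extended reals, so that no junk value arises for an empty set.\<close>

definition copy_optimum ::
    "nat \<Rightarrow> (real ^ 'p \<Rightarrow> complex mat) \<Rightarrow> nat \<Rightarrow> real ^ 'p ^ 'p \<Rightarrow> ereal" where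
  "copy_optimum d \<rho> n W =
     ereal (real n) *
       (INF (K, M, est) \<in> {(K, M, est). locally_unbiased d \<rho> n K M est}.
          ereal (Determinants.trace (W ** mse_matrix (\<rho> 0) n K M est)))"

definition sym_pos_semidef :: "real ^ 'n ^ 'n \<Rightarrow> bool" where
  "sym_pos_semidef A \<longleftrightarrow> Finite_Cartesian_Product.transpose A = A \<and> (\<forall>x. 0 \<le> x \<bullet> (A *v x))"

definition sym_pos_def :: "real ^ 'n ^ 'n \<Rightarrow> bool" where
  "sym_pos_def A \<longleftrightarrow>
     Finite_Cartesian_Product.transpose A = A \<and> (\<forall>x. x \<noteq> 0 \<longrightarrow> 0 < x \<bullet> (A *v x))"

definition psd_sqrt :: "real ^ 'n ^ 'n \<Rightarrow> real ^ 'n ^ 'n" where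
  "psd_sqrt A = (THE B. sym_pos_semidef B \<and> B ** B = A)"

text \<open>For real matrices the adjoint is the transpose.\<close>

definition trace_norm :: "real ^ 'n ^ 'n \<Rightarrow> real" where
  "trace_norm A = Determinants.trace (psd_sqrt (Finite_Cartesian_Product.transpose A ** A))"

definition holevo_feasible ::
    "nat \<Rightarrow> (real ^ 'p \<Rightarrow> complex mat) \<Rightarrow> ('p \<Rightarrow> complex mat) \<Rightarrow> bool" where
  "holevo_feasible d \<rho> X \<longleftrightarrow>
     (\<forall>\<mu>. hermitian_op d (X \<mu>)) \<and>
     (\<forall>\<mu>. mat_trace (\<rho> 0 * X \<mu>) = 0) \<and>
     (\<forall>\<mu> \<nu>. mat_trace (partial_at_0 d \<rho> \<nu> * X \<mu>) = (if \<mu> = \<nu> then 1 else 0))"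

definition holevo_Z :: "complex mat \<Rightarrow> ('p \<Rightarrow> complex mat) \<Rightarrow> complex ^ 'p ^ 'p" where
  "holevo_Z \<rho>0 X = (\<chi> \<mu> \<nu>. mat_trace (\<rho>0 * X \<mu> * X \<nu>))"

definition Re_matrix :: "complex ^ 'n ^ 'm \<Rightarrow> real ^ 'n ^ 'm" where
  "Re_matrix A = (\<chi> i j. Re (A $ i $ j))"

definition Im_matrix :: "complex ^ 'n ^ 'm \<Rightarrow> real ^ 'n ^ 'm" where
  "Im_matrix A = (\<chi> i j. Im (A $ i $ j))"

definition holevo_bound :: "nat \<Rightarrow> (real ^ 'p \<Rightarrow> complex mat) \<Rightarrow> real ^ 'p ^ 'p \<Rightarrow> ereal" where
  "holevo_bound d \<rho> W =
     (INF X \<in> {X. holevo_feasible d \<rho> X}.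
        ereal (Determinants.trace (W ** Re_matrix (holevo_Z (\<rho> 0) X))
               + trace_norm (psd_sqrt W ** Im_matrix (holevo_Z (\<rho> 0) X) ** psd_sqrt W)))"

end

theory Submission
  imports Defs
begin

text \<open>
  Suppose the \<open>n\<close>-copy optimum does not exceed the Holevo bound. A locally unbiased \<open>n\<close>-copy estimator
  \<open>(M, \<theta>)\<close> yields the observables \<open>X\<^sub>\<mu> = \<Sum>\<^sub>k \<theta>\<^sub>\<mu>(k) M\<^sub>k\<close>. Projecting them onto the collective
  observables \<open>J(A) = A \<otimes> 1 \<otimes> \<dots> + \<dots> + 1 \<otimes> \<dots> \<otimes> A\<close> gives \<open>X = J(S) / n + R\<close> with \<open>S\<close> feasible for the single-copy Holevo problem, and the
  cost splits into the Holevo cost of \<open>S\<close>, a cost of \<open>R\<close>, and a cost of the covariance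
  \<open>G\<^sub>\<mu>\<^sub>\<nu> = \<Sum>\<^sub>k \<theta>\<^sub>\<mu>(k) \<theta>\<^sub>\<nu>(k) M\<^sub>k - X\<^sub>\<mu> X\<^sub>\<nu>\<close>, all measured by one dual matrix \<open>Y \<ge> 0\<close> with
  \<open>Re Y = W\<close>. As \<open>\<rho>\<close> has full rank, these costs bound the same expressions with plain traces, and
  there \<open>Im Y\<close> drops out by cyclicity. Hence for near-optimal estimators \<open>R\<close> and \<open>G\<close> are small, and
  so are the commutators \<open>[X\<^sub>\<mu>, X\<^sub>\<nu>] = G\<^sub>\<nu>\<^sub>\<mu> - G\<^sub>\<mu>\<^sub>\<nu>\<close>. A limit point of \<open>S\<close> then consists of commuting
  observables with Holevo cost at most the bound, and measuring their joint spectral decomposition on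
  a single copy attains this value.
\<close>

section \<open>Real symmetric matrices and the dual of the Holevo functional\<close>

text \<open>The dual matrix \<open>Y\<close> has to be optimal for \<open>S\<close>, so it changes
  with the estimator. The limit argument is uniform because each loss estimate sees \<open>Y\<close>
  only through \<open>Y >= 0\<close> and \<open>Re Y = W\<close>: the coefficient of the defect is
  fixed in advance as \<open>n\<close> times a lower bound for the spectrum of the n-copy state
  times one for the spectrum of \<open>W\<close>. The cost splits for two reasons. The classical
  second moments of the estimates form a real matrix, so pairing them with \<open>Y\<close> returns
  exactly \<open>Tr (W V)\<close>. The cross terms between \<open>R\<close> and \<open>J(S)\<close>
  vanish because \<open>J(S) / n\<close> is an orthogonal projection, and second moments of centred
  collective observables are \<open>n\<close> times those of one copy. Local unbiasedness survives
  the projection because the derivative of the n-copy state is that state times a collective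
  operator. Near-optimal estimators may need more and more outcomes, so compactness is applied to
  the one-copy tuples \<open>S\<close>, never to the measurements. Commutators pass to the limit
  through [J(A), J(B)] = J([A, B]) and the injectivity of \<open>J\<close> for n >= 1.\<close>

lemma selfadjoint_eigenvector:
  fixes f :: "'a::euclidean_space \<Rightarrow> 'a"
  assumes lin: "linear f" and sa: "\<And>x y. f x \<bullet> y = x \<bullet> f y"
    and S: "real_vector.subspace S" and inv: "\<And>x. x \<in> S \<Longrightarrow> f x \<in> S" and ne: "S \<noteq> {0}"
  obtains v l where "v \<in> S" "norm v = 1" "f v = l *\<^sub>R v"
proof -
  have cont: "continuous_on (S \<inter> sphere 0 1) (\<lambda>x. x \<bullet> f x)"
    by (intro continuous_intros linear_continuous_on lin[unfolded linear_conv_bounded_linear])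
  have cpt: "compact (S \<inter> sphere 0 1)"
    using S closed_subspace by (intro closed_Int_compact) auto
  obtain u where u: "u \<in> S" "u \<noteq> 0" using ne subspace_0[OF S] by blast
  then have "u /\<^sub>R norm u \<in> S \<inter> sphere 0 1"
    using S by (auto intro: subspace_scale)
  then obtain v where v: "v \<in> S" "norm v = 1" 
    and mx: "\<And>x. x \<in> S \<inter> sphere 0 1 \<Longrightarrow> x \<bullet> f x \<le> v \<bullet> f v"
    using continuous_attains_sup[OF cpt _ cont] by force
  define l where "l = v \<bullet> f v"
  have le: "x \<bullet> f x \<le> l * (x \<bullet> x)" if "x \<in> S" for x
  proof (cases "x = 0")
    case False
    have "(x /\<^sub>R norm x) \<bullet> f (x /\<^sub>R norm x) \<le> l"
      unfolding l_def using that False S by (intro mx) (auto intro: subspace_scale)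
    then have "(x \<bullet> f x) / (norm x)\<^sup>2 \<le> l"
      by (simp add: linear_scale[OF lin] power2_eq_square divide_inverse mult_ac)
    with False show ?thesis by (simp add: divide_le_eq power2_norm_eq_inner)
  qed (simp add: linear_0[OF lin])
  \<comment> \<open>\<open>v\<close> maximises the Rayleigh quotient on the unit sphere of
    \<open>S\<close>, and \<open>w\<close> is the residual of the eigenvector equation. Moving
    \<open>v\<close> by t w gains 2 t (w . w) to first order against a second-order term t^2 C,
    which a maximum forbids for small t > 0 unless w = 0.\<close>
  define w where "w = f v - l *\<^sub>R v"
  have wS: "w \<in> S" unfolding w_def using v inv S by (auto intro: subspace_diff subspace_scale)
  define C where "C = l * (w \<bullet> w) - w \<bullet> f w"
  have C: "C \<ge> 0" using le[OF wS] by (simp add: C_def)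
  have ineq: "2 * t * (w \<bullet> w) \<le> t\<^sup>2 * C" for t
  proof -
    have "(v + t *\<^sub>R w) \<bullet> f (v + t *\<^sub>R w) \<le> l * ((v + t *\<^sub>R w) \<bullet> (v + t *\<^sub>R w))"
      using v wS S by (intro le) (auto intro: subspace_add subspace_scale)
    moreover have vfw: "v \<bullet> f w = w \<bullet> f v" using sa[of v w] by (simp add: inner_commute)
    moreover have vv: "v \<bullet> v = 1" using v by (simp add: norm_eq_1)
    ultimately have "l + 2 * (t * (w \<bullet> f v)) + t\<^sup>2 * (w \<bullet> f w)
        \<le> l * (1 + 2 * t * (v \<bullet> w) + t\<^sup>2 * (w \<bullet> w))"
      by (simp add: linear_add[OF lin] linear_scale[OF lin] inner_add_left inner_add_right
          l_def[symmetric] inner_commute[of w v] power2_eq_square algebra_simps)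
    moreover have "w \<bullet> f v = w \<bullet> (w + l *\<^sub>R v)" by (simp add: w_def)
    then have wfv: "w \<bullet> f v = w \<bullet> w + l * (v \<bullet> w)" by (simp add: inner_add_right inner_commute)
    ultimately show ?thesis by (simp add: C_def wfv algebra_simps)
  qed
  have "w \<bullet> w = 0"
  proof (rule ccontr)
    assume "w \<bullet> w \<noteq> 0"
    then have pos: "w \<bullet> w > 0" by simp
    \<comment> \<open>The \<open>+ 1\<close> keeps the denominator positive when C = 0, and t C
      still does not exceed w . w.\<close>
    define t where "t = (w \<bullet> w) / (C + 1)"
    have t: "t > 0" using pos C by (simp add: t_def)
    have "2 * (w \<bullet> w) \<le> t * C" using ineq[of t] t by (simp add: power2_eq_square)
    also have "\<dots> \<le> t * (C + 1)" using t by simp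
    also have "\<dots> = w \<bullet> w" using C by (simp add: t_def)
    finally show False using pos by simp
  qed
  then have "f v = l *\<^sub>R v" by (simp add: w_def)
  with v that show thesis by blast
qed

text \<open>Self-adjointness makes the orthogonal complement of an eigenvector inside
  \<open>S\<close> invariant again. The claim is about subspaces so that the induction on the
  dimension can pass to this complement.\<close>

lemma selfadjoint_eigenbasis_subspace:
  fixes f :: "'a::euclidean_space \<Rightarrow> 'a"
  assumes lin: "linear f" and sa: "\<And>x y. f x \<bullet> y = x \<bullet> f y"
    and "real_vector.subspace S" and "\<And>x. x \<in> S \<Longrightarrow> f x \<in> S"
  shows "\<exists>B. pairwise Linear_Algebra.orthogonal B \<and> (\<forall>b\<in>B. norm b = 1 \<and> (\<exists>l. f b = l *\<^sub>R b)) \<and> real_vector.span B = S"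
  using assms(3,4)
proof (induction "real_vector.dim S" arbitrary: S rule: less_induct)
  case (less S)
  show ?case
  proof (cases "S = {0}")
    case True
    then show ?thesis by (intro exI[of _ "{}"]) auto
  next
    case False
    obtain v l where v: "v \<in> S" "norm v = 1" "f v = l *\<^sub>R v"
      using selfadjoint_eigenvector[OF lin sa less.prems(1,2) False] by blast
    have vv: "v \<bullet> v = 1" using v by (simp add: norm_eq_1)
    define S' where "S' = S \<inter> {x. v \<bullet> x = 0}"
    have sub: "real_vector.subspace S'"
      using less.prems(1) unfolding S'_def
      by (intro real_vector.subspaceI) (auto simp: inner_add_right intro: subspace_0 subspace_add subspace_scale)
    have inv: "f x \<in> S'" if "x \<in> S'" for x
      using that less.prems(2) sa[of v x] v by (auto simp: S'_def)
    have "v \<notin> S'" using vv by (simp add: S'_def)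
    then have "S' \<subset> S" using v(1) unfolding S'_def by blast
    then have "real_vector.dim S' < real_vector.dim S"
      using sub less.prems(1) by (metis dim_psubset span_eq_iff)
    from less.hyps[OF this sub inv] obtain B where B: "pairwise Linear_Algebra.orthogonal B"
      "\<forall>b\<in>B. norm b = 1 \<and> (\<exists>l. f b = l *\<^sub>R b)" "real_vector.span B = S'" by blast
    have orth: "v \<bullet> b = 0" if "b \<in> B" for b
      using that span_base[of b B] B(3) by (auto simp: S'_def)
    have "real_vector.span (insert v B) = S"
    proof
      show "real_vector.span (insert v B) \<subseteq> S"
        using v B(3) span_superset[of B] \<open>S' \<subset> S\<close> less.prems(1) by (intro span_minimal) auto
      show "S \<subseteq> real_vector.span (insert v B)"
      proof
        fix x assume x: "x \<in> S"
        have "x - (v \<bullet> x) *\<^sub>R v \<in> real_vector.span B"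
          unfolding B(3) S'_def using x v less.prems(1) vv
          by (auto intro!: subspace_diff subspace_scale simp: inner_diff_right)
        then show "x \<in> real_vector.span (insert v B)" by (auto simp: span_insert)
      qed
    qed
    moreover have "pairwise Linear_Algebra.orthogonal (insert v B)"
      using B(1) orth by (auto simp: pairwise_insert real_inner_class.orthogonal_def inner_commute)
    ultimately show ?thesis using B(2) v by (intro exI[of _ "insert v B"]) auto
  qed
qed

section \<open>Orthonormal bases indexed by the parameters\<close>

definition orthonormal_family :: "('p \<Rightarrow> real ^ 'p) \<Rightarrow> bool" where
  "orthonormal_family e \<longleftrightarrow> (\<forall>i j. e i \<bullet> e j = (if i = j then 1 else 0))"

lemma orthonormal_familyD:
  "orthonormal_family e \<Longrightarrow> e i \<bullet> e j = (if i = j then 1 else 0)"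
  by (simp add: orthonormal_family_def)

text \<open>Counting independent eigenvectors gives \<open>CARD('p)\<close>, so the coordinate type
  itself can index the basis and all later spectral sums run over \<open>UNIV\<close>.\<close>

lemma symmetric_matrix_eigenbasis:
  fixes A :: "real ^ 'p ^ 'p"
  assumes "Finite_Cartesian_Product.transpose A = A"
  obtains e l where "orthonormal_family e" "\<And>i. A *v e i = l i *\<^sub>R e i"
proof -
  have sa: "(A *v x) \<bullet> y = x \<bullet> (A *v y)" for x y
    by (metis assms dot_lmul_matrix vector_transpose_matrix)
  obtain B where B: "pairwise Linear_Algebra.orthogonal B"
      "\<forall>b\<in>B. norm b = 1 \<and> (\<exists>l. A *v b = l *\<^sub>R b)" "real_vector.span B = (UNIV :: (real^'p) set)"
    using selfadjoint_eigenbasis_subspace[of "(*v) A" UNIV] sa by auto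
  have "0 \<notin> B" using B(2) by force
  then have ind: "\<not> real_vector.dependent B" using B(1) pairwise_orthogonal_independent by blast
  then have "card B = DIM(real^'p)"
    using B(3) by (metis dim_UNIV dim_eq_card_independent dim_span)
  then have "card B = CARD('p)" by simp
  moreover have "finite B" using ind independent_bound by blast
  ultimately obtain e :: "'p \<Rightarrow> real^'p" where e: "bij_betw e UNIV B"
    by (metis finite_same_card_bij finite_class.finite_UNIV)
  have eB: "e i \<in> B" for i using e by (auto simp: bij_betw_def)
  have "e i \<bullet> e j = (if i = j then 1 else 0)" for i j
  proof (cases "i = j")
    case True
    then show ?thesis using B(2) eB by (auto simp: norm_eq_1)
  next
    case False
    then have "e i \<noteq> e j" using e by (auto simp: bij_betw_def inj_on_def)
    then show ?thesis using False B(1) eB by (auto simp: pairwise_def real_inner_class.orthogonal_def)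
  qed
  then have "orthonormal_family e" by (simp add: orthonormal_family_def)
  moreover have "\<forall>i. \<exists>l. A *v e i = l *\<^sub>R e i" using B(2) eB by blast
  then have "\<exists>l. \<forall>i. A *v e i = l i *\<^sub>R e i" by (rule choice)
  ultimately show thesis using that by blast
qed

text \<open>A square matrix with orthonormal rows has orthonormal columns, since a one-sided inverse
  of a square matrix is two-sided.\<close>

lemma orthonormal_family_completeness:
  assumes "orthonormal_family e"
  shows "(\<Sum>i\<in>UNIV. e i $ a * e i $ b) = (if a = b then 1 else 0)"
proof -
  define M where "M = (\<chi> i. e i)"
  have "M ** Finite_Cartesian_Product.transpose M = Finite_Cartesian_Product.mat 1"
    using orthonormal_familyD[OF assms]
    by (simp add: M_def matrix_matrix_mult_def Finite_Cartesian_Product.vec_eq_iff Finite_Cartesian_Product.mat_def inner_vec_def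
        Finite_Cartesian_Product.transpose_def)
  then have "Finite_Cartesian_Product.transpose M ** M = Finite_Cartesian_Product.mat 1"
    using matrix_left_right_inverse by blast
  then show ?thesis
    by (simp add: M_def matrix_matrix_mult_def Finite_Cartesian_Product.vec_eq_iff Finite_Cartesian_Product.mat_def
        Finite_Cartesian_Product.transpose_def)
qed

lemma orthonormal_family_expansion:
  assumes "orthonormal_family e"
  shows "(\<Sum>i\<in>UNIV. (e i \<bullet> x) *\<^sub>R e i) = x"
proof (subst Finite_Cartesian_Product.vec_eq_iff, intro allI)
  fix a
  have "(\<Sum>i\<in>UNIV. (e i \<bullet> x) *\<^sub>R e i) $ a = (\<Sum>i\<in>UNIV. \<Sum>b\<in>UNIV. e i $ b * x $ b * e i $ a)"
    by (simp add: inner_vec_def sum_distrib_right)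
  also have "\<dots> = (\<Sum>b\<in>UNIV. x $ b * (\<Sum>i\<in>UNIV. e i $ b * e i $ a))"
    by (subst sum.swap) (simp add: sum_distrib_left mult_ac)
  also have "\<dots> = x $ a"
    by (simp add: orthonormal_family_completeness[OF assms] if_distrib sum.delta cong: if_cong)
  finally show "(\<Sum>i\<in>UNIV. (e i \<bullet> x) *\<^sub>R e i) $ a = x $ a" .
qed

lemma matrix_eqI_basis:
  fixes A B :: "real ^ 'p ^ 'p"
  assumes "orthonormal_family e" "\<And>i. A *v e i = B *v e i"
  shows "A = B"
proof -
  have "A *v x = B *v x" for x
  proof -
    have "A *v (\<Sum>i\<in>UNIV. (e i \<bullet> x) *\<^sub>R e i) = B *v (\<Sum>i\<in>UNIV. (e i \<bullet> x) *\<^sub>R e i)"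
      by (simp add: linear_sum[OF matrix_vector_mul_linear] matrix_vector_mult_scaleR assms(2))
    then show ?thesis by (simp add: orthonormal_family_expansion[OF assms(1)])
  qed
  then show ?thesis by (simp add: matrix_eq)
qed

section \<open>Spectral functions and the positive square root\<close>

definition spectral_matrix :: "('p \<Rightarrow> real) \<Rightarrow> ('p \<Rightarrow> real ^ 'p) \<Rightarrow> real ^ 'p ^ 'p" where
  "spectral_matrix s e = (\<chi> a b. \<Sum>i\<in>UNIV. s i * e i $ a * e i $ b)"

lemma spectral_matrix_mult_vec:
  "spectral_matrix s e *v x = (\<Sum>i\<in>UNIV. (s i * (e i \<bullet> x)) *\<^sub>R e i)"
proof (subst Finite_Cartesian_Product.vec_eq_iff, intro allI)
  fix a
  have "(spectral_matrix s e *v x) $ a = (\<Sum>b\<in>UNIV. \<Sum>i\<in>UNIV. s i * e i $ a * e i $ b * x $ b)"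
    by (simp add: spectral_matrix_def matrix_vector_mult_def sum_distrib_right)
  also have "\<dots> = (\<Sum>i\<in>UNIV. s i * (e i \<bullet> x) * e i $ a)"
    by (subst sum.swap) (simp add: inner_vec_def sum_distrib_left sum_distrib_right mult_ac)
  finally show "(spectral_matrix s e *v x) $ a = (\<Sum>i\<in>UNIV. (s i * (e i \<bullet> x)) *\<^sub>R e i) $ a"
    by simp
qed

lemma spectral_matrix_basis:
  "orthonormal_family e \<Longrightarrow> spectral_matrix s e *v e j = s j *\<^sub>R e j"
  by (simp add: spectral_matrix_mult_vec orthonormal_familyD if_distrib if_distribR sum.delta cong: if_cong)

lemma spectral_matrix_psd:
  assumes "\<And>i. 0 \<le> s i"
  shows "sym_pos_semidef (spectral_matrix s e)"
proof -
  have "x \<bullet> (spectral_matrix s e *v x) = (\<Sum>i\<in>UNIV. s i * (e i \<bullet> x)\<^sup>2)" for x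
    by (simp add: spectral_matrix_mult_vec inner_sum_right power2_eq_square inner_commute mult_ac)
  then show ?thesis using assms
    by (auto simp: sym_pos_semidef_def spectral_matrix_def Finite_Cartesian_Product.vec_eq_iff sum_nonneg
        Finite_Cartesian_Product.transpose_def mult_ac)
qed

lemma psd_eigenvalue_nonneg:
  assumes "sym_pos_semidef A" "orthonormal_family e" "A *v e i = l *\<^sub>R e i"
  shows "0 \<le> l"
proof -
  have "0 \<le> e i \<bullet> (A *v e i)" using assms(1) by (simp add: sym_pos_semidef_def)
  then show ?thesis by (simp add: assms(3) orthonormal_familyD[OF assms(2)])
qed

text \<open>With w = (B - s) v the hypothesis reads (B + s) w = 0, and a positive semidefinite
  \<open>B\<close> has no eigenvalue -s < 0; for s = 0 the norm of \<open>B v\<close> vanishes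
  directly. This is the uniqueness of the positive root, needed to evaluate the \<open>THE\<close>
  in \<open>psd_sqrt\<close>.\<close>

lemma psd_root_eigenvector:
  fixes B :: "real ^ 'p ^ 'p"
  assumes B: "sym_pos_semidef B" and s: "0 \<le> s" and v: "B *v (B *v v) = s\<^sup>2 *\<^sub>R v"
  shows "B *v v = s *\<^sub>R v"
proof -
  define w where "w = B *v v - s *\<^sub>R v"
  have Bw: "B *v w = - s *\<^sub>R w"
    by (simp add: w_def matrix_vector_mult_diff_distrib matrix_vector_mult_scaleR v
        power2_eq_square scaleR_diff_right)
  have sym: "x \<bullet> (B *v y) = (B *v x) \<bullet> y" for x y
    using B by (metis sym_pos_semidef_def dot_lmul_matrix vector_transpose_matrix)
  have "0 \<le> w \<bullet> (B *v w)" using B by (simp add: sym_pos_semidef_def)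
  then have "s * (w \<bullet> w) \<le> 0" by (simp add: Bw)
  then have "w = 0 \<or> s = 0" using s
    by (metis inner_gt_zero_iff less_eq_real_def mult_pos_pos not_less)
  then show ?thesis
  proof
    assume s0: "s = 0"
    have "(B *v v) \<bullet> (B *v v) = v \<bullet> (B *v (B *v v))" by (simp add: sym)
    also have "\<dots> = 0" by (simp add: v s0)
    finally show ?thesis by (simp add: s0)
  qed (simp add: w_def)
qed

lemma spectral_sqrt:
  fixes A :: "real ^ 'p ^ 'p"
  assumes A: "sym_pos_semidef A" and e: "orthonormal_family e" and l: "\<And>i. A *v e i = l i *\<^sub>R e i"
  shows "psd_sqrt A = spectral_matrix (\<lambda>i. sqrt (l i)) e"
proof -
  have l0: "0 \<le> l i" for i using psd_eigenvalue_nonneg[OF A e l] .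
  define R where "R = spectral_matrix (\<lambda>i. sqrt (l i)) e"
  have R: "sym_pos_semidef R" unfolding R_def using l0 by (intro spectral_matrix_psd) auto
  have Re: "R *v e i = sqrt (l i) *\<^sub>R e i" for i unfolding R_def by (rule spectral_matrix_basis[OF e])
  have RR: "R ** R = A"
    by (rule matrix_eqI_basis[OF e])
       (simp add: matrix_vector_mul_assoc[symmetric] Re matrix_vector_mult_scaleR l l0)
  have "(THE B. sym_pos_semidef B \<and> B ** B = A) = R"
  proof (rule the_equality)
    fix B assume B: "sym_pos_semidef B \<and> B ** B = A"
    show "B = R"
    proof (rule matrix_eqI_basis[OF e])
      fix i
      have "B *v (B *v e i) = (sqrt (l i))\<^sup>2 *\<^sub>R e i"
        using B l0 l by (simp add: matrix_vector_mul_assoc)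
      then show "B *v e i = R *v e i"
        using psd_root_eigenvector[of B "sqrt (l i)" "e i"] B l0 by (simp add: Re)
    qed
  qed (use R RR in auto)
  then show ?thesis by (simp add: psd_sqrt_def R_def)
qed

lemma psd_sqrt_props:
  fixes A :: "real ^ 'p ^ 'p"
  assumes A: "sym_pos_semidef A"
  shows "sym_pos_semidef (psd_sqrt A)" "psd_sqrt A ** psd_sqrt A = A"
proof -
  obtain e l where e: "orthonormal_family e" and l: "\<And>i. A *v e i = l i *\<^sub>R e i"
    using symmetric_matrix_eigenbasis A by (metis sym_pos_semidef_def)
  have l0: "0 \<le> l i" for i using psd_eigenvalue_nonneg[OF A e l] .
  show "sym_pos_semidef (psd_sqrt A)"
    unfolding spectral_sqrt[OF A e l] using l0 by (intro spectral_matrix_psd) auto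
  show "psd_sqrt A ** psd_sqrt A = A"
    unfolding spectral_sqrt[OF A e l]
    by (rule matrix_eqI_basis[OF e])
       (simp add: matrix_vector_mul_assoc[symmetric] spectral_matrix_basis[OF e] matrix_vector_mult_scaleR l l0)
qed

lemma gram_matrix_psd:
  fixes B :: "real ^ 'p ^ 'p"
  shows "sym_pos_semidef (Finite_Cartesian_Product.transpose B ** B)"
proof -
  have "x \<bullet> ((Finite_Cartesian_Product.transpose B ** B) *v x) = (B *v x) \<bullet> (B *v x)" for x
    by (metis dot_lmul_matrix matrix_vector_mul_assoc vector_transpose_matrix transpose_transpose)
  then show ?thesis by (simp add: sym_pos_semidef_def matrix_transpose_mul)
qed

section \<open>The trace norm\<close>

lemma trace_spectral_matrix:
  assumes "orthonormal_family e"
  shows "Determinants.trace (spectral_matrix s e) = sum s UNIV"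
proof -
  have "Determinants.trace (spectral_matrix s e) = (\<Sum>i\<in>UNIV. s i * (e i \<bullet> e i))"
    unfolding Determinants.trace_def spectral_matrix_def
    by (simp add: inner_vec_def sum_distrib_left mult_ac, rule sum.swap)
  then show ?thesis by (simp add: orthonormal_familyD[OF assms])
qed

lemma trace_norm_nonneg: "0 \<le> trace_norm (B :: real ^ 'p ^ 'p)"
proof -
  let ?A = "Finite_Cartesian_Product.transpose B ** B"
  obtain e l where e: "orthonormal_family e" and l: "\<And>i. ?A *v e i = l i *\<^sub>R e i"
    using symmetric_matrix_eigenbasis gram_matrix_psd by (metis sym_pos_semidef_def)
  have "0 \<le> l i" for i using psd_eigenvalue_nonneg[OF gram_matrix_psd e l] .
  then show ?thesis
    by (simp add: trace_norm_def spectral_sqrt[OF gram_matrix_psd e l] trace_spectral_matrix[OF e] sum_nonneg)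
qed

text \<open>Here \<open>e\<close> diagonalises B^T B and \<open>g\<close> is the other side of the
  polar decomposition, so B e_i is the i-th singular value times g_i. That singular value is (B e_i)
  . g_i, and antisymmetry turns it into - e_i . (B g_i), which is where the minus sign comes
  from.\<close>

lemma trace_norm_antisymmetric:
  fixes B :: "real ^ 'p ^ 'p"
  assumes B: "Finite_Cartesian_Product.transpose B = - B"
  obtains e g where "orthonormal_family e" "orthonormal_family g"
    "trace_norm B = - (\<Sum>i\<in>UNIV. e i \<bullet> (B *v g i))"
proof -
  let ?A = "Finite_Cartesian_Product.transpose B ** B"
  obtain e l where e: "orthonormal_family e" and l: "\<And>i. ?A *v e i = l i *\<^sub>R e i"
    using symmetric_matrix_eigenbasis gram_matrix_psd by (metis sym_pos_semidef_def)
  have l0: "0 \<le> l i" for i using psd_eigenvalue_nonneg[OF gram_matrix_psd e l] .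
  have anti: "x \<bullet> (B *v y) = - ((B *v x) \<bullet> y)" for x y
  proof -
    have "x \<bullet> (B *v y) = (Finite_Cartesian_Product.transpose B *v x) \<bullet> y"
      by (simp only: transpose_matrix_vector dot_lmul_matrix)
    moreover have "(- B) *v x = - (B *v x)"
      by (simp add: matrix_vector_mult_def Finite_Cartesian_Product.vec_eq_iff sum_negf)
    ultimately show ?thesis by (simp add: B)
  qed
  have BB: "(B *v x) \<bullet> (B *v y) = x \<bullet> (?A *v y)" for x y
    unfolding matrix_vector_mul_assoc[symmetric] dot_lmul_matrix[symmetric] vector_transpose_matrix ..
  have BBe: "(B *v e i) \<bullet> (B *v e j) = (if i = j then l i else 0)" for i j
    by (simp add: BB l orthonormal_familyD[OF e])
  \<comment> \<open>On the kernel of \<open>B\<close> the partial isometry is completed by the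
    identity. This keeps \<open>g\<close> orthonormal because antisymmetry makes the range of
    \<open>B\<close> orthogonal to its kernel.\<close>
  define g where "g i = (if l i = 0 then e i else (B *v e i) /\<^sub>R sqrt (l i))" for i
  have ker: "B *v e i = 0" if "l i = 0" for i using BBe[of i i] that by simp
  have "g i \<bullet> g j = (if i = j then 1 else 0)" for i j
  proof -
    have "e i \<bullet> (B *v e j) = 0" if "l i = 0" for i j
      using ker[OF that] anti[of "e i" "e j"] by simp
    moreover from this have "(B *v e j) \<bullet> e i = 0" if "l i = 0" for i j
      using that by (simp add: inner_commute)
    moreover have "inverse (sqrt (l i)) * (inverse (sqrt (l i)) * l i) = 1" if "l i \<noteq> 0" for i
      using l0[of i] that by (simp add: field_simps)
    ultimately show ?thesis
      by (auto simp: g_def orthonormal_familyD[OF e] BBe)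
  qed
  then have g: "orthonormal_family g" by (simp add: orthonormal_family_def)
  have "e i \<bullet> (B *v g i) = - sqrt (l i)" for i
  proof (cases "l i = 0")
    case True
    then show ?thesis by (simp add: g_def ker)
  next
    case False
    have "e i \<bullet> (B *v g i) = - (l i / sqrt (l i))"
      unfolding anti[of "e i" "g i"] using False by (simp add: g_def BBe divide_inverse)
    then show ?thesis using l0 by (simp add: real_div_sqrt)
  qed
  then have "trace_norm B = - (\<Sum>i\<in>UNIV. e i \<bullet> (B *v g i))"
    by (simp add: trace_norm_def spectral_sqrt[OF gram_matrix_psd e l] trace_spectral_matrix[OF e] sum_negf)
  with e g that show thesis by blast
qed

lemma psd_sqrt_psd_def:
  assumes "sym_pos_def (W :: real ^ 'p ^ 'p)"
  shows "Finite_Cartesian_Product.transpose (psd_sqrt W) = psd_sqrt W" "psd_sqrt W ** psd_sqrt W = W"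
proof -
  have "sym_pos_semidef W"
    using assms unfolding sym_pos_def_def sym_pos_semidef_def
    by (metis inner_zero_left order.strict_implies_order order_refl)
  from psd_sqrt_props[OF this] 
  show "Finite_Cartesian_Product.transpose (psd_sqrt W) = psd_sqrt W" "psd_sqrt W ** psd_sqrt W = W"
    by (auto simp: sym_pos_semidef_def)
qed

lemma sum_congruence_orthonormal:
  fixes R :: "real ^ 'p ^ 'p"
  assumes "orthonormal_family e"
  shows "(\<Sum>i\<in>UNIV. (R *v e i) $ a * (R *v e i) $ b) = (R ** Finite_Cartesian_Product.transpose R) $ a $ b"
proof -
  have "(\<Sum>i\<in>UNIV. (R *v e i) $ a * (R *v e i) $ b)
      = (\<Sum>i\<in>UNIV. \<Sum>c\<in>UNIV. \<Sum>d\<in>UNIV. R $ a $ c * R $ b $ d * (e i $ c * e i $ d))"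
    by (simp add: matrix_vector_mult_def sum_product mult_ac)
  also have "\<dots> = (\<Sum>c\<in>UNIV. \<Sum>d\<in>UNIV. R $ a $ c * R $ b $ d * (\<Sum>i\<in>UNIV. e i $ c * e i $ d))"
    by (subst sum.swap, rule sum.cong[OF refl], subst sum.swap) (simp add: sum_distrib_left)
  also have "\<dots> = (\<Sum>c\<in>UNIV. R $ a $ c * R $ b $ c)"
    by (simp add: orthonormal_family_completeness[OF assms] if_distrib sum.delta cong: if_cong)
  also have "\<dots> = (R ** Finite_Cartesian_Product.transpose R) $ a $ b"
    by (simp add: matrix_matrix_mult_def Finite_Cartesian_Product.transpose_def)
  finally show ?thesis .
qed

lemma trace_mult_symmetric:
  fixes W A :: "real ^ 'p ^ 'p"
  assumes "Finite_Cartesian_Product.transpose W = W"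
  shows "Determinants.trace (W ** A) = (\<Sum>a\<in>UNIV. \<Sum>b\<in>UNIV. W $ a $ b * A $ a $ b)"
proof -
  have "W $ a $ b = W $ b $ a" for a b
    using assms by (metis Finite_Cartesian_Product.transpose_def vec_lambda_beta)
  then have "Determinants.trace (W ** A) = (\<Sum>a\<in>UNIV. \<Sum>b\<in>UNIV. W $ b $ a * A $ b $ a)"
    by (simp add: Determinants.trace_def matrix_matrix_mult_def)
  then show ?thesis by (subst (asm) sum.swap)
qed

text \<open>A rank-one decomposition of the optimal dual matrix \<open>Y = W + i A \<ge> 0\<close> of the semidefinite
  program behind the Holevo functional. It comes from the polar decomposition of
  \<open>B = \<surd>W Im Z \<surd>W\<close>: with \<open>B e = |B| g\<close> one takes \<open>c = \<surd>W (e + i g) / \<surd>2\<close>.\<close>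

lemma holevo_dual_family:
  fixes W :: "real ^ 'p ^ 'p" and Z :: "complex ^ 'p ^ 'p"
  assumes W: "sym_pos_def W" and Z: "\<And>a b. Z $ b $ a = cnj (Z $ a $ b)"
  shows "\<exists>c :: 'p \<Rightarrow> 'p \<Rightarrow> complex.
    (\<forall>a b. (\<Sum>r\<in>UNIV. Re (cnj (c r a) * c r b)) = W $ a $ b) \<and>
    (\<Sum>r\<in>UNIV. \<Sum>a\<in>UNIV. \<Sum>b\<in>UNIV. Re (cnj (c r a) * c r b * Z $ a $ b))
       = Determinants.trace (W ** Re_matrix Z) + trace_norm (psd_sqrt W ** Im_matrix Z ** psd_sqrt W)"
proof -
  define R where "R = psd_sqrt W"
  have R: "Finite_Cartesian_Product.transpose R = R" "R ** R = W"
    using psd_sqrt_psd_def[OF W] by (auto simp: R_def)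
  define I where "I = Im_matrix Z"
  have Iab: "I $ b $ a = - I $ a $ b" for a b
    by (simp add: I_def Im_matrix_def Z[of b a])
  define B where "B = R ** I ** R"
  have "Finite_Cartesian_Product.transpose I = - I"
    by (simp add: Finite_Cartesian_Product.vec_eq_iff Finite_Cartesian_Product.transpose_def Iab[symmetric])
  moreover have "R ** (- I) = - (R ** I)" "(- (R ** I)) ** R = - (R ** I ** R)"
    by (simp_all add: Finite_Cartesian_Product.vec_eq_iff matrix_matrix_mult_def sum_negf)
  ultimately have "Finite_Cartesian_Product.transpose B = - B"
    by (simp add: B_def matrix_transpose_mul R matrix_mul_assoc)
  then obtain e g where e: "orthonormal_family e" and g: "orthonormal_family g"
    and tn: "trace_norm B = - (\<Sum>i\<in>UNIV. e i \<bullet> (B *v g i))"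
    by (rule trace_norm_antisymmetric)
  define x where "x i = R *v e i" for i
  define y where "y i = R *v g i" for i
  define c where "c i a = Complex (x i $ a / sqrt 2) (y i $ a / sqrt 2)" for i a
  have Re_c: "Re (cnj (c i a) * c i b) = (x i $ a * x i $ b + y i $ a * y i $ b) / 2" for i a b
    by (simp add: c_def add_divide_distrib)
  have Im_c: "Im (cnj (c i a) * c i b) = (x i $ a * y i $ b - y i $ a * x i $ b) / 2" for i a b
    by (simp add: c_def diff_divide_distrib)
  \<comment> \<open>Pushed through \<open>R\<close>, each of the two bases gives R R^T = W by
    completeness; the factors 1 / sqrt 2 in \<open>c\<close> average the two copies of
    \<open>W\<close>.\<close>
  have Y: "(\<Sum>r\<in>UNIV. Re (cnj (c r a) * c r b)) = W $ a $ b" for a b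
    unfolding Re_c using sum_congruence_orthonormal[OF e, of R a b] sum_congruence_orthonormal[OF g, of R a b]
    by (simp add: x_def y_def sum.distrib sum_divide_distrib[symmetric] R)
  \<comment> \<open>Both the imaginary part of a rank-one piece and \<open>I\<close> are
    antisymmetric, so the two halves of the antisymmetrisation contribute equally and absorb the
    factor 1/2.\<close>
  have im: "(\<Sum>a\<in>UNIV. \<Sum>b\<in>UNIV. Im (cnj (c r a) * c r b) * I $ a $ b) = e r \<bullet> (B *v g r)" for r
  proof -
    have "(\<Sum>a\<in>UNIV. \<Sum>b\<in>UNIV. y r $ a * x r $ b * I $ a $ b)
        = (\<Sum>a\<in>UNIV. \<Sum>b\<in>UNIV. y r $ b * x r $ a * I $ b $ a)" by (rule sum.swap)
    also have "\<dots> = (\<Sum>a\<in>UNIV. \<Sum>b\<in>UNIV. - (x r $ a * y r $ b * I $ a $ b))"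
      by (intro sum.cong refl) (subst Iab, simp)
    finally have "(\<Sum>a\<in>UNIV. \<Sum>b\<in>UNIV. y r $ a * x r $ b * I $ a $ b)
        = - (\<Sum>a\<in>UNIV. \<Sum>b\<in>UNIV. x r $ a * y r $ b * I $ a $ b)"
      by (simp only: sum_negf)
    then have "(\<Sum>a\<in>UNIV. \<Sum>b\<in>UNIV. Im (cnj (c r a) * c r b) * I $ a $ b)
        = (\<Sum>a\<in>UNIV. \<Sum>b\<in>UNIV. x r $ a * y r $ b * I $ a $ b)"
      unfolding Im_c by (simp add: diff_divide_distrib left_diff_distrib sum_subtractf sum_divide_distrib[symmetric])
    also have "\<dots> = x r \<bullet> (I *v y r)"
      by (simp add: inner_vec_def matrix_vector_mult_def sum_distrib_left mult_ac)
    also have "\<dots> = e r \<bullet> (B *v g r)"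
    proof -
      have "(R *v u) \<bullet> v = u \<bullet> (R *v v)" for u v
        using transpose_matrix_vector[of R u] by (simp add: R(1) dot_lmul_matrix)
      then show ?thesis by (simp add: x_def y_def B_def matrix_vector_mul_assoc[symmetric])
    qed
    finally show ?thesis .
  qed
  have "(\<Sum>r\<in>UNIV. \<Sum>a\<in>UNIV. \<Sum>b\<in>UNIV. Re (cnj (c r a) * c r b * Z $ a $ b))
      = (\<Sum>r\<in>UNIV. \<Sum>a\<in>UNIV. \<Sum>b\<in>UNIV. Re (cnj (c r a) * c r b) * Re_matrix Z $ a $ b)
        - (\<Sum>r\<in>UNIV. \<Sum>a\<in>UNIV. \<Sum>b\<in>UNIV. Im (cnj (c r a) * c r b) * I $ a $ b)"
    by (simp add: I_def Re_matrix_def Im_matrix_def sum_subtractf)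
  also have "(\<Sum>r\<in>UNIV. \<Sum>a\<in>UNIV. \<Sum>b\<in>UNIV. Re (cnj (c r a) * c r b) * Re_matrix Z $ a $ b)
      = (\<Sum>a\<in>UNIV. \<Sum>b\<in>UNIV. W $ a $ b * Re_matrix Z $ a $ b)"
    by (subst sum.swap, rule sum.cong[OF refl], subst sum.swap)
       (simp only: sum_distrib_right[symmetric] Y)
  also have "\<dots> = Determinants.trace (W ** Re_matrix Z)"
    using W by (simp add: trace_mult_symmetric sym_pos_def_def)
  \<comment> \<open>The minus sign in Re (u v) = Re u Re v - Im u Im v meets the one in the formula
    for the trace norm, so the trace norm enters with a plus.\<close>
  also have "(\<Sum>r\<in>UNIV. \<Sum>a\<in>UNIV. \<Sum>b\<in>UNIV. Im (cnj (c r a) * c r b) * I $ a $ b) = - trace_norm B"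
    by (simp only: im tn minus_minus)
  finally have "(\<Sum>r\<in>UNIV. \<Sum>a\<in>UNIV. \<Sum>b\<in>UNIV. Re (cnj (c r a) * c r b * Z $ a $ b))
      = Determinants.trace (W ** Re_matrix Z) + trace_norm B" by simp
  then show ?thesis using Y unfolding B_def R_def I_def by blast
qed

text \<open>For symmetric \<open>W\<close> this is W >= w in the Loewner order, stated by duality:
  it is tested on coefficients of nonnegative quadratic forms, the shape in which traces of kernels
  arrive later.\<close>

definition weight_coercive :: "real ^ 'p ^ 'p \<Rightarrow> real \<Rightarrow> bool" where
  "weight_coercive W w \<longleftrightarrow> 0 < w \<and>
     (\<forall>g :: 'p \<Rightarrow> 'p \<Rightarrow> real. (\<forall>x. 0 \<le> (\<Sum>a\<in>UNIV. \<Sum>b\<in>UNIV. x a * x b * g a b)) \<longrightarrow>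
        w * (\<Sum>a\<in>UNIV. g a a) \<le> (\<Sum>a\<in>UNIV. \<Sum>b\<in>UNIV. W $ a $ b * g a b))"

text \<open>In an eigenbasis of \<open>W\<close> the pairing with \<open>g\<close> is the sum of all
  l_i q_i and the trace of \<open>g\<close> is the sum of all q_i, where q_i >= 0 is the value of
  the form at e_i. So \<open>w\<close> can be the smallest eigenvalue.\<close>

lemma sym_pos_def_coercive:
  fixes W :: "real ^ 'p ^ 'p"
  assumes W: "sym_pos_def W"
  shows "\<exists>w. weight_coercive W w"
proof -
  obtain e l where e: "orthonormal_family e" and l: "\<And>i. W *v e i = l i *\<^sub>R e i"
    using symmetric_matrix_eigenbasis W by (metis sym_pos_def_def)
  have l0: "0 < l i" for i
  proof -
    have "e i \<noteq> 0" using orthonormal_familyD[OF e, of i i] by auto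
    then have "0 < e i \<bullet> (W *v e i)" using W by (simp add: sym_pos_def_def)
    then show ?thesis by (simp add: l orthonormal_familyD[OF e])
  qed
  have Weq: "W = spectral_matrix l e"
    by (rule matrix_eqI_basis[OF e]) (simp add: l spectral_matrix_basis[OF e])
  define w where "w = Min (range l)"
  have w: "0 < w" "w \<le> l i" for i using l0 by (auto simp: w_def)
  have "w * (\<Sum>a\<in>UNIV. g a a) \<le> (\<Sum>a\<in>UNIV. \<Sum>b\<in>UNIV. W $ a $ b * g a b)"
    if g: "\<forall>x. 0 \<le> (\<Sum>a\<in>UNIV. \<Sum>b\<in>UNIV. x a * x b * g a b)" for g :: "'p \<Rightarrow> 'p \<Rightarrow> real"
  proof -
    define q where "q i = (\<Sum>a\<in>UNIV. \<Sum>b\<in>UNIV. e i $ a * e i $ b * g a b)" for i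
    have swap: "(\<Sum>i\<in>UNIV. s i * q i) = (\<Sum>a\<in>UNIV. \<Sum>b\<in>UNIV. (\<Sum>i\<in>UNIV. s i * e i $ a * e i $ b) * g a b)" for s
      unfolding q_def sum_distrib_left sum_distrib_right
      by (subst sum.swap, rule sum.cong[OF refl], subst sum.swap) (simp add: mult_ac)
    have "w * (\<Sum>i\<in>UNIV. q i) \<le> (\<Sum>i\<in>UNIV. l i * q i)"
      unfolding sum_distrib_left by (intro sum_mono mult_right_mono w) (simp add: q_def g)
    moreover have "(\<Sum>i\<in>UNIV. l i * q i) = (\<Sum>a\<in>UNIV. \<Sum>b\<in>UNIV. W $ a $ b * g a b)"
      by (simp add: swap Weq spectral_matrix_def)
    moreover have "(\<Sum>i\<in>UNIV. q i) = (\<Sum>a\<in>UNIV. g a a)"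
      using swap[of "\<lambda>_. 1"]
      by (simp add: orthonormal_family_completeness[OF e] if_distrib[of "\<lambda>x. x * _"] cong: if_cong)
    ultimately show ?thesis by simp
  qed
  with w(1) show ?thesis by (auto simp: weight_coercive_def)
qed

section \<open>Joint diagonalization of commuting Hermitian matrices\<close>

lemma mat_adjoint_dim [simp]: "dim_row (mat_adjoint A) = dim_col A" "dim_col (mat_adjoint A) = dim_row A"
  by (simp_all add: mat_adjoint_def)

lemma mat_adjoint_carrier [simp]: "A \<in> carrier_mat n m \<Longrightarrow> mat_adjoint A \<in> carrier_mat m n"
  by (rule carrier_matI) auto

lemma mat_adjoint_index:
  fixes A :: "complex mat"
  assumes "i < dim_col A" "j < dim_row A"
  shows "mat_adjoint A $$ (i, j) = cnj (A $$ (j, i))"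
  using assms by (simp add: mat_adjoint_def mat_of_rows_index)

lemma hermitian_op_iff:
  "hermitian_op N A \<longleftrightarrow> A \<in> carrier_mat N N \<and> (\<forall>i<N. \<forall>j<N. A $$ (j, i) = cnj (A $$ (i, j)))"
proof (cases "A \<in> carrier_mat N N")
  case True
  then have "mat_adjoint A = A \<longleftrightarrow> (\<forall>i<N. \<forall>j<N. mat_adjoint A $$ (j, i) = A $$ (j, i))"
    by (auto simp: mat_eq_iff)
  with True show ?thesis unfolding hermitian_op_def by (metis carrier_matD mat_adjoint_index)
qed (simp add: hermitian_op_def)

lemma hermitian_op_carrier [simp]: "hermitian_op N A \<Longrightarrow> A \<in> carrier_mat N N"
  by (simp add: hermitian_op_def)

lemma hermitian_op_index:
  "hermitian_op N A \<Longrightarrow> i < N \<Longrightarrow> j < N \<Longrightarrow> cnj (A $$ (i, j)) = A $$ (j, i)"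
  by (metis hermitian_op_iff)

lemma cscalar_prod_sum:
  fixes v w :: "complex Matrix.vec"
  assumes "w \<in> carrier_vec N"
  shows "v \<bullet>c w = (\<Sum>a<N. vec_index v a * cnj (vec_index w a))"
  using assms by (auto simp: scalar_prod_def atLeast0LessThan intro!: sum.cong)

lemma mult_mat_vec_sum:
  fixes A :: "complex mat"
  assumes "A \<in> carrier_mat n N" "v \<in> carrier_vec N" "a < n"
  shows "vec_index (A *\<^sub>v v) a = (\<Sum>b<N. A $$ (a, b) * vec_index v b)"
  using assms by (auto simp: scalar_prod_def atLeast0LessThan intro!: sum.cong)

lemma mult_mat_sum:
  fixes A B :: "complex mat"
  assumes "A \<in> carrier_mat n N" "B \<in> carrier_mat N m" "a < n" "b < m"
  shows "(A * B) $$ (a, b) = (\<Sum>k<N. A $$ (a, k) * B $$ (k, b))"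
  using assms by (auto simp: scalar_prod_def atLeast0LessThan intro!: sum.cong)

lemma hermitian_op_cscalar:
  assumes X: "hermitian_op N X" and u: "u \<in> carrier_vec N" and v: "v \<in> carrier_vec N"
  shows "(X *\<^sub>v u) \<bullet>c v = u \<bullet>c (X *\<^sub>v v)"
proof -
  have XN: "X \<in> carrier_mat N N" using X by simp
  have "(X *\<^sub>v u) \<bullet>c v = (\<Sum>a<N. \<Sum>b<N. X $$ (a, b) * vec_index u b * cnj (vec_index v a))"
    using v mult_mat_vec_sum[OF XN u] by (simp add: cscalar_prod_sum sum_distrib_right)
  also have "\<dots> = (\<Sum>b<N. \<Sum>a<N. vec_index u b * cnj (X $$ (b, a) * vec_index v a))"
    by (subst sum.swap) (auto simp: hermitian_op_index[OF X] mult_ac intro!: sum.cong)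
  also have "\<dots> = u \<bullet>c (X *\<^sub>v v)"
    using mult_mat_vec_sum[OF XN v] XN v 
    by (simp add: cscalar_prod_sum[OF mult_mat_vec_carrier[OF XN v]] sum_distrib_left)
  finally show ?thesis .
qed

text \<open>The equations are padded with zero rows to a square matrix. Row \<open>k\<close> is one
  of these, which makes the determinant vanish and yields a kernel vector.\<close>

lemma underdetermined_system:
  fixes A :: "nat \<Rightarrow> nat \<Rightarrow> complex"
  assumes "k < N"
  obtains c where "\<exists>j<N. c j \<noteq> 0" "\<And>i. i < k \<Longrightarrow> (\<Sum>j<N. A i j * c j) = 0"
proof -
  define M where "M = Matrix.mat N N (\<lambda>(i, j). if i < k then A i j else 0)"
  have M: "M \<in> carrier_mat N N" by (simp add: M_def)
  have "M = mat\<^sub>r N N (\<lambda>i. if i = k then 0\<^sub>v N else Matrix.row M i)"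
    by (intro eq_matI) (auto simp: M_def)
  then have "Determinant.det M = Determinant.det (mat\<^sub>r N N (\<lambda>i. if i = k then 0\<^sub>v N else Matrix.row M i))"
    by (rule arg_cong)
  also have "\<dots> = 0" using M by (intro det_row_0[OF assms]) auto
  finally have "Determinant.det M = 0" .
  then obtain v where v: "v \<in> carrier_vec N" "v \<noteq> 0\<^sub>v N" "M *\<^sub>v v = 0\<^sub>v N"
    using det_0_iff_vec_prod_zero[OF M] by blast
  show thesis
  proof (rule that)
    show "\<exists>j<N. vec_index v j \<noteq> 0" using v by (auto simp: vec_eq_iff)
    fix i assume i: "i < k"
    with assms have "vec_index (M *\<^sub>v v) i = (\<Sum>j<N. M $$ (i, j) * vec_index v j)"
      by (intro mult_mat_vec_sum[OF M v(1)]) auto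
    with v(3) i assms show "(\<Sum>j<N. A i j * vec_index v j) = 0" by (simp add: M_def)
  qed
qed

section \<open>Eigenvectors inside invariant subspaces\<close>

definition invariant_subspace :: "nat \<Rightarrow> complex mat \<Rightarrow> complex Matrix.vec set \<Rightarrow> bool" where
  "invariant_subspace N X U \<longleftrightarrow> U \<subseteq> carrier_vec N \<and> (\<forall>u\<in>U. \<forall>v\<in>U. u + v \<in> U) \<and>
     (\<forall>u\<in>U. \<forall>z. z \<cdot>\<^sub>v u \<in> U) \<and> (\<forall>u\<in>U. X *\<^sub>v u \<in> U)"

text \<open>This is the vector p(X) v, computed by Horner's scheme.\<close>

definition poly_apply :: "nat \<Rightarrow> complex mat \<Rightarrow> complex Matrix.vec \<Rightarrow> complex poly \<Rightarrow> complex Matrix.vec" where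
  "poly_apply N X v p = fold_coeffs (\<lambda>a u. a \<cdot>\<^sub>v v + X *\<^sub>v u) p (0\<^sub>v N)"

context
  fixes N :: nat and X :: "complex mat" and v :: "complex Matrix.vec"
  assumes X: "X \<in> carrier_mat N N" and v: "v \<in> carrier_vec N"
begin

lemma poly_apply_0: "poly_apply N X v 0 = 0\<^sub>v N"
  by (simp add: poly_apply_def)

lemma poly_apply_pCons: "poly_apply N X v (pCons a p) = a \<cdot>\<^sub>v v + X *\<^sub>v poly_apply N X v p"
\<comment> \<open>\<open>fold_coeffs\<close> performs no step on the zero polynomial, so only in
  this case does the Horner recursion not unfold by itself.\<close>
proof (cases "a = 0 \<and> p = 0")
  case True
  then show ?thesis using X v by (auto simp: poly_apply_0)
next
  case False
  then show ?thesis by (auto simp: poly_apply_def)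
qed

lemma poly_apply_carrier: "poly_apply N X v p \<in> carrier_vec N"
  by (induction p) (use X v in \<open>auto simp: poly_apply_0 poly_apply_pCons\<close>)

lemma poly_apply_add: "poly_apply N X v (p + q) = poly_apply N X v p + poly_apply N X v q"
proof (induction p q rule: poly_induct2)
  case (pCons a p b q)
  have "X *\<^sub>v (poly_apply N X v p + poly_apply N X v q) = X *\<^sub>v poly_apply N X v p + X *\<^sub>v poly_apply N X v q"
    by (rule mult_add_distrib_mat_vec[OF X poly_apply_carrier poly_apply_carrier])
  moreover have "X *\<^sub>v poly_apply N X v r \<in> carrier_vec N" for r using X poly_apply_carrier by simp
  ultimately show ?case using v pCons
    by (auto simp: poly_apply_pCons intro!: eq_vecI simp: carrier_matD[OF X] carrier_vecD[OF v] algebra_simps simp del: index_mult_mat_vec)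
qed (simp add: poly_apply_0)

lemma poly_apply_smult: "poly_apply N X v (Polynomial.smult c p) = c \<cdot>\<^sub>v poly_apply N X v p"
proof (induction p)
  case (pCons a p)
  have "X *\<^sub>v (c \<cdot>\<^sub>v poly_apply N X v p) = c \<cdot>\<^sub>v (X *\<^sub>v poly_apply N X v p)"
    by (rule mult_mat_vec[OF X poly_apply_carrier])
  moreover have "X *\<^sub>v poly_apply N X v r \<in> carrier_vec N" for r using X poly_apply_carrier by simp
  ultimately show ?case using v pCons
    by (auto simp: poly_apply_pCons intro!: eq_vecI simp: carrier_matD[OF X] carrier_vecD[OF v] algebra_simps simp del: index_mult_mat_vec)
qed (auto simp: poly_apply_0)

lemma poly_apply_linear_factor:
  "poly_apply N X v ([:-a, 1:] * q) = (- a) \<cdot>\<^sub>v poly_apply N X v q + X *\<^sub>v poly_apply N X v q"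
proof -
  have "[:-a, 1:] * q = Polynomial.smult (-a) q + pCons 0 q" by simp
  moreover have "X *\<^sub>v poly_apply N X v q \<in> carrier_vec N" using X poly_apply_carrier by simp
  then have "0 \<cdot>\<^sub>v v + X *\<^sub>v poly_apply N X v q = X *\<^sub>v poly_apply N X v q"
    using X v by (intro eq_vecI) auto
  ultimately show ?thesis
    by (simp only: poly_apply_add poly_apply_smult poly_apply_pCons)
qed

text \<open>The N + 1 Krylov vectors v, X v, ..., X^N v in dimension N are linearly
  dependent.\<close>

lemma annihilating_poly:
  obtains p where "p \<noteq> 0" "poly_apply N X v p = 0\<^sub>v N"
proof -
  obtain c where c: "\<exists>j<Suc N. c j \<noteq> 0"
    and z: "\<And>a. a < N \<Longrightarrow> (\<Sum>j<Suc N. vec_index (poly_apply N X v (monom 1 j)) a * c j) = 0"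
    using underdetermined_system[of N "Suc N" "\<lambda>a j. vec_index (poly_apply N X v (monom 1 j)) a"]
    by (metis lessI)
  define p where "p m = (\<Sum>j<m. monom (c j) j)" for m
  have "vec_index (poly_apply N X v (p m)) a = (\<Sum>j<m. vec_index (poly_apply N X v (monom 1 j)) a * c j)"
    if "a < N" for m a
  proof (induction m)
    case 0
    then show ?case using that by (simp add: p_def poly_apply_0)
  next
    case (Suc m)
    have "p (Suc m) = p m + Polynomial.smult (c m) (monom 1 m)" by (simp add: p_def smult_monom)
    then show ?case using Suc that poly_apply_carrier[THEN carrier_vecD]
      by (simp add: poly_apply_add poly_apply_smult mult_ac)
  qed
  then have "poly_apply N X v (p (Suc N)) = 0\<^sub>v N"
    using z poly_apply_carrier[THEN carrier_vecD] by (intro eq_vecI) auto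
  moreover have "coeff (p (Suc N)) j = c j" if "j < Suc N" for j
    using that by (simp add: p_def coeff_sum coeff_monom del: sum.lessThan_Suc)
  then have "p (Suc N) \<noteq> 0" using c by force
  ultimately show thesis using that by blast
qed

lemma poly_apply_invariant:
  assumes "invariant_subspace N X U" "v \<in> U"
  shows "poly_apply N X v p \<in> U"
proof (induction p)
  case 0
  \<comment> \<open>The closure conditions do not list the zero vector; it lies in \<open>U\<close>
    as the zero multiple of \<open>v\<close>.\<close>
  have "0 \<cdot>\<^sub>v v = 0\<^sub>v N" using v by auto
  then show ?case using assms by (metis invariant_subspace_def poly_apply_0)
next
  case (pCons a p)
  then show ?case using assms by (simp add: poly_apply_pCons invariant_subspace_def)
qed

end

text \<open>Split off a root \<open>a\<close> of an annihilating polynomial, p = (x - a) q. Either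
  q(X) v is nonzero, and then it is an eigenvector for \<open>a\<close>, or \<open>q\<close>
  annihilates \<open>v\<close> with smaller degree. The eigenvector stays in \<open>U\<close>
  because it is a polynomial in \<open>X\<close> applied to \<open>v\<close>.\<close>

lemma invariant_subspace_eigenvector:
  assumes X: "X \<in> carrier_mat N N" and U: "invariant_subspace N X U" and v: "v \<in> U" "v \<noteq> 0\<^sub>v N"
  obtains u l where "u \<in> U" "u \<noteq> 0\<^sub>v N" "X *\<^sub>v u = l \<cdot>\<^sub>v u"
proof -
  have vN: "v \<in> carrier_vec N" using U v by (auto simp: invariant_subspace_def)
  have "\<exists>u\<in>U. u \<noteq> 0\<^sub>v N \<and> (\<exists>l. X *\<^sub>v u = l \<cdot>\<^sub>v u)" if "p \<noteq> 0" "poly_apply N X v p = 0\<^sub>v N" for p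
    using that
  proof (induction "degree p" arbitrary: p rule: less_induct)
    case (less p)
    show ?case
    proof (cases "degree p = 0")
      case True
      then obtain a where p: "p = [:a:]" by (metis degree_eq_zeroE)
      have "X *\<^sub>v 0\<^sub>v N = 0\<^sub>v N" using X by auto
      then have "a \<cdot>\<^sub>v v = 0\<^sub>v N"
        using less.prems vN by (simp add: p poly_apply_pCons[OF X vN] poly_apply_0[OF X vN])
      then have "\<forall>i<N. a * vec_index v i = 0" using vN
        by (metis carrier_vecD index_smult_vec(1) index_zero_vec(1))
      moreover have "a \<noteq> 0" using less.prems p by simp
      ultimately have "v = 0\<^sub>v N" using vN by (intro eq_vecI) auto
      with v show ?thesis by simp
    next
      case False
      then obtain a where "poly p a = 0"
        using fundamental_theorem_of_algebra constant_degree by metis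
      then obtain q where p: "p = [:-a, 1:] * q" by (metis poly_eq_0_iff_dvd dvdE)
      have q: "q \<noteq> 0" using less.prems p by auto
      then have deg: "degree q < degree p" 
        using degree_mult_eq[of "[:-a, 1:]" q] unfolding p by (simp del: mult_pCons_left)
      let ?w = "poly_apply N X v q"
      have w: "?w \<in> carrier_vec N" by (rule poly_apply_carrier[OF X vN])
      show ?thesis
      proof (cases "?w = 0\<^sub>v N")
        case True
        then show ?thesis using less.hyps[OF deg q] by blast
      next
        case False
        have Xw: "X *\<^sub>v ?w \<in> carrier_vec N" using X w by simp
        have sum0: "(- a) \<cdot>\<^sub>v ?w + X *\<^sub>v ?w = 0\<^sub>v N"
          using less.prems(2) unfolding p poly_apply_linear_factor[OF X vN] .
        have "X *\<^sub>v ?w = a \<cdot>\<^sub>v ?w"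
        proof (rule eq_vecI)
          fix i assume "i < dim_vec (a \<cdot>\<^sub>v ?w)"
          then have i: "i < N" using w by simp
          have "vec_index ((- a) \<cdot>\<^sub>v ?w + X *\<^sub>v ?w) i = 0" using i by (simp add: sum0)
          then show "vec_index (X *\<^sub>v ?w) i = vec_index (a \<cdot>\<^sub>v ?w) i"
            using i w X by (simp add: carrier_vecD[OF w] carrier_matD[OF X] add_eq_0_iff del: index_mult_mat_vec)
        qed (use w X in auto)
        moreover have "?w \<in> U" by (rule poly_apply_invariant[OF X vN U v(1)])
        ultimately show ?thesis using False by blast
      qed
    qed
  qed
  moreover obtain p where "p \<noteq> 0" "poly_apply N X v p = 0\<^sub>v N"
    using annihilating_poly[OF X vN] .
  ultimately show thesis using that by blast
qed

text \<open>The vectors of \<open>U\<close> that share the eigenvalues already found form the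
  subspace \<open>U'\<close>. It is invariant under the next matrix because that matrix commutes
  with the earlier ones, so the next eigenvector can be sought inside it.\<close>

lemma joint_eigenvector:
  fixes X :: "'i \<Rightarrow> complex mat"
  assumes "finite F" and X: "\<And>i. X i \<in> carrier_mat N N"
    and comm: "\<And>i j. X i * X j = X j * X i"
    and U: "\<And>i. invariant_subspace N (X i) U" and v: "v \<in> U" "v \<noteq> 0\<^sub>v N"
  shows "\<exists>u\<in>U. u \<noteq> 0\<^sub>v N \<and> (\<forall>i\<in>F. \<exists>l. X i *\<^sub>v u = l \<cdot>\<^sub>v u)"
  using assms(1)
proof (induction F)
  case empty
  then show ?case using v by blast
next
  case (insert j F)
  then obtain u l where u: "u \<in> U" "u \<noteq> 0\<^sub>v N" "\<forall>i\<in>F. X i *\<^sub>v u = l i \<cdot>\<^sub>v u" by metis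
  have UN: "w \<in> carrier_vec N" if "w \<in> U" for w using U[of j] that by (auto simp: invariant_subspace_def)
  define U' where "U' = {w \<in> U. \<forall>i\<in>F. X i *\<^sub>v w = l i \<cdot>\<^sub>v w}"
  have "invariant_subspace N (X j) U'"
    unfolding invariant_subspace_def
  proof (intro conjI ballI allI)
    show "U' \<subseteq> carrier_vec N" using UN by (auto simp: U'_def)
  next
    fix w1 w2 assume w: "w1 \<in> U'" "w2 \<in> U'"
    have "X i *\<^sub>v (w1 + w2) = l i \<cdot>\<^sub>v (w1 + w2)" if "i \<in> F" for i
      using w that UN mult_add_distrib_mat_vec[OF X[of i], of w1 w2] smult_add_distrib_vec[of w1 N w2 "l i"]
      by (auto simp: U'_def)
    then show "w1 + w2 \<in> U'" using w U by (auto simp: U'_def invariant_subspace_def)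
  next
    fix w z assume w: "w \<in> U'"
    have "X i *\<^sub>v (z \<cdot>\<^sub>v w) = l i \<cdot>\<^sub>v (z \<cdot>\<^sub>v w)" if "i \<in> F" for i
      using w that UN mult_mat_vec[OF X[of i], of w z] by (auto simp: U'_def smult_smult_assoc mult.commute)
    then show "z \<cdot>\<^sub>v w \<in> U'" using w U by (auto simp: U'_def invariant_subspace_def)
  next
    fix w assume w: "w \<in> U'"
    then have wN: "w \<in> carrier_vec N" using UN by (auto simp: U'_def)
    have "X i *\<^sub>v (X j *\<^sub>v w) = l i \<cdot>\<^sub>v (X j *\<^sub>v w)" if "i \<in> F" for i
    proof -
      have "X i *\<^sub>v (X j *\<^sub>v w) = X j *\<^sub>v (X i *\<^sub>v w)"
        using assoc_mult_mat_vec[OF X X wN] comm by metis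
      also have "\<dots> = l i \<cdot>\<^sub>v (X j *\<^sub>v w)"
        using w that mult_mat_vec[OF X wN] by (auto simp: U'_def)
      finally show ?thesis .
    qed
    then show "X j *\<^sub>v w \<in> U'" using w U by (auto simp: U'_def invariant_subspace_def)
  qed
  moreover have "u \<in> U'" using u by (simp add: U'_def)
  ultimately obtain w m where "w \<in> U'" "w \<noteq> 0\<^sub>v N" "X j *\<^sub>v w = m \<cdot>\<^sub>v w"
    using invariant_subspace_eigenvector[OF X _ _ u(2)] by metis
  then show ?case by (intro bexI[of _ w]) (auto simp: U'_def)
qed

text \<open>The orthogonal complement of the joint eigenvectors found so far is invariant because
  the matrices are Hermitian. It is nonzero while there are fewer than \<open>N\<close> of them,
  since orthogonality is then an underdetermined system.\<close>

lemma joint_eigenvectors_orthonormal: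
  fixes X :: "'i::finite \<Rightarrow> complex mat"
  assumes X: "\<And>i. hermitian_op N (X i)" and comm: "\<And>i j. X i * X j = X j * X i" and k: "k \<le> N"
  shows "\<exists>e. \<forall>m<k. e m \<in> carrier_vec N \<and> (\<forall>m'<k. e m \<bullet>c e m' = (if m = m' then 1 else 0)) \<and>
           (\<forall>i. \<exists>l. X i *\<^sub>v e m = l \<cdot>\<^sub>v e m)"
  using k
proof (induction k)
  case (Suc k)
  then obtain e where e: "\<forall>m<k. e m \<in> carrier_vec N \<and> (\<forall>m'<k. e m \<bullet>c e m' = (if m = m' then 1 else 0)) \<and>
           (\<forall>i. \<exists>l. X i *\<^sub>v e m = l \<cdot>\<^sub>v e m)" by auto
  define U where "U = {u \<in> carrier_vec N. \<forall>m<k. u \<bullet>c e m = 0}"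
  have XN: "X i \<in> carrier_mat N N" for i using X by simp
  have inv: "invariant_subspace N (X i) U" for i
    unfolding invariant_subspace_def
  proof (intro conjI ballI allI)
    fix u assume u: "u \<in> U"
    have "(X i *\<^sub>v u) \<bullet>c e m = 0" if m: "m < k" for m
    proof -
      obtain l where l: "X i *\<^sub>v e m = l \<cdot>\<^sub>v e m" using e m by blast
      have "(X i *\<^sub>v u) \<bullet>c e m = u \<bullet>c (l \<cdot>\<^sub>v e m)"
        using u m e by (subst hermitian_op_cscalar[OF X]) (auto simp: U_def l)
      also have "\<dots> = cnj l * (u \<bullet>c e m)"
      proof -
        have "e m \<in> carrier_vec N" using m e by blast
        then show ?thesis by (simp add: cscalar_prod_sum[of _ N] sum_distrib_left mult_ac)
      qed
      finally show ?thesis using u m by (simp add: U_def)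
    qed
    then show "X i *\<^sub>v u \<in> U" using u mult_mat_vec_carrier[OF XN[of i]] by (auto simp: U_def)
  next
    fix u v assume "u \<in> U" "v \<in> U"
    then show "u + v \<in> U" using e by (auto simp: U_def cscalar_prod_sum[of _ N] distrib_right sum.distrib)
  next
    fix u z assume "u \<in> U"
    moreover have "(\<Sum>a<N. z * vec_index u a * cnj (vec_index (e m) a)) = z * (\<Sum>a<N. vec_index u a * cnj (vec_index (e m) a))" for m
      by (simp add: sum_distrib_left mult_ac)
    ultimately show "z \<cdot>\<^sub>v u \<in> U" using e by (auto simp: U_def cscalar_prod_sum[of _ N])
  qed (auto simp: U_def)
  obtain c where c: "\<exists>j<N. c j \<noteq> 0" "\<And>i. i < k \<Longrightarrow> (\<Sum>j<N. cnj (vec_index (e i) j) * c j) = 0"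
    using underdetermined_system[of k N "\<lambda>i j. cnj (vec_index (e i) j)"] Suc.prems by auto
  have "Matrix.vec N c \<in> U" using c(2) e by (auto simp: U_def cscalar_prod_sum[of _ N] mult.commute)
  moreover have "Matrix.vec N c \<noteq> 0\<^sub>v N" using c(1) by (auto simp: vec_eq_iff)
  ultimately have "\<exists>u\<in>U. u \<noteq> 0\<^sub>v N \<and> (\<forall>i\<in>UNIV. \<exists>l. X i *\<^sub>v u = l \<cdot>\<^sub>v u)"
    by (intro joint_eigenvector[OF _ XN comm inv]) auto
  then obtain u where u: "u \<in> U" "u \<noteq> 0\<^sub>v N" "\<forall>i. \<exists>l. X i *\<^sub>v u = l \<cdot>\<^sub>v u"
    by auto
  have uN: "u \<in> carrier_vec N" using u by (simp add: U_def)
  define s where "s = (\<Sum>a<N. (cmod (vec_index u a))\<^sup>2)"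
  have uu: "u \<bullet>c u = complex_of_real s"
    by (simp add: cscalar_prod_sum[OF uN] s_def complex_mult_cnj cmod_power2)
  have "\<exists>a<N. vec_index u a \<noteq> 0" using u(2) uN by (auto simp: vec_eq_iff)
  then obtain a where "a < N" "vec_index u a \<noteq> 0" by blast
  then have s: "s > 0" unfolding s_def by (intro sum_pos2[of _ a]) auto
  define w where "w = complex_of_real (1 / sqrt s) \<cdot>\<^sub>v u"
  have wU: "w \<in> U" using inv u(1) unfolding w_def invariant_subspace_def by blast
  have wN: "w \<in> carrier_vec N" using uN by (simp add: w_def)
  have "(z \<cdot>\<^sub>v u) \<bullet>c (z \<cdot>\<^sub>v u) = z * cnj z * (u \<bullet>c u)" for z
    using uN by (simp add: cscalar_prod_sum[of _ N] sum_distrib_left mult_ac)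
  then have "w \<bullet>c w = complex_of_real (1 / sqrt s * (1 / sqrt s)) * (u \<bullet>c u)"
    unfolding w_def of_real_mult complex_cnj_complex_of_real by (metis complex_cnj_complex_of_real)
  also have "\<dots> = 1"
    using s unfolding uu of_real_mult[symmetric] by (simp add: field_simps)
  finally have ww: "w \<bullet>c w = 1" .
  have we: "w \<bullet>c e m = 0" if "m < k" for m using wU that by (simp add: U_def)
  have ew: "e m \<bullet>c w = 0" if "m < k" for m
  proof -
    have "cnj (w \<bullet>c e m) = e m \<bullet>c w"
      using e that wN by (simp add: cscalar_prod_sum[of _ N] mult.commute)
    then show ?thesis using we[OF that] by simp
  qed
  have Xw: "\<exists>l. X i *\<^sub>v w = l \<cdot>\<^sub>v w" for i
  proof -
    obtain l where l: "X i *\<^sub>v u = l \<cdot>\<^sub>v u" using u(3) by blast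
    have "X i *\<^sub>v w = l \<cdot>\<^sub>v w"
      unfolding w_def mult_mat_vec[OF XN uN] l by (simp add: smult_smult_assoc mult.commute)
    then show ?thesis ..
  qed
  show ?case
    using e ww we ew Xw wN by (intro exI[of _ "e(k := w)"]) (auto simp: less_Suc_eq)
qed simp

text \<open>The eigenvectors are handed over as arrays of entries, which turns later spectral
  arguments into manipulations of complex sums. Completeness follows from orthonormality because a
  left inverse of a square matrix is a right inverse.\<close>

lemma joint_eigenbasis:
  fixes X :: "'i::finite \<Rightarrow> complex mat"
  assumes X: "\<And>i. hermitian_op N (X i)" and comm: "\<And>i j. X i * X j = X j * X i"
  obtains e :: "nat \<Rightarrow> nat \<Rightarrow> complex" and l :: "nat \<Rightarrow> 'i \<Rightarrow> real" where
    "\<And>a b. a < N \<Longrightarrow> b < N \<Longrightarrow> (\<Sum>m<N. e m a * cnj (e m b)) = (if a = b then 1 else 0)"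
    "\<And>m m'. m < N \<Longrightarrow> m' < N \<Longrightarrow> (\<Sum>a<N. e m a * cnj (e m' a)) = (if m = m' then 1 else 0)"
    "\<And>i a b. a < N \<Longrightarrow> b < N \<Longrightarrow> X i $$ (a, b) = (\<Sum>m<N. complex_of_real (l m i) * (e m a * cnj (e m b)))"
proof -
  obtain v where v: "\<forall>m<N. v m \<in> carrier_vec N \<and> (\<forall>m'<N. v m \<bullet>c v m' = (if m = m' then 1 else 0)) \<and>
           (\<forall>i. \<exists>l. X i *\<^sub>v v m = l \<cdot>\<^sub>v v m)"
    using joint_eigenvectors_orthonormal[of N X N] X comm by blast
  define e where "e m a = vec_index (v m) a" for m a
  have orth: "(\<Sum>a<N. e m a * cnj (e m' a)) = (if m = m' then 1 else 0)" if "m < N" "m' < N" for m m'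
    using v that by (simp add: e_def cscalar_prod_sum[of _ N, symmetric])
  define E where "E = Matrix.mat N N (\<lambda>(a, m). e m a)"
  define F where "F = Matrix.mat N N (\<lambda>(m, a). cnj (e m a))"
  have EN: "E \<in> carrier_mat N N" and FN: "F \<in> carrier_mat N N" by (auto simp: E_def F_def)
  have "F * E = 1\<^sub>m N"
  proof (rule eq_matI)
    fix m m' assume "m < dim_row (1\<^sub>m N)" "m' < dim_col (1\<^sub>m N)"
    then have m: "m < N" "m' < N" by auto
    then have "(F * E) $$ (m, m') = (\<Sum>a<N. e m' a * cnj (e m a))"
      by (simp add: mult_mat_sum[OF FN EN]) (simp add: E_def F_def mult.commute)
    then show "(F * E) $$ (m, m') = 1\<^sub>m N $$ (m, m')" using m by (simp add: orth)
  qed (use EN FN in auto)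
  then have EF: "E * F = 1\<^sub>m N" using mat_mult_left_right_inverse[OF FN EN] by blast
  have compl: "(\<Sum>m<N. e m a * cnj (e m b)) = (if a = b then 1 else 0)" if "a < N" "b < N" for a b
  proof -
    have "(E * F) $$ (a, b) = (\<Sum>m<N. e m a * cnj (e m b))"
      using that by (simp add: mult_mat_sum[OF EN FN]) (simp add: E_def F_def)
    then show ?thesis using that by (simp add: EF)
  qed
  have "\<exists>l. X i *\<^sub>v v m = complex_of_real l \<cdot>\<^sub>v v m" if m: "m < N" for i m
  proof -
    obtain l where l: "X i *\<^sub>v v m = l \<cdot>\<^sub>v v m" using v m by blast
    have vm: "v m \<in> carrier_vec N" "v m \<bullet>c v m = 1" using v m by auto
    \<comment> \<open>Moving the Hermitian matrix across the inner product shows that the eigenvalue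
      equals its conjugate.\<close>
    have "l * (v m \<bullet>c v m) = (X i *\<^sub>v v m) \<bullet>c v m" using vm(1) by (simp add: l cscalar_prod_sum[of _ N] sum_distrib_left mult_ac)
    also have "\<dots> = v m \<bullet>c (l \<cdot>\<^sub>v v m)" by (subst hermitian_op_cscalar[OF X vm(1) vm(1)]) (simp add: l)
    also have "\<dots> = cnj l * (v m \<bullet>c v m)"
      using vm(1) by (simp add: cscalar_prod_sum[of _ N] sum_distrib_left mult_ac)
    finally have "l = cnj l" unfolding vm(2) mult_1_right .
    then have "Im l = Im (cnj l)" by (rule arg_cong)
    then have "l = complex_of_real (Re l)" by (simp add: complex_eq_iff)
    then show ?thesis using l by metis
  qed
  then obtain l where l: "X i *\<^sub>v v m = complex_of_real (l m i) \<cdot>\<^sub>v v m" if "m < N" for i m by metis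
  have "X i $$ (a, b) = (\<Sum>m<N. complex_of_real (l m i) * (e m a * cnj (e m b)))"
    if ab: "a < N" "b < N" for i a b
  proof -
    have XN: "X i \<in> carrier_mat N N" using X by simp
    have Xe: "(\<Sum>c<N. X i $$ (a, c) * e m c) = complex_of_real (l m i) * e m a" if "m < N" for m
    proof -
      have vN: "v m \<in> carrier_vec N" using v that by blast
      have "vec_index (X i *\<^sub>v v m) a = complex_of_real (l m i) * e m a"
        using l[OF that] vN ab by (simp add: e_def)
      then show ?thesis by (simp only: mult_mat_vec_sum[OF XN vN ab(1)] e_def)
    qed
    have "X i $$ (a, b) = (\<Sum>c<N. X i $$ (a, c) * (\<Sum>m<N. e m c * cnj (e m b)))"
      using ab by (simp add: compl if_distrib sum.delta cong: if_cong)
    also have "\<dots> = (\<Sum>m<N. (\<Sum>c<N. X i $$ (a, c) * e m c) * cnj (e m b))"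
      unfolding sum_distrib_left sum_distrib_right by (subst sum.swap) (simp add: mult_ac)
    also have "\<dots> = (\<Sum>m<N. complex_of_real (l m i) * (e m a * cnj (e m b)))"
      using Xe by (intro sum.cong) (auto simp: mult_ac)
    finally show ?thesis .
  qed
  with compl orth that show thesis by blast
qed

section \<open>Tensor powers and collective observables\<close>

lemma mat_trace_mult:
  assumes "A \<in> carrier_mat n m" "B \<in> carrier_mat m n"
  shows "mat_trace (A * B) = (\<Sum>a<n. \<Sum>b<m. A $$ (a, b) * B $$ (b, a))"
proof -
  have "mat_trace (A * B) = (\<Sum>a<n. (A * B) $$ (a, a))" using assms by (simp add: mat_trace_def)
  also have "\<dots> = (\<Sum>a<n. \<Sum>b<m. A $$ (a, b) * B $$ (b, a))"
    by (intro sum.cong refl mult_mat_sum[OF assms]) auto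
  finally show ?thesis .
qed

lemma mat_trace_comm:
  assumes "A \<in> carrier_mat n m" "B \<in> carrier_mat m n"
  shows "mat_trace (A * B) = mat_trace (B * A)"
  unfolding mat_trace_mult[OF assms] mat_trace_mult[OF assms(2,1)]
  by (subst sum.swap) (simp add: mult.commute)

lemma mat_trace_add:
  "A \<in> carrier_mat n n \<Longrightarrow> B \<in> carrier_mat n n \<Longrightarrow> mat_trace (A + B) = mat_trace A + mat_trace B"
  by (simp add: mat_trace_def sum.distrib)

lemma mat_trace_smult: "A \<in> carrier_mat n n \<Longrightarrow> mat_trace (z \<cdot>\<^sub>m A) = z * mat_trace A"
  by (simp add: mat_trace_def sum_distrib_left)

lemma mat_trace_adjoint: "A \<in> carrier_mat n n \<Longrightarrow> mat_trace (mat_adjoint A) = cnj (mat_trace A)"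
  by (auto simp: mat_trace_def mat_adjoint_index intro!: sum.cong)

lemma mat_adjoint_mult:
  fixes A B :: "complex mat"
  assumes "A \<in> carrier_mat n m" "B \<in> carrier_mat m k"
  shows "mat_adjoint (A * B) = mat_adjoint B * mat_adjoint A"
proof (rule eq_matI)
  fix i j assume "i < dim_row (mat_adjoint B * mat_adjoint A)" "j < dim_col (mat_adjoint B * mat_adjoint A)"
  then have ij: "i < k" "j < n" using assms by auto
  have "mat_adjoint (A * B) $$ (i, j) = cnj ((A * B) $$ (j, i))"
    using ij assms by (intro mat_adjoint_index) auto
  also have "\<dots> = (\<Sum>c<m. mat_adjoint B $$ (i, c) * mat_adjoint A $$ (c, j))"
    using ij assms by (simp add: mult_mat_sum[OF assms] mat_adjoint_index mult.commute del: index_mult_mat)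
  also have "\<dots> = (mat_adjoint B * mat_adjoint A) $$ (i, j)"
    using ij assms by (intro mult_mat_sum[symmetric]) auto
  finally show "mat_adjoint (A * B) $$ (i, j) = (mat_adjoint B * mat_adjoint A) $$ (i, j)" .
qed (use assms in auto)

lemma mat_adjoint_add:
  fixes A B :: "complex mat"
  assumes "A \<in> carrier_mat n m" "B \<in> carrier_mat n m"
  shows "mat_adjoint (A + B) = mat_adjoint A + mat_adjoint B"
  using assms by (intro eq_matI) (auto simp: mat_adjoint_index)

lemma mat_adjoint_smult:
  fixes A :: "complex mat"
  shows "mat_adjoint (z \<cdot>\<^sub>m A) = cnj z \<cdot>\<^sub>m mat_adjoint A"
  by (intro eq_matI) (auto simp: mat_adjoint_index)

lemma mat_adjoint_one: "mat_adjoint (1\<^sub>m n) = (1\<^sub>m n :: complex mat)"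
  by (intro eq_matI) (auto simp: mat_adjoint_index)

lemma mat_adjoint_adjoint: "mat_adjoint (mat_adjoint A) = (A :: complex mat)"
  by (intro eq_matI) (auto simp: mat_adjoint_index)

section \<open>Kronecker products\<close>

lemma sum_div_mod:
  fixes f :: "nat \<Rightarrow> nat \<Rightarrow> 'a::comm_monoid_add"
  shows "(\<Sum>k<n*m. f (k div m) (k mod m)) = (\<Sum>i<n. \<Sum>j<m. f i j)"
proof -
  have lt: "i * m + j < n * m" if "i < n" "j < m" for i j
  proof -
    have "i * m + j < Suc i * m" using that by simp
    also have "\<dots> \<le> n * m" using that by (intro mult_le_mono1) simp
    finally show ?thesis .
  qed
  have "bij_betw (\<lambda>k. (k div m, k mod m)) {..<n*m} ({..<n} \<times> {..<m})"
    by (rule bij_betw_byWitness[where f' = "\<lambda>(i, j). i * m + j"])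
       (auto simp: less_mult_imp_div_less lt intro!: mod_less_divisor gr0I)
  from sum.reindex_bij_betw[OF this, of "\<lambda>(i, j). f i j"] show ?thesis
    by (simp add: sum.cartesian_product)
qed

lemma kronecker_carrier [simp]:
  "A \<in> carrier_mat n n' \<Longrightarrow> B \<in> carrier_mat m m' \<Longrightarrow> kronecker A B \<in> carrier_mat (n * m) (n' * m')"
  by (auto simp: kronecker_def)

lemma kronecker_index:
  assumes "A \<in> carrier_mat n n'" "B \<in> carrier_mat m m'" "i < n * m" "j < n' * m'"
  shows "kronecker A B $$ (i, j) = A $$ (i div m, j div m') * B $$ (i mod m, j mod m')"
  using assms by (auto simp: kronecker_def)

lemma div_mod_less_mult:
  assumes "i < n * (m::nat)"
  shows "i div m < n" "i mod m < m"
  using assms by (auto simp: less_mult_imp_div_less intro!: mod_less_divisor gr0I)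

lemma kronecker_mult:
  assumes "A \<in> carrier_mat n n" "B \<in> carrier_mat m m" "C \<in> carrier_mat n n" "D \<in> carrier_mat m m"
  shows "kronecker A B * kronecker C D = kronecker (A * C) (B * D)"
proof (rule eq_matI)
  have AC: "A * C \<in> carrier_mat n n" and BD: "B * D \<in> carrier_mat m m" using assms by auto
  fix i j assume "i < dim_row (kronecker (A * C) (B * D))" "j < dim_col (kronecker (A * C) (B * D))"
  then have ij: "i < n * m" "j < n * m" using kronecker_carrier[OF AC BD] by auto
  have "(kronecker A B * kronecker C D) $$ (i, j)
      = (\<Sum>k<n*m. kronecker A B $$ (i, k) * kronecker C D $$ (k, j))"
    by (rule mult_mat_sum[OF kronecker_carrier[OF assms(1,2)] kronecker_carrier[OF assms(3,4)] ij])
  also have "\<dots> = (\<Sum>k<n*m. (A $$ (i div m, k div m) * C $$ (k div m, j div m))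
      * (B $$ (i mod m, k mod m) * D $$ (k mod m, j mod m)))"
    using ij by (intro sum.cong) (auto simp: kronecker_index[OF assms(1,2)] kronecker_index[OF assms(3,4)])
  also have "\<dots> = (\<Sum>k<n. A $$ (i div m, k) * C $$ (k, j div m)) * (\<Sum>l<m. B $$ (i mod m, l) * D $$ (l, j mod m))"
    by (simp add: sum_product
        sum_div_mod[where f = "\<lambda>k l. (A $$ (i div m, k) * C $$ (k, j div m)) * (B $$ (i mod m, l) * D $$ (l, j mod m))"])
  also have "\<dots> = kronecker (A * C) (B * D) $$ (i, j)"
    using ij div_mod_less_mult[OF ij(1)] div_mod_less_mult[OF ij(2)]
    by (simp add: kronecker_index[OF AC BD] mult_mat_sum[OF assms(1,3)] mult_mat_sum[OF assms(2,4)])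
  finally show "(kronecker A B * kronecker C D) $$ (i, j) = kronecker (A * C) (B * D) $$ (i, j)" .
qed (use assms in \<open>auto simp: kronecker_def\<close>)

lemma kronecker_trace:
  assumes "A \<in> carrier_mat n n" "B \<in> carrier_mat m m"
  shows "mat_trace (kronecker A B) = mat_trace A * mat_trace B"
proof -
  have "mat_trace (kronecker A B) = (\<Sum>k<n*m. A $$ (k div m, k div m) * B $$ (k mod m, k mod m))"
    using kronecker_carrier[OF assms] by (auto simp: mat_trace_def kronecker_index[OF assms])
  also have "\<dots> = mat_trace A * mat_trace B"
    using assms
    by (simp add: mat_trace_def sum_product sum_div_mod[where f = "\<lambda>k l. A $$ (k, k) * B $$ (l, l)"])
  finally show ?thesis .
qed

lemma kronecker_adjoint:
  assumes A: "A \<in> carrier_mat n n" and B: "B \<in> carrier_mat m m"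
  shows "mat_adjoint (kronecker A B) = kronecker (mat_adjoint A) (mat_adjoint B)"
proof (rule eq_matI)
  have C: "mat_adjoint A \<in> carrier_mat n n" "mat_adjoint B \<in> carrier_mat m m" using A B by auto
  fix i j assume "i < dim_row (kronecker (mat_adjoint A) (mat_adjoint B))"
    "j < dim_col (kronecker (mat_adjoint A) (mat_adjoint B))"
  then have ij: "i < n * m" "j < n * m" using kronecker_carrier[OF C] by auto
  then show "mat_adjoint (kronecker A B) $$ (i, j) = kronecker (mat_adjoint A) (mat_adjoint B) $$ (i, j)"
    using A B div_mod_less_mult[OF ij(1)] div_mod_less_mult[OF ij(2)]
    by (simp add: mat_adjoint_index carrier_matD[OF kronecker_carrier[OF A B]] kronecker_index[OF A B] kronecker_index[OF C])
qed (use A B in \<open>auto simp: kronecker_def\<close>)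

lemma kronecker_one: "kronecker (1\<^sub>m n) (1\<^sub>m m) = 1\<^sub>m (n * m)"
proof (rule eq_matI)
  fix i j assume "i < dim_row (1\<^sub>m (n * m))" "j < dim_col (1\<^sub>m (n * m))"
  then have ij: "i < n * m" "j < n * m" by auto
  have "i = j \<longleftrightarrow> i div m = j div m \<and> i mod m = j mod m" by (metis div_mult_mod_eq)
  then show "kronecker (1\<^sub>m n) (1\<^sub>m m) $$ (i, j) = 1\<^sub>m (n * m) $$ (i, j)"
    using ij div_mod_less_mult[OF ij(1)] div_mod_less_mult[OF ij(2)]
    by (simp add: kronecker_index[of _ n n _ m m])
qed (auto simp: kronecker_def)

lemma kronecker_add_left:
  assumes "A \<in> carrier_mat n n" "B \<in> carrier_mat n n" "C \<in> carrier_mat m m"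
  shows "kronecker (A + B) C = kronecker A C + kronecker B C"
  using assms by (intro eq_matI) (auto simp: kronecker_def distrib_right div_mod_less_mult)

lemma kronecker_add_right:
  assumes "A \<in> carrier_mat n n" "B \<in> carrier_mat m m" "C \<in> carrier_mat m m"
  shows "kronecker A (B + C) = kronecker A B + kronecker A C"
  using assms by (intro eq_matI) (auto simp: kronecker_def distrib_left div_mod_less_mult)

lemma kronecker_smult_left: "kronecker (z \<cdot>\<^sub>m A) B = z \<cdot>\<^sub>m kronecker A B"
  by (intro eq_matI) (auto simp: kronecker_def div_mod_less_mult)

lemma kronecker_smult_right: "kronecker A (z \<cdot>\<^sub>m B) = z \<cdot>\<^sub>m kronecker A B"
  by (intro eq_matI) (auto simp: kronecker_def div_mod_less_mult)

lemma kronecker_one_right: "kronecker A (1\<^sub>m 1) = A"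
  by (intro eq_matI) (auto simp: kronecker_def)

section \<open>Tensor powers and sums of one-copy operators\<close>

lemma tensor_pow_carrier [simp]: "A \<in> carrier_mat d d \<Longrightarrow> tensor_pow A n \<in> carrier_mat (d ^ n) (d ^ n)"
  by (induction n) auto

lemma tensor_pow_mult:
  assumes "A \<in> carrier_mat d d" "B \<in> carrier_mat d d"
  shows "tensor_pow A n * tensor_pow B n = tensor_pow (A * B) n"
  by (induction n)
     (auto simp: kronecker_mult[OF assms(1) tensor_pow_carrier[OF assms(1)] assms(2) tensor_pow_carrier[OF assms(2)]])

lemma tensor_pow_adjoint:
  assumes "A \<in> carrier_mat d d"
  shows "mat_adjoint (tensor_pow A n) = tensor_pow (mat_adjoint A) n"
  by (induction n) (auto simp: kronecker_adjoint[OF assms tensor_pow_carrier[OF assms]] mat_adjoint_one)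

lemma tensor_pow_one: "tensor_pow (1\<^sub>m d) n = 1\<^sub>m (d ^ n)"
  by (induction n) (auto simp: kronecker_one)

lemma tensor_pow_trace:
  assumes "A \<in> carrier_mat d d"
  shows "mat_trace (tensor_pow A n) = mat_trace A ^ n"
proof (induction n)
  case (Suc n)
  then show ?case by (simp add: kronecker_trace[OF assms tensor_pow_carrier[OF assms]])
qed (simp add: mat_trace_def)

text \<open>This is the map \<open>J\<close>. It splits off the first copy exactly as
  \<open>tensor_pow\<close> does, so that the two unfold in step; the sum over no copies is
  zero.\<close>

fun collective :: "nat \<Rightarrow> nat \<Rightarrow> complex mat \<Rightarrow> complex mat" where
  "collective d 0 A = 0\<^sub>m 1 1"
| "collective d (Suc n) A = kronecker A (1\<^sub>m (d ^ n)) + kronecker (1\<^sub>m d) (collective d n A)"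

lemma collective_carrier [simp]: "A \<in> carrier_mat d d \<Longrightarrow> collective d n A \<in> carrier_mat (d ^ n) (d ^ n)"
  by (induction n) auto

lemma collective_adjoint:
  assumes "A \<in> carrier_mat d d"
  shows "mat_adjoint (collective d n A) = collective d n (mat_adjoint A)"
proof (induction n)
  case 0
  show ?case by (intro eq_matI) (auto simp: mat_adjoint_index)
next
  case (Suc n)
  have "kronecker A (1\<^sub>m (d ^ n)) \<in> carrier_mat (d * d^n) (d * d^n)"
    "kronecker (1\<^sub>m d) (collective d n A) \<in> carrier_mat (d * d^n) (d * d^n)"
    using assms by auto
  then show ?case using Suc
    by (simp add: mat_adjoint_add kronecker_adjoint[OF assms one_carrier_mat]
        kronecker_adjoint[OF one_carrier_mat collective_carrier[OF assms]] mat_adjoint_one)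
qed

lemma collective_one: "collective d n (1\<^sub>m d) = of_nat n \<cdot>\<^sub>m 1\<^sub>m (d ^ n)"
proof (induction n)
  case (Suc n)
  show ?case by (intro eq_matI) (auto simp: Suc kronecker_smult_right kronecker_one)
qed auto

text \<open>The terms where \<open>A\<close> and \<open>B\<close> act on different copies are, taken
  together, symmetric under exchanging \<open>A\<close> and \<open>B\<close>. They cancel in the
  commutator, and they have expectation zero in a product state in which \<open>A\<close> and
  \<open>B\<close> are centred.\<close>

lemma collective_mult:
  assumes A: "A \<in> carrier_mat d d" and B: "B \<in> carrier_mat d d"
  shows "collective d (Suc n) A * collective d (Suc n) B
       = kronecker (A * B) (1\<^sub>m (d ^ n)) + kronecker A (collective d n B) + kronecker B (collective d n A)
         + kronecker (1\<^sub>m d) (collective d n A * collective d n B)"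
proof -
  note J = collective_carrier[OF A, of n] collective_carrier[OF B, of n]
  note K = kronecker_carrier[OF A one_carrier_mat[of "d ^ n"]] kronecker_carrier[OF B one_carrier_mat[of "d ^ n"]]
    kronecker_carrier[OF one_carrier_mat[of d] J(1)] kronecker_carrier[OF one_carrier_mat[of d] J(2)]
    kronecker_carrier[OF A J(2)] kronecker_carrier[OF B J(1)]
    kronecker_carrier[OF mult_carrier_mat[OF A B] one_carrier_mat[of "d ^ n"]]
    kronecker_carrier[OF one_carrier_mat[of d] mult_carrier_mat[OF J]]
  have "collective d (Suc n) A * collective d (Suc n) B
      = (kronecker A (1\<^sub>m (d ^ n)) * kronecker B (1\<^sub>m (d ^ n)) + kronecker (1\<^sub>m d) (collective d n A) * kronecker B (1\<^sub>m (d ^ n)))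
       + (kronecker A (1\<^sub>m (d ^ n)) * kronecker (1\<^sub>m d) (collective d n B)
          + kronecker (1\<^sub>m d) (collective d n A) * kronecker (1\<^sub>m d) (collective d n B))"
    unfolding collective.simps
    by (subst mult_add_distrib_mat[OF add_carrier_mat[OF K(3)] K(2,4)])
       (simp only: add_mult_distrib_mat[OF K(1,3,2)] add_mult_distrib_mat[OF K(1,3,4)])
  also have "\<dots> = (kronecker (A * B) (1\<^sub>m (d ^ n)) + kronecker B (collective d n A))
      + (kronecker A (collective d n B) + kronecker (1\<^sub>m d) (collective d n A * collective d n B))"
    using A B
    by (simp add: kronecker_mult[OF A one_carrier_mat B one_carrier_mat] kronecker_mult[OF one_carrier_mat J(1) B one_carrier_mat]
        kronecker_mult[OF A one_carrier_mat one_carrier_mat J(2)] kronecker_mult[OF one_carrier_mat J(1) one_carrier_mat J(2)]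
        right_mult_one_mat[OF J(1)] left_mult_one_mat[OF J(2)] right_mult_one_mat[OF A] left_mult_one_mat[OF B])
  finally show ?thesis using K by (intro eq_matI) (auto simp: algebra_simps)
qed

text \<open>Operators on different copies commute, so \<open>J\<close> is a homomorphism of Lie
  algebras.\<close>

lemma collective_commutator:
  assumes A: "A \<in> carrier_mat d d" and B: "B \<in> carrier_mat d d"
  shows "collective d n A * collective d n B - collective d n B * collective d n A = collective d n (A * B - B * A)"
proof (induction n)
  case (Suc n)
  note J = collective_carrier[OF A, of n] collective_carrier[OF B, of n]
  note K = kronecker_carrier[OF A J(2)] kronecker_carrier[OF B J(1)]
    kronecker_carrier[OF mult_carrier_mat[OF A B] one_carrier_mat[of "d ^ n"]]
    kronecker_carrier[OF mult_carrier_mat[OF B A] one_carrier_mat[of "d ^ n"]]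
    kronecker_carrier[OF one_carrier_mat[of d] mult_carrier_mat[OF J]]
    kronecker_carrier[OF one_carrier_mat[of d] mult_carrier_mat[OF J(2,1)]]
  \<comment> \<open>Subtraction is rewritten as adding a multiple by -1, so that additivity and
    homogeneity of the Kronecker product apply.\<close>
  have minus: "P - Q = P + (- 1) \<cdot>\<^sub>m Q" if "P \<in> carrier_mat k k" "Q \<in> carrier_mat k k" for P Q :: "complex mat" and k
    using that by (intro eq_matI) auto
  have "kronecker (A * B - B * A) (1\<^sub>m (d ^ n))
      = kronecker (A * B) (1\<^sub>m (d ^ n)) - kronecker (B * A) (1\<^sub>m (d ^ n))"
    unfolding minus[OF mult_carrier_mat[OF A B] mult_carrier_mat[OF B A]] minus[OF K(3,4)]
    by (subst kronecker_add_left[OF mult_carrier_mat[OF A B] smult_carrier_mat[OF mult_carrier_mat[OF B A]] one_carrier_mat])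
       (simp add: kronecker_smult_left)
  moreover have "kronecker (1\<^sub>m d) (collective d n A * collective d n B - collective d n B * collective d n A)
      = kronecker (1\<^sub>m d) (collective d n A * collective d n B) - kronecker (1\<^sub>m d) (collective d n B * collective d n A)"
    unfolding minus[OF mult_carrier_mat[OF J] mult_carrier_mat[OF J(2,1)]] minus[OF K(5,6)]
    by (subst kronecker_add_right[OF one_carrier_mat mult_carrier_mat[OF J] smult_carrier_mat[OF mult_carrier_mat[OF J(2,1)]]])
       (simp add: kronecker_smult_right)
  ultimately show ?case
    unfolding collective_mult[OF A B] collective_mult[OF B A] using K
    by (simp add: Suc[symmetric]) (intro eq_matI; auto)
next
  case 0
  show ?case by (intro eq_matI) auto
qed

text \<open>Intertwining holds copy by copy. With A' = r^-1 A r it moves a collective operator from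
  one side of the n-copy state to the other, at the price of changing \<open>A\<close>.\<close>

lemma collective_tensor_pow:
  assumes A: "A \<in> carrier_mat d d" and A': "A' \<in> carrier_mat d d" and r: "r \<in> carrier_mat d d"
    and eq: "A * r = r * A'"
  shows "collective d n A * tensor_pow r n = tensor_pow r n * collective d n A'"
proof (induction n)
  case (Suc n)
  note J = collective_carrier[OF A, of n] collective_carrier[OF A', of n]
  note T = tensor_pow_carrier[OF r, of n]
  note K = kronecker_carrier[OF A one_carrier_mat[of "d ^ n"]] kronecker_carrier[OF A' one_carrier_mat[of "d ^ n"]]
    kronecker_carrier[OF one_carrier_mat[of d] J(1)] kronecker_carrier[OF one_carrier_mat[of d] J(2)]
    kronecker_carrier[OF r T]
  have "collective d (Suc n) A * tensor_pow r (Suc n)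
      = kronecker A (1\<^sub>m (d ^ n)) * kronecker r (tensor_pow r n) + kronecker (1\<^sub>m d) (collective d n A) * kronecker r (tensor_pow r n)"
    using add_mult_distrib_mat[OF K(1,3,5)] by simp
  also have "\<dots> = kronecker r (tensor_pow r n) * kronecker A' (1\<^sub>m (d ^ n)) + kronecker r (tensor_pow r n) * kronecker (1\<^sub>m d) (collective d n A')"
    
    by (simp add: kronecker_mult[OF A one_carrier_mat r T] kronecker_mult[OF one_carrier_mat J(1) r T]
        kronecker_mult[OF r T A' one_carrier_mat] kronecker_mult[OF r T one_carrier_mat J(2)]
        left_mult_one_mat[OF T] right_mult_one_mat[OF T] left_mult_one_mat[OF r] right_mult_one_mat[OF r] eq Suc)
  also have "\<dots> = tensor_pow r (Suc n) * collective d (Suc n) A'"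
    using mult_add_distrib_mat[OF K(5,2,4)] by simp
  finally show ?case .
qed auto

lemma collective_trace:
  assumes A: "A \<in> carrier_mat d d" and r: "r \<in> carrier_mat d d" "mat_trace r = 1"
  shows "mat_trace (tensor_pow r n * collective d n A) = of_nat n * mat_trace (r * A)"
proof (induction n)
  case 0
  show ?case by (simp add: mat_trace_def)
next
  case (Suc n)
  note J = collective_carrier[OF A, of n]
  note T = tensor_pow_carrier[OF r(1), of n]
  note K = kronecker_carrier[OF A one_carrier_mat[of "d ^ n"]] kronecker_carrier[OF one_carrier_mat[of d] J]
    kronecker_carrier[OF r(1) T]
  have "mat_trace (tensor_pow r (Suc n) * collective d (Suc n) A)
      = mat_trace (kronecker r (tensor_pow r n) * kronecker A (1\<^sub>m (d ^ n)) + kronecker r (tensor_pow r n) * kronecker (1\<^sub>m d) (collective d n A))"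
    using mult_add_distrib_mat[OF K(3,1,2)] by simp
  also have "\<dots> = mat_trace (kronecker r (tensor_pow r n) * kronecker A (1\<^sub>m (d ^ n))) + mat_trace (kronecker r (tensor_pow r n) * kronecker (1\<^sub>m d) (collective d n A))"
    using K by (intro mat_trace_add[of _ "d * d ^ n"]) auto
  also have "\<dots> = mat_trace (r * A) * mat_trace (tensor_pow r n) + mat_trace r * mat_trace (tensor_pow r n * collective d n A)"

    by (simp add: kronecker_mult[OF r(1) T A one_carrier_mat] kronecker_mult[OF r(1) T one_carrier_mat J]
        right_mult_one_mat[OF T] right_mult_one_mat[OF r(1)] kronecker_trace[OF mult_carrier_mat[OF r(1) A] T]
        kronecker_trace[OF r(1) mult_carrier_mat[OF T J]])
  finally show ?case using Suc r by (simp add: tensor_pow_trace algebra_simps)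
qed

text \<open>Covariances of sums of independent centred copies add up: a term with \<open>A\<close>
  and \<open>B\<close> on different copies factors and contains Tr (r A) = 0 or Tr (r B) =
  0.\<close>

lemma collective_trace_mult:
  assumes A: "A \<in> carrier_mat d d" "mat_trace (r * A) = 0" and B: "B \<in> carrier_mat d d" "mat_trace (r * B) = 0"
    and r: "r \<in> carrier_mat d d" "mat_trace r = 1"
  shows "mat_trace (tensor_pow r n * (collective d n A * collective d n B)) = of_nat n * mat_trace (r * (A * B))"
proof (induction n)
  case 0
  show ?case by (simp add: mat_trace_def)
next
  case (Suc n)
  note J = collective_carrier[OF A(1), of n] collective_carrier[OF B(1), of n]
  note T = tensor_pow_carrier[OF r(1), of n]
  note K = kronecker_carrier[OF mult_carrier_mat[OF A(1) B(1)] one_carrier_mat[of "d ^ n"]]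
    kronecker_carrier[OF A(1) J(2)] kronecker_carrier[OF B(1) J(1)] 
    kronecker_carrier[OF one_carrier_mat[of d] mult_carrier_mat[OF J]]
    kronecker_carrier[OF r(1) T]
  have tr: "mat_trace (R * (P1 + P2 + P3 + P4)) = mat_trace (R * P1) + mat_trace (R * P2) + mat_trace (R * P3) + mat_trace (R * P4)"
    if "R \<in> carrier_mat k k" "P1 \<in> carrier_mat k k" "P2 \<in> carrier_mat k k" "P3 \<in> carrier_mat k k" "P4 \<in> carrier_mat k k"
    for R P1 P2 P3 P4 k
    using that by (simp add: mult_add_distrib_mat[of _ k k _ k] mat_trace_add[of _ k])
  have "mat_trace (tensor_pow r (Suc n) * (collective d (Suc n) A * collective d (Suc n) B))
      = mat_trace (kronecker r (tensor_pow r n) * kronecker (A * B) (1\<^sub>m (d ^ n)))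
        + mat_trace (kronecker r (tensor_pow r n) * kronecker A (collective d n B))
        + mat_trace (kronecker r (tensor_pow r n) * kronecker B (collective d n A))
        + mat_trace (kronecker r (tensor_pow r n) * kronecker (1\<^sub>m d) (collective d n A * collective d n B))"
    unfolding collective_mult[OF A(1) B(1)] using tr[OF K(5,1,2,3,4)] by simp
  also have "\<dots> = mat_trace (r * (A * B)) * mat_trace (tensor_pow r n)
      + mat_trace (tensor_pow r n * (collective d n A * collective d n B))"

    by (simp add: kronecker_mult[OF r(1) T mult_carrier_mat[OF A(1) B(1)] one_carrier_mat]
        kronecker_mult[OF r(1) T A(1) J(2)] kronecker_mult[OF r(1) T B(1) J(1)]
        kronecker_mult[OF r(1) T one_carrier_mat mult_carrier_mat[OF J]]
        right_mult_one_mat[OF T] right_mult_one_mat[OF r(1)]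
        kronecker_trace[OF mult_carrier_mat[OF r(1) mult_carrier_mat[OF A(1) B(1)]] T]
        kronecker_trace[OF mult_carrier_mat[OF r(1) A(1)] mult_carrier_mat[OF T J(2)]]
        kronecker_trace[OF mult_carrier_mat[OF r(1) B(1)] mult_carrier_mat[OF T J(1)]]
        kronecker_trace[OF r(1) mult_carrier_mat[OF T mult_carrier_mat[OF J]]] A(2) B(2) r(2))
  finally show ?case using Suc r by (simp add: tensor_pow_trace algebra_simps)
qed

text \<open>This is the product rule. Writing the one-copy derivative as F(0) A, with
  \<open>A\<close> a logarithmic derivative, turns the sum over copies into a single collective
  operator. The matrix format is assumed only near 0 because the model is controlled only on its
  parameter set; the index formula for Kronecker products is used there.\<close>

lemma tensor_pow_has_vector_derivative:
  fixes F :: "real \<Rightarrow> complex mat"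
  assumes F: "\<And>i j. i < d \<Longrightarrow> j < d \<Longrightarrow> ((\<lambda>t. F t $$ (i, j)) has_vector_derivative D $$ (i, j)) (at 0)"
    and ev: "\<forall>\<^sub>F t in nhds 0. F t \<in> carrier_mat d d" and D: "D \<in> carrier_mat d d"
    and A: "A \<in> carrier_mat d d" "F 0 * A = D"
  shows "i < d ^ n \<Longrightarrow> j < d ^ n \<Longrightarrow>
    ((\<lambda>t. tensor_pow (F t) n $$ (i, j)) has_vector_derivative (tensor_pow (F 0) n * collective d n A) $$ (i, j)) (at 0)"
proof (induction n arbitrary: i j)
  case (Suc n)
  have F0: "F 0 \<in> carrier_mat d d" using ev by (rule eventually_nhds_x_imp_x)
  note T = tensor_pow_carrier[OF F0, of n]
  note J = collective_carrier[OF A(1), of n]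
  note K = kronecker_carrier[OF A(1) one_carrier_mat[of "d ^ n"]] kronecker_carrier[OF one_carrier_mat[of d] J]
    kronecker_carrier[OF F0 T]
  have ij: "i < d * d ^ n" "j < d * d ^ n" using Suc.prems by auto
  note ij' = div_mod_less_mult[OF ij(1)] div_mod_less_mult[OF ij(2)]
  define i1 i2 j1 j2 where defs: "i1 = i div d ^ n" "i2 = i mod d ^ n" "j1 = j div d ^ n" "j2 = j mod d ^ n"
  have "tensor_pow (F 0) (Suc n) * collective d (Suc n) A
      = kronecker (F 0) (tensor_pow (F 0) n) * kronecker A (1\<^sub>m (d ^ n)) + kronecker (F 0) (tensor_pow (F 0) n) * kronecker (1\<^sub>m d) (collective d n A)"
    using mult_add_distrib_mat[OF K(3,1,2)] by simp
  also have "\<dots> = kronecker D (tensor_pow (F 0) n) + kronecker (F 0) (tensor_pow (F 0) n * collective d n A)"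
    
    by (simp add: kronecker_mult[OF F0 T A(1) one_carrier_mat] kronecker_mult[OF F0 T one_carrier_mat J]
        right_mult_one_mat[OF T] right_mult_one_mat[OF F0] A(2))
  finally have "(tensor_pow (F 0) (Suc n) * collective d (Suc n) A) $$ (i, j)
      = kronecker D (tensor_pow (F 0) n) $$ (i, j) + kronecker (F 0) (tensor_pow (F 0) n * collective d n A) $$ (i, j)"
    using ij kronecker_carrier[OF F0 mult_carrier_mat[OF T J]] by simp
  then have rhs: "(tensor_pow (F 0) (Suc n) * collective d (Suc n) A) $$ (i, j)
      = F 0 $$ (i1, j1) * (tensor_pow (F 0) n * collective d n A) $$ (i2, j2) + D $$ (i1, j1) * tensor_pow (F 0) n $$ (i2, j2)"
    by (simp add: defs kronecker_index[OF D T ij] kronecker_index[OF F0 mult_carrier_mat[OF T J] ij])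
  have "((\<lambda>t. F t $$ (i1, j1) * tensor_pow (F t) n $$ (i2, j2)) has_vector_derivative
      F 0 $$ (i1, j1) * (tensor_pow (F 0) n * collective d n A) $$ (i2, j2) + D $$ (i1, j1) * tensor_pow (F 0) n $$ (i2, j2)) (at 0)"
    using ij' by (intro has_vector_derivative_mult F Suc.IH) (auto simp: defs)
  moreover have eq: "F t $$ (i1, j1) * tensor_pow (F t) n $$ (i2, j2) = tensor_pow (F t) (Suc n) $$ (i, j)"
    if "F t \<in> carrier_mat d d" for t
    using that ij by (simp add: defs kronecker_index[OF that tensor_pow_carrier[OF that]])
  have "\<forall>\<^sub>F t in nhds 0. F t $$ (i1, j1) * tensor_pow (F t) n $$ (i2, j2) = tensor_pow (F t) (Suc n) $$ (i, j)"
    using ev by eventually_elim (rule eq)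
  then have "\<forall>\<^sub>F t in at 0. F t $$ (i1, j1) * tensor_pow (F t) n $$ (i2, j2) = tensor_pow (F t) (Suc n) $$ (i, j)"
    by (simp add: eventually_nhds_conv_at)
  ultimately show ?case
    unfolding rhs has_vector_derivative_def
    using eq[OF F0] by (elim has_derivative_transform_eventually) auto
qed simp

lemma sum_rotate:
  "(\<Sum>a\<in>A. \<Sum>b\<in>B. \<Sum>k\<in>K. f a b k) = (\<Sum>k\<in>K. \<Sum>a\<in>A. \<Sum>b\<in>B. f a b k)"
proof -
  have "(\<Sum>b\<in>B. \<Sum>k\<in>K. f a b k) = (\<Sum>k\<in>K. \<Sum>b\<in>B. f a b k)" for a by (rule sum.swap)
  then show ?thesis by (simp only:) (rule sum.swap)
qed

section \<open>Positive operators: spectrum, factorisation, inverse\<close>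

lemma quadratic_form_sum:
  assumes A: "A \<in> carrier_mat N N" and v: "v \<in> carrier_vec N"
  shows "(A *\<^sub>v v) \<bullet>c v = (\<Sum>a<N. \<Sum>b<N. cnj (vec_index v a) * A $$ (a, b) * vec_index v b)"
  using mult_mat_vec_sum[OF A v]
  by (auto simp: cscalar_prod_sum[OF v] sum_distrib_left sum_distrib_right mult_ac intro!: sum.cong)

lemma pos_semidef_op_quadratic:
  assumes "pos_semidef_op N A"
  shows "0 \<le> Re (\<Sum>a<N. \<Sum>b<N. cnj (x a) * A $$ (a, b) * x b)"
proof -
  have "0 \<le> Re ((A *\<^sub>v Matrix.vec N x) \<bullet>c Matrix.vec N x)"
    using assms by (simp add: pos_semidef_op_def)
  also have "(A *\<^sub>v Matrix.vec N x) \<bullet>c Matrix.vec N x = (\<Sum>a<N. \<Sum>b<N. cnj (x a) * A $$ (a, b) * x b)"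
    using assms by (subst quadratic_form_sum[of _ N]) (auto simp: pos_semidef_op_def)
  finally show ?thesis .
qed

lemma pos_def_op_eigenbasis:
  assumes A: "pos_def_op N A"
  obtains e :: "nat \<Rightarrow> nat \<Rightarrow> complex" and l :: "nat \<Rightarrow> real" where
    "\<And>m. m < N \<Longrightarrow> 0 < l m"
    "\<And>a b. a < N \<Longrightarrow> b < N \<Longrightarrow> (\<Sum>m<N. e m a * cnj (e m b)) = (if a = b then 1 else 0)"
    "\<And>m m'. m < N \<Longrightarrow> m' < N \<Longrightarrow> (\<Sum>a<N. e m a * cnj (e m' a)) = (if m = m' then 1 else 0)"
    "\<And>a b. a < N \<Longrightarrow> b < N \<Longrightarrow> A $$ (a, b) = (\<Sum>m<N. complex_of_real (l m) * (e m a * cnj (e m b)))"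
proof -
  have H: "hermitian_op N A" using A by (simp add: pos_def_op_def)
  \<comment> \<open>A single matrix is treated as a commuting family indexed by
    \<open>unit\<close>.\<close>
  obtain e :: "nat \<Rightarrow> nat \<Rightarrow> complex" and l :: "nat \<Rightarrow> unit \<Rightarrow> real" where
    c: "\<And>a b. a < N \<Longrightarrow> b < N \<Longrightarrow> (\<Sum>m<N. e m a * cnj (e m b)) = (if a = b then 1 else 0)"
    and o: "\<And>m m'. m < N \<Longrightarrow> m' < N \<Longrightarrow> (\<Sum>a<N. e m a * cnj (e m' a)) = (if m = m' then 1 else 0)"
    and s: "\<And>i a b. a < N \<Longrightarrow> b < N \<Longrightarrow> A $$ (a, b) = (\<Sum>m<N. complex_of_real (l m i) * (e m a * cnj (e m b)))"
    by (rule joint_eigenbasis[of N "\<lambda>_::unit. A", OF H refl]) (rule that; assumption)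
  have "0 < l m ()" if m: "m < N" for m
  proof -
    let ?v = "Matrix.vec N (e m)"
    have "?v \<noteq> 0\<^sub>v N"
    proof
      assume "?v = 0\<^sub>v N"
      then have "e m a = 0" if "a < N" for a using that by (metis index_vec index_zero_vec(1))
      then show False using o[OF m m] by simp
    qed
    then have "0 < Re ((A *\<^sub>v ?v) \<bullet>c ?v)" using A by (simp add: pos_def_op_def)
    also have "(A *\<^sub>v ?v) \<bullet>c ?v = (\<Sum>a<N. \<Sum>b<N. cnj (e m a) * A $$ (a, b) * e m b)"
      using H by (subst quadratic_form_sum[of _ N]) auto
    also have "\<dots> = (\<Sum>a<N. \<Sum>b<N. \<Sum>k<N. complex_of_real (l k ()) * ((e k a * cnj (e m a)) * (e m b * cnj (e k b))))"
      by (intro sum.cong refl) (simp add: s[of _ _ "()"] sum_distrib_left sum_distrib_right mult_ac)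
    also have "\<dots> = (\<Sum>k<N. complex_of_real (l k ()) * ((\<Sum>a<N. e k a * cnj (e m a)) * (\<Sum>b<N. e m b * cnj (e k b))))"
      by (subst sum_rotate) (simp only: sum_product, simp only: sum_distrib_left)
    also have "\<dots> = complex_of_real (l m ())"
      using m by (simp add: o if_distrib sum.delta cong: if_cong)
    finally show ?thesis by simp
  qed
  then show thesis using that[of "\<lambda>m. l m ()" e, OF _ c o s] by simp
qed

text \<open>The operator counterpart of \<open>weight_coercive\<close>: for Hermitian
  \<open>A\<close> it says A >= l, tested by the trace against operators whose quadratic form has
  nonnegative real part.\<close>

definition trace_coercive :: "nat \<Rightarrow> complex mat \<Rightarrow> real \<Rightarrow> bool" where
  "trace_coercive N A l \<longleftrightarrow> 0 < l \<and>
     (\<forall>G\<in>carrier_mat N N. (\<forall>x. 0 \<le> Re (\<Sum>a<N. \<Sum>b<N. cnj (x a) * G $$ (a, b) * x b)) \<longrightarrow>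
        l * Re (mat_trace G) \<le> Re (mat_trace (A * G)))"

lemma pos_def_op_trace_coercive:
  assumes A: "pos_def_op N A"
  shows "\<exists>l. trace_coercive N A l"
proof -
  obtain e l where l: "\<And>m. m < N \<Longrightarrow> 0 < (l m :: real)"
    and c: "\<And>a b. a < N \<Longrightarrow> b < N \<Longrightarrow> (\<Sum>m<N. e m a * cnj (e m b)) = (if a = b then 1 else 0)"
    and s: "\<And>a b. a < N \<Longrightarrow> b < N \<Longrightarrow> A $$ (a, b) = (\<Sum>m<N. complex_of_real (l m) * (e m a * cnj (e m b)))"
    by (rule pos_def_op_eigenbasis[OF A]) (rule that; assumption)
  \<comment> \<open>The inserted 1 keeps \<open>Min\<close> meaningful when N = 0 and can only lower
    the bound.\<close>
  define k where "k = Min (insert 1 (l ` {..<N}))"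
  have k: "0 < k" "\<And>m. m < N \<Longrightarrow> k \<le> l m" using l by (auto simp: k_def)
  have "k * Re (mat_trace G) \<le> Re (mat_trace (A * G))"
    if G: "G \<in> carrier_mat N N" and pos: "\<forall>x. 0 \<le> Re (\<Sum>a<N. \<Sum>b<N. cnj (x a) * G $$ (a, b) * x b)" for G
  proof -
    define q where "q m = (\<Sum>a<N. \<Sum>b<N. cnj (e m a) * G $$ (a, b) * e m b)" for m
    have swap: "(\<Sum>m<N. z m * q m) = (\<Sum>b<N. \<Sum>a<N. (\<Sum>m<N. z m * (e m b * cnj (e m a))) * G $$ (a, b))" for z
    proof -
      have "(\<Sum>m<N. z m * q m) = (\<Sum>m<N. \<Sum>b<N. \<Sum>a<N. z m * (e m b * cnj (e m a)) * G $$ (a, b))"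
        unfolding q_def sum_distrib_left by (subst (2) sum.swap) (simp add: mult_ac)
      also have "\<dots> = (\<Sum>b<N. \<Sum>a<N. \<Sum>m<N. z m * (e m b * cnj (e m a)) * G $$ (a, b))"
        by (rule sum_rotate[symmetric])
      finally show ?thesis by (simp only: sum_distrib_right)
    qed
    have "mat_trace (A * G) = (\<Sum>m<N. complex_of_real (l m) * q m)"
      unfolding swap using A G by (subst mat_trace_mult[of _ N N]) (auto simp: s pos_def_op_def intro!: sum.cong)
    moreover have "mat_trace G = (\<Sum>m<N. q m)"
      using swap[of "\<lambda>_. 1"] G by (simp add: c mat_trace_def if_distrib[of "\<lambda>x. x * _"] cong: if_cong)
    moreover have "(\<Sum>m<N. k * Re (q m)) \<le> (\<Sum>m<N. l m * Re (q m))"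
      using k(2) pos by (intro sum_mono mult_right_mono) (auto simp: q_def)
    ultimately show ?thesis by (simp add: sum_distrib_left)
  qed
  with k(1) show ?thesis by (auto simp: trace_coercive_def)
qed

text \<open>\<open>Q\<close> is the root of the eigenvalues times the adjoint of the eigenvector
  matrix. An invertible factor is what passes to tensor powers by multiplicativity alone, and it
  also gives the inverse of \<open>A\<close> as \<open>P\<close> times its adjoint.\<close>

lemma pos_def_op_factor:
  assumes A: "pos_def_op N A"
  obtains Q P where "Q \<in> carrier_mat N N" "P \<in> carrier_mat N N" "A = mat_adjoint Q * Q" "P * Q = 1\<^sub>m N" "Q * P = 1\<^sub>m N"
proof -
  obtain e l where l: "\<And>m. m < N \<Longrightarrow> 0 < (l m :: real)"
    and c: "\<And>a b. a < N \<Longrightarrow> b < N \<Longrightarrow> (\<Sum>m<N. e m a * cnj (e m b)) = (if a = b then 1 else 0)"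
    and s: "\<And>a b. a < N \<Longrightarrow> b < N \<Longrightarrow> A $$ (a, b) = (\<Sum>m<N. complex_of_real (l m) * (e m a * cnj (e m b)))"
    by (rule pos_def_op_eigenbasis[OF A]) (rule that; assumption)
  define Q where "Q = Matrix.mat N N (\<lambda>(m, a). complex_of_real (sqrt (l m)) * cnj (e m a))"
  define P where "P = Matrix.mat N N (\<lambda>(a, m). e m a / complex_of_real (sqrt (l m)))"
  have Q: "Q \<in> carrier_mat N N" and P: "P \<in> carrier_mat N N" by (auto simp: Q_def P_def)
  have AN: "A \<in> carrier_mat N N" using A by (simp add: pos_def_op_def)
  have "A = mat_adjoint Q * Q"
  proof (rule eq_matI)
    fix a b assume "a < dim_row (mat_adjoint Q * Q)" "b < dim_col (mat_adjoint Q * Q)"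
    then have ab: "a < N" "b < N" using Q by auto
    have sq: "complex_of_real (sqrt (l m)) * complex_of_real (sqrt (l m)) = complex_of_real (l m)" if "m < N" for m
      using l[OF that] by (simp flip: of_real_mult)
    have "(mat_adjoint Q * Q) $$ (a, b) = (\<Sum>m<N. mat_adjoint Q $$ (a, m) * Q $$ (m, b))"
      by (rule mult_mat_sum[OF mat_adjoint_carrier[OF Q] Q ab])
    also have "\<dots> = (\<Sum>m<N. (complex_of_real (sqrt (l m)) * complex_of_real (sqrt (l m))) * (e m a * cnj (e m b)))"
      using ab Q by (intro sum.cong) (auto simp: mat_adjoint_index, auto simp: Q_def mult_ac)
    also have "\<dots> = A $$ (a, b)" unfolding s[OF ab] by (intro sum.cong) (auto simp: sq)
    finally show "A $$ (a, b) = (mat_adjoint Q * Q) $$ (a, b)" by simp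
  qed (use AN Q in auto)
  moreover have PQ: "P * Q = 1\<^sub>m N"
  proof (rule eq_matI)
    fix a b assume "a < dim_row (1\<^sub>m N)" "b < dim_col (1\<^sub>m N)"
    then have ab: "a < N" "b < N" by auto
    have "(P * Q) $$ (a, b) = (\<Sum>m<N. P $$ (a, m) * Q $$ (m, b))" by (rule mult_mat_sum[OF P Q ab])
    also have "\<dots> = (\<Sum>m<N. e m a * cnj (e m b))"
      using ab l by (intro sum.cong) (auto simp: P_def Q_def order.strict_implies_not_eq[OF l, symmetric])
    finally show "(P * Q) $$ (a, b) = 1\<^sub>m N $$ (a, b)" using ab by (simp add: c)
  qed (use P Q in auto)
  moreover have "Q * P = 1\<^sub>m N" using mat_mult_left_right_inverse[OF P Q PQ] .
  ultimately show thesis using that Q P by blast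
qed

text \<open>The quadratic form at \<open>v\<close> is the squared norm of \<open>Q v\<close>, and
  the left inverse \<open>P\<close> makes \<open>Q\<close> injective.\<close>

lemma pos_def_op_gram:
  assumes Q: "Q \<in> carrier_mat N N" and P: "P \<in> carrier_mat N N" "P * Q = 1\<^sub>m N"
  shows "pos_def_op N (mat_adjoint Q * Q)"
proof -
  have "hermitian_op N (mat_adjoint Q * Q)"
    using mult_carrier_mat[OF mat_adjoint_carrier[OF Q] Q] mat_adjoint_mult[OF mat_adjoint_carrier[OF Q] Q]
    by (simp add: hermitian_op_def mat_adjoint_adjoint)
  moreover have "0 < Re (((mat_adjoint Q * Q) *\<^sub>v v) \<bullet>c v)" if v: "v \<in> carrier_vec N" "v \<noteq> 0\<^sub>v N" for v
  proof -
    define w where "w = Q *\<^sub>v v"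
    have w: "w \<in> carrier_vec N" using Q v by (simp add: w_def)
    have "P *\<^sub>v w = v" using assoc_mult_mat_vec[OF P(1) Q v(1)] P(2) v(1) by (simp add: w_def)
    moreover have "P *\<^sub>v 0\<^sub>v N = 0\<^sub>v N" using P(1) by auto
    ultimately have "w \<noteq> 0\<^sub>v N" using v by metis
    then obtain a where a: "a < N" "vec_index w a \<noteq> 0" using w by (auto simp: vec_eq_iff)
    have "((mat_adjoint Q * Q) *\<^sub>v v) \<bullet>c v = (mat_adjoint Q *\<^sub>v w) \<bullet>c v"
      using Q v by (simp add: w_def assoc_mult_mat_vec[of _ N N _ N])
    also have "\<dots> = (\<Sum>a<N. \<Sum>b<N. cnj (Q $$ (b, a)) * vec_index w b * cnj (vec_index v a))"
      using Q mult_mat_vec_sum[OF mat_adjoint_carrier[OF Q] w]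
      by (auto simp: cscalar_prod_sum[OF v(1)] sum_distrib_right mat_adjoint_index intro!: sum.cong)
    also have "\<dots> = (\<Sum>b<N. vec_index w b * cnj (vec_index w b))"
      using mult_mat_vec_sum[OF Q v(1)]
      by (subst sum.swap) (auto simp: w_def[symmetric] sum_distrib_left mult_ac intro!: sum.cong)
    also have "Re \<dots> = (\<Sum>b<N. (cmod (vec_index w b))\<^sup>2)"
      by (simp add: complex_mult_cnj cmod_power2 del: of_real_add of_real_power)
    finally show ?thesis using a by (simp add: sum_pos2[of _ a])
  qed
  ultimately show ?thesis by (simp add: pos_def_op_def)
qed

lemma pos_def_op_tensor_pow:
  assumes A: "pos_def_op d A"
  shows "pos_def_op (d ^ n) (tensor_pow A n)"
proof -
  obtain Q P where Q: "Q \<in> carrier_mat d d" and P: "P \<in> carrier_mat d d"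
    and AQ: "A = mat_adjoint Q * Q" and PQ: "P * Q = 1\<^sub>m d"
    using pos_def_op_factor[OF A] by metis
  have "tensor_pow P n * tensor_pow Q n = 1\<^sub>m (d ^ n)"
    by (simp add: tensor_pow_mult[OF P Q] PQ tensor_pow_one)
  then have "pos_def_op (d ^ n) (mat_adjoint (tensor_pow Q n) * tensor_pow Q n)"
    using Q P by (intro pos_def_op_gram[of _ _ "tensor_pow P n"]) auto
  then show ?thesis
    by (simp add: AQ tensor_pow_adjoint[OF Q] tensor_pow_mult[OF mat_adjoint_carrier[OF Q] Q])
qed

lemma pos_def_op_inverse:
  assumes A: "pos_def_op N A"
  obtains B where "B \<in> carrier_mat N N" "A * B = 1\<^sub>m N" "B * A = 1\<^sub>m N"
proof -
  obtain Q P where Q: "Q \<in> carrier_mat N N" and P: "P \<in> carrier_mat N N"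
    and AQ: "A = mat_adjoint Q * Q" and PQ: "P * Q = 1\<^sub>m N" and QP: "Q * P = 1\<^sub>m N"
    using pos_def_op_factor[OF A] by metis
  let ?B = "P * mat_adjoint P"
  have AN: "A \<in> carrier_mat N N" using A by (simp add: pos_def_op_def)
  have B: "?B \<in> carrier_mat N N" using P by simp
  have "A * ?B = mat_adjoint Q * (Q * P * mat_adjoint P)"
    unfolding AQ using Q P by (simp add: assoc_mult_mat[of _ N N _ N _ N])
  also have "\<dots> = mat_adjoint (P * Q)"
    using Q P by (simp add: QP mat_adjoint_mult[OF P Q])
  finally have "A * ?B = 1\<^sub>m N" by (simp add: PQ mat_adjoint_one)
  with mat_mult_left_right_inverse[OF AN B this] B that show thesis by blast
qed

section \<open>Projection onto collective observables\<close>

lemma mat_trace_cycle: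
  assumes "A \<in> carrier_mat N N" "B \<in> carrier_mat N N" "C \<in> carrier_mat N N"
  shows "mat_trace (A * (B * C)) = mat_trace (B * (C * A))"
  using mat_trace_comm[OF assms(1) mult_carrier_mat[OF assms(2,3)]] assoc_mult_mat[OF assms(2,3,1)] by simp

lemma mat_trace_nondegenerate:
  assumes B: "B \<in> carrier_mat N N" and C: "C \<in> carrier_mat N N"
    and eq: "\<And>A. A \<in> carrier_mat N N \<Longrightarrow> mat_trace (A * B) = mat_trace (A * C)"
  shows "B = C"
proof (rule eq_matI)
  fix i j assume "i < dim_row C" "j < dim_col C"
  then have ij: "i < N" "j < N" using C by auto
  \<comment> \<open>This is the matrix unit with its 1 at position (j, i); the trace against it
    reads off the entry (i, j).\<close>
  define A where "A = Matrix.mat N N (\<lambda>(a, b). if b = i then if a = j then 1 else 0 else (0::complex))"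
  have A: "A \<in> carrier_mat N N" by (simp add: A_def)
  have "mat_trace (A * M) = M $$ (i, j)" if "M \<in> carrier_mat N N" for M
  proof -
    have "mat_trace (A * M) = (\<Sum>a<N. \<Sum>b<N. if b = i then if a = j then M $$ (b, a) else 0 else 0)"
      unfolding mat_trace_mult[OF A that] by (intro sum.cong) (auto simp: A_def)
    then show ?thesis using ij by simp
  qed
  then show "B $$ (i, j) = C $$ (i, j)" using eq[OF A] B C by simp
qed (use B C in auto)

text \<open>The coefficient of \<open>A $$ (i, j)\<close> in the entry (x, y) of
  \<open>collective d n A\<close>. Having the linear map \<open>J\<close> in coordinates gives both
  its transpose for the trace pairing and its continuity.\<close>

fun collective_coeff :: "nat \<Rightarrow> nat \<Rightarrow> nat \<Rightarrow> nat \<Rightarrow> nat \<Rightarrow> nat \<Rightarrow> complex" where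
  "collective_coeff d 0 x y i j = 0"
| "collective_coeff d (Suc n) x y i j =
     (if j = y div d ^ n then if i = x div d ^ n then 1\<^sub>m (d ^ n) $$ (x mod d ^ n, y mod d ^ n) else 0 else 0)
       + 1\<^sub>m d $$ (x div d ^ n, y div d ^ n) * collective_coeff d n (x mod d ^ n) (y mod d ^ n) i j"

lemma collective_index:
  assumes A: "A \<in> carrier_mat d d"
  shows "x < d ^ n \<Longrightarrow> y < d ^ n \<Longrightarrow>
     collective d n A $$ (x, y) = (\<Sum>i<d. \<Sum>j<d. A $$ (i, j) * collective_coeff d n x y i j)"
proof (induction n arbitrary: x y)
  case (Suc n)
  let ?m = "d ^ n"
  have xy: "x < d * ?m" "y < d * ?m" using Suc.prems by auto
  note dm = div_mod_less_mult[OF xy(1)] div_mod_less_mult[OF xy(2)]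
  note J = collective_carrier[OF A, of n]
  have "(\<Sum>i<d. \<Sum>j<d. A $$ (i, j) * collective_coeff d (Suc n) x y i j)
     = (\<Sum>i<d. \<Sum>j<d. if j = y div ?m then if i = x div ?m then A $$ (i, j) * 1\<^sub>m ?m $$ (x mod ?m, y mod ?m) else 0 else 0)
       + 1\<^sub>m d $$ (x div ?m, y div ?m) * (\<Sum>i<d. \<Sum>j<d. A $$ (i, j) * collective_coeff d n (x mod ?m) (y mod ?m) i j)"
    unfolding collective_coeff.simps sum_distrib_left sum.distrib[symmetric]
    by (intro sum.cong refl) (simp add: distrib_left mult_ac)
  also have "\<dots> = A $$ (x div ?m, y div ?m) * 1\<^sub>m ?m $$ (x mod ?m, y mod ?m)
       + 1\<^sub>m d $$ (x div ?m, y div ?m) * collective d n A $$ (x mod ?m, y mod ?m)"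
    using dm by (simp add: Suc.IH)
  also have "\<dots> = collective d (Suc n) A $$ (x, y)"
    using xy carrier_matD[OF kronecker_carrier[OF one_carrier_mat[of d] J]]
    by (simp add: kronecker_index[OF A one_carrier_mat xy] kronecker_index[OF one_carrier_mat J xy])
  finally show ?case by simp
qed simp

text \<open>\<open>K\<close> is the transpose of \<open>J\<close> applied to \<open>X\<close>, that
  is, the sum of the \<open>n\<close> one-copy partial traces of \<open>X\<close>.\<close>

lemma collective_trace_dual:
  assumes X: "X \<in> carrier_mat (d ^ n) (d ^ n)"
  obtains K where "K \<in> carrier_mat d d"
    "\<And>A. A \<in> carrier_mat d d \<Longrightarrow> mat_trace (collective d n A * X) = mat_trace (A * K)"
proof -
  define K where "K = Matrix.mat d d (\<lambda>(j, i). \<Sum>x<d ^ n. \<Sum>y<d ^ n. collective_coeff d n x y i j * X $$ (y, x))"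
  have K: "K \<in> carrier_mat d d" by (simp add: K_def)
  have "mat_trace (collective d n A * X) = mat_trace (A * K)" if A: "A \<in> carrier_mat d d" for A
  proof -
    have "mat_trace (collective d n A * X)
        = (\<Sum>x<d ^ n. \<Sum>y<d ^ n. \<Sum>i<d. \<Sum>j<d. A $$ (i, j) * (collective_coeff d n x y i j * X $$ (y, x)))"
      unfolding mat_trace_mult[OF collective_carrier[OF A] X]
      by (intro sum.cong refl) (simp add: collective_index[OF A] sum_distrib_left sum_distrib_right mult_ac)
    also have "\<dots> = (\<Sum>i<d. \<Sum>x<d ^ n. \<Sum>y<d ^ n. \<Sum>j<d. A $$ (i, j) * (collective_coeff d n x y i j * X $$ (y, x)))"
      by (rule sum_rotate)
    also have "\<dots> = (\<Sum>i<d. \<Sum>j<d. \<Sum>x<d ^ n. \<Sum>y<d ^ n. A $$ (i, j) * (collective_coeff d n x y i j * X $$ (y, x)))"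
      by (intro sum.cong refl sum_rotate)
    also have "\<dots> = mat_trace (A * K)"
      unfolding mat_trace_mult[OF A K] by (intro sum.cong refl) (simp add: K_def sum_distrib_left)
    finally show ?thesis .
  qed
  with K that show thesis by blast
qed

text \<open>\<open>S\<close> is \<open>n\<close> times the orthogonal projection of \<open>X\<close> onto the collective observables
  \<open>A \<otimes> 1 \<otimes> \<dots> + \<dots> + 1 \<otimes> \<dots> \<otimes> A\<close>, for the inner product \<open>Tr (\<rho>\<^sup>\<otimes>\<^sup>n A\<^sup>\<dagger> B)\<close>. Since \<open>\<rho>\<^sup>\<otimes>\<^sup>n\<close> maps
  collective observables to collective observables by conjugation, \<open>S\<close> is Hermitian and
  represents \<open>X\<close> on both sides.\<close>

lemma collective_projection:
  assumes r: "pos_def_op d r" and X: "hermitian_op (d ^ n) X"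
  obtains S where "hermitian_op d S"
    "\<And>A. A \<in> carrier_mat d d \<Longrightarrow> mat_trace (tensor_pow r n * (collective d n A * X)) = mat_trace (r * (A * S))"
    "\<And>A. A \<in> carrier_mat d d \<Longrightarrow> mat_trace (tensor_pow r n * (X * collective d n A)) = mat_trace (r * (S * A))"
proof -
  obtain ri where ri: "ri \<in> carrier_mat d d" "r * ri = 1\<^sub>m d" "ri * r = 1\<^sub>m d" using pos_def_op_inverse[OF r] .
  have rH: "hermitian_op d r" using r by (simp add: pos_def_op_def)
  then have rC: "r \<in> carrier_mat d d" by simp
  have XC: "X \<in> carrier_mat (d ^ n) (d ^ n)" using X by simp
  note T = tensor_pow_carrier[OF rC, of n]
  have TH: "mat_adjoint (tensor_pow r n) = tensor_pow r n"
    using rH by (simp add: tensor_pow_adjoint[OF rC] hermitian_op_def)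
  obtain K where K: "K \<in> carrier_mat d d"
    "\<And>A. A \<in> carrier_mat d d \<Longrightarrow> mat_trace (collective d n A * (X * tensor_pow r n)) = mat_trace (A * K)"
    by (rule collective_trace_dual[OF mult_carrier_mat[OF XC T]]) (rule that; assumption)
  \<comment> \<open>The wanted identity Tr (A K) = Tr (r A S) = Tr (A S r) for all \<open>A\<close>
    forces S r = K.\<close>
  define S where "S = K * ri"
  have S: "S \<in> carrier_mat d d" using K ri by (simp add: S_def)
  have Sr: "S * r = K" using K(1) ri rC by (simp add: S_def assoc_mult_mat[OF K(1) ri(1) rC])
  have left: "mat_trace (tensor_pow r n * (collective d n A * X)) = mat_trace (r * (A * S))"
    if A: "A \<in> carrier_mat d d" for A
  proof -
    have "mat_trace (tensor_pow r n * (collective d n A * X)) = mat_trace (collective d n A * (X * tensor_pow r n))"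
      by (rule mat_trace_cycle[OF T collective_carrier[OF A] XC])
    also have "\<dots> = mat_trace (A * (S * r))" by (simp add: K(2)[OF A] Sr)
    also have "\<dots> = mat_trace (r * (A * S))" by (rule mat_trace_cycle[OF rC A S, symmetric])
    finally show ?thesis .
  qed
  have right: "mat_trace (tensor_pow r n * (X * collective d n A)) = mat_trace (r * (S * A))"
    if A: "A \<in> carrier_mat d d" for A
  proof -
    \<comment> \<open>\<open>A'\<close> is \<open>A\<close> conjugated by the state, so that J(A)
      times the n-copy state equals the n-copy state times J(A'). A pairing from the right thereby
      becomes one from the left.\<close>
    define A' where "A' = ri * (A * r)"
    have A': "A' \<in> carrier_mat d d" using A ri rC by (simp add: A'_def)
    have rA': "r * A' = A * r"
      using assoc_mult_mat[OF rC ri(1) mult_carrier_mat[OF A rC]] left_mult_one_mat[OF mult_carrier_mat[OF A rC]]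
      by (simp add: A'_def ri)
    note J = collective_carrier[OF A, of n] collective_carrier[OF A', of n]
    have "mat_trace (tensor_pow r n * (X * collective d n A)) = mat_trace (collective d n A * (tensor_pow r n * X))"
      using mat_trace_cycle[OF J(1) T XC] by simp
    also have "\<dots> = mat_trace (tensor_pow r n * (collective d n A' * X))"
      using assoc_mult_mat[OF J(1) T XC] assoc_mult_mat[OF T J(2) XC]
        collective_tensor_pow[OF A A' rC rA'[symmetric], of n] by simp
    also have "\<dots> = mat_trace (r * (A' * S))" by (rule left[OF A'])
    also have "\<dots> = mat_trace (A * (r * S))"
      using assoc_mult_mat[OF rC A' S] assoc_mult_mat[OF A rC S] by (simp add: rA')
    also have "\<dots> = mat_trace (r * (S * A))" by (rule mat_trace_cycle[OF A rC S])
    finally show ?thesis .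
  qed
  have S': "mat_adjoint S \<in> carrier_mat d d" using S by simp
  \<comment> \<open>Taking adjoints in \<open>right\<close>, applied to the adjoint of
    \<open>A\<close>, produces the left-hand side, while the defining property of \<open>K\<close>
    produces the right-hand side. Since \<open>A\<close> is arbitrary and \<open>r\<close> is
    invertible, \<open>S\<close> is Hermitian.\<close>
  have "mat_trace (A * (mat_adjoint S * r)) = mat_trace (A * (S * r))" if A: "A \<in> carrier_mat d d" for A
  proof -
    have Aa: "mat_adjoint A \<in> carrier_mat d d" using A by simp
    note J = collective_carrier[OF A, of n] collective_carrier[OF Aa, of n]
    have "mat_adjoint (r * (S * mat_adjoint A)) = A * (mat_adjoint S * r)"
      using rH mat_adjoint_mult[OF rC mult_carrier_mat[OF S Aa]] mat_adjoint_mult[OF S Aa] assoc_mult_mat[OF A S' rC]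
      by (simp add: mat_adjoint_adjoint hermitian_op_def)
    then have "mat_trace (A * (mat_adjoint S * r)) = cnj (mat_trace (r * (S * mat_adjoint A)))"
      using mat_trace_adjoint[OF mult_carrier_mat[OF rC mult_carrier_mat[OF S Aa]]] by simp
    also have "\<dots> = cnj (mat_trace (tensor_pow r n * (X * collective d n (mat_adjoint A))))"
      by (simp add: right[OF Aa])
    also have "\<dots> = mat_trace (mat_adjoint (tensor_pow r n * (X * collective d n (mat_adjoint A))))"
      using mat_trace_adjoint[OF mult_carrier_mat[OF T mult_carrier_mat[OF XC J(2)]]] by simp
    also have "mat_adjoint (tensor_pow r n * (X * collective d n (mat_adjoint A)))
        = collective d n A * (X * tensor_pow r n)"
      using X mat_adjoint_mult[OF T mult_carrier_mat[OF XC J(2)]] mat_adjoint_mult[OF XC J(2)] assoc_mult_mat[OF J(1) XC T]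
      by (simp add: TH collective_adjoint[OF Aa] mat_adjoint_adjoint hermitian_op_def)
    also have "mat_trace \<dots> = mat_trace (A * (S * r))" by (simp add: K(2)[OF A] Sr)
    finally show ?thesis .
  qed
  then have "mat_adjoint S * r = S * r"
    by (rule mat_trace_nondegenerate[OF mult_carrier_mat[OF S' rC] mult_carrier_mat[OF S rC]])
  then have "mat_adjoint S * r * ri = S * r * ri" by simp
  then have "mat_adjoint S = S"
    unfolding assoc_mult_mat[OF S' rC ri(1)] assoc_mult_mat[OF S rC ri(1)] ri(2) using S S' by simp
  with S have "hermitian_op d S" by (simp add: hermitian_op_def)
  with left right that show thesis by blast
qed

lemma mat_trace_mult_affine:
  assumes "T \<in> carrier_mat N N" "X \<in> carrier_mat N N" "Y \<in> carrier_mat N N" "P \<in> carrier_mat N N" "Q \<in> carrier_mat N N"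
  shows "mat_trace (T * ((X + z \<cdot>\<^sub>m P) * (Y + z \<cdot>\<^sub>m Q)))
    = mat_trace (T * (X * Y)) + z * mat_trace (T * (X * Q)) + z * mat_trace (T * (P * Y)) + z * z * mat_trace (T * (P * Q))"
proof -
  note zQ = smult_carrier_mat[OF assms(5), of z] and zP = smult_carrier_mat[OF assms(4), of z]
  have "(X + z \<cdot>\<^sub>m P) * (Y + z \<cdot>\<^sub>m Q) = (X * Y + z \<cdot>\<^sub>m (P * Y)) + (z \<cdot>\<^sub>m (X * Q) + (z * z) \<cdot>\<^sub>m (P * Q))"
    unfolding mult_add_distrib_mat[OF add_carrier_mat[OF zP] assms(3) zQ] add_mult_distrib_mat[OF assms(2) zP assms(3)]
      add_mult_distrib_mat[OF assms(2) zP zQ]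
    using assms by (simp add: mult_smult_distrib[of _ N N] mult_smult_assoc_mat[of _ N N]) (intro eq_matI; auto)
  moreover have "T * (z \<cdot>\<^sub>m M) = z \<cdot>\<^sub>m (T * M)" if "M \<in> carrier_mat N N" for M z
    using mult_smult_distrib[OF assms(1) that] .
  ultimately show ?thesis
    using assms
    by (simp add: mult_add_distrib_mat[of T N N _ N] mat_trace_add[of _ N] mat_trace_smult[of _ N])
qed

text \<open>If J(C) = 0, the additivity of covariances gives 0 = n Tr (r A' C) for every centred
  \<open>A'\<close>. As Tr (r C) = 0 too, this extends to all \<open>A\<close>, and the trace
  pairing and \<open>r\<close> are nondegenerate.\<close>

lemma collective_eq_zero_imp:
  assumes r: "pos_def_op d r" "mat_trace r = 1" and n: "0 < n"
    and C: "C \<in> carrier_mat d d" and J: "collective d n C = 0\<^sub>m (d ^ n) (d ^ n)"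
  shows "C = 0\<^sub>m d d"
proof -
  obtain ri where ri: "ri \<in> carrier_mat d d" "r * ri = 1\<^sub>m d" "ri * r = 1\<^sub>m d" using pos_def_op_inverse[OF r(1)] .
  have rC: "r \<in> carrier_mat d d" using r(1) by (simp add: pos_def_op_def)
  note T = tensor_pow_carrier[OF rC, of n]
  have zero: "mat_trace (0\<^sub>m N N) = 0" for N by (simp add: mat_trace_def)
  have trC: "mat_trace (r * C) = 0"
    using collective_trace[OF C rC r(2), of n] n right_mult_zero_mat[OF T] by (simp add: J zero)
  have "mat_trace (A * (C * r)) = mat_trace (A * 0\<^sub>m d d)" if A: "A \<in> carrier_mat d d" for A
  proof -
    \<comment> \<open>\<open>A\<close> is centred by subtracting its expectation, as
      \<open>collective_trace_mult\<close> requires.\<close>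
    define A' where "A' = A + (- mat_trace (r * A)) \<cdot>\<^sub>m 1\<^sub>m d"
    have A': "A' \<in> carrier_mat d d" using A by (simp add: A'_def)
    have dist: "r * A' = r * A + (- mat_trace (r * A)) \<cdot>\<^sub>m r"
      unfolding A'_def using A rC by (simp add: mult_add_distrib_mat[of r d d _ d] mult_smult_distrib[of r d d _ d])
    then have "mat_trace (r * A') = 0"
      using A rC by (simp add: mat_trace_add[of _ d] mat_trace_smult[of _ d] r(2))
    then have "of_nat n * mat_trace (r * (A' * C)) = mat_trace (tensor_pow r n * (collective d n A' * collective d n C))"
      by (intro collective_trace_mult[OF A' _ C trC rC r(2), symmetric])
    also have "\<dots> = 0" using right_mult_zero_mat[OF collective_carrier[OF A']] right_mult_zero_mat[OF T] by (simp add: J zero)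
    finally have "mat_trace (r * (A' * C)) = 0" using n by simp
    moreover have "r * (A' * C) = r * (A * C) + (- mat_trace (r * A)) \<cdot>\<^sub>m (r * C)"
      using assoc_mult_mat[OF rC A' C] assoc_mult_mat[OF rC A C] A C rC
        add_mult_distrib_mat[OF mult_carrier_mat[OF rC A] smult_carrier_mat[OF rC] C]
        mult_smult_assoc_mat[OF rC C] by (simp add: dist)
    ultimately have "mat_trace (r * (A * C)) = 0"
      using A C rC by (simp add: mat_trace_add[of _ d] mat_trace_smult[of _ d] trC)
    then have "mat_trace (A * (C * r)) = 0" using mat_trace_cycle[OF rC A C] by simp
    then show ?thesis using right_mult_zero_mat[OF A] by (simp add: zero)
  qed
  then have "C * r = 0\<^sub>m d d"
    by (rule mat_trace_nondegenerate[OF mult_carrier_mat[OF C rC] zero_carrier_mat])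
  then have "C * r * ri = 0\<^sub>m d d" using left_mult_zero_mat[OF ri(1)] by simp
  then show ?thesis unfolding assoc_mult_mat[OF C rC ri(1)] ri(2) using C by simp
qed

text \<open>The n-copy derivative is the n-copy state times a collective operator, so testing an
  observable against it only involves the projection of that observable onto the collective ones.
  This makes the projection compatible with local unbiasedness.\<close>

lemma partial_tensor_pow:
  fixes \<rho> :: "real ^ 'p \<Rightarrow> complex mat"
  assumes \<Theta>: "\<forall>\<theta>\<in>\<Theta>. density_op d (\<rho> \<theta>)" and 0: "0 \<in> interior \<Theta>"
    and smooth: "\<forall>i<d. \<forall>j<d. smooth_on (interior \<Theta>) (\<lambda>\<theta>. \<rho> \<theta> $$ (i, j))"
    and A: "A \<in> carrier_mat d d" "\<rho> 0 * A = partial_at_0 d \<rho> \<nu>"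
  shows "partial_at_0 (d ^ n) (\<lambda>\<theta>. tensor_pow (\<rho> \<theta>) n) \<nu> = tensor_pow (\<rho> 0) n * collective d n A"
proof -
  define F where "F t = \<rho> (t *\<^sub>R axis \<nu> 1)" for t
  have F0: "F 0 = \<rho> 0" by (simp add: F_def)
  have \<rho>C: "\<rho> \<theta> \<in> carrier_mat d d" if "\<theta> \<in> interior \<Theta>" for \<theta>
    using \<Theta> that interior_subset unfolding density_op_def pos_semidef_op_def hermitian_op_def by blast
  \<comment> \<open>For small \<open>t\<close> the coordinate line stays in the interior of the
    parameter set, where \<open>F t\<close> is a \<open>d\<close> by \<open>d\<close> state.\<close>
  have "open ((\<lambda>t. t *\<^sub>R axis \<nu> 1) -` interior \<Theta> :: real set)"
    by (intro open_vimage open_interior continuous_intros)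
  then have ev: "\<forall>\<^sub>F t in nhds 0. F t \<in> carrier_mat d d"
    unfolding eventually_nhds using 0 \<rho>C by (intro exI conjI) (auto simp: F_def)
  have deriv: "((\<lambda>t. F t $$ (i, j)) has_vector_derivative partial_at_0 d \<rho> \<nu> $$ (i, j)) (at 0)"
    if ij: "i < d" "j < d" for i j
  proof -
    have "times_differentiable_on (Suc 0) (interior \<Theta>) (\<lambda>\<theta>. \<rho> \<theta> $$ (i, j))"
      using smooth ij unfolding smooth_on_def by blast
    then have "(\<lambda>\<theta>. \<rho> \<theta> $$ (i, j)) differentiable (at (0 *\<^sub>R axis \<nu> 1))" using 0 by simp
    moreover have "(\<lambda>t. t *\<^sub>R axis \<nu> (1::real)) differentiable (at 0)"
      by (intro derivative_intros)
    ultimately have "((\<lambda>\<theta>. \<rho> \<theta> $$ (i, j)) \<circ> (\<lambda>t. t *\<^sub>R axis \<nu> 1)) differentiable (at 0)"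
      by (intro differentiable_chain_at) auto
    then show ?thesis
      using ij by (simp add: partial_at_0_def F_def comp_def vector_derivative_works)
  qed
  have D: "partial_at_0 d \<rho> \<nu> \<in> carrier_mat d d" by (simp add: partial_at_0_def)
  note T = mult_carrier_mat[OF tensor_pow_carrier[OF \<rho>C[OF 0], of n] collective_carrier[OF A(1), of n]]
  show ?thesis
  proof (rule eq_matI)
    fix i j assume "i < dim_row (tensor_pow (\<rho> 0) n * collective d n A)" "j < dim_col (tensor_pow (\<rho> 0) n * collective d n A)"
    then have ij: "i < d ^ n" "j < d ^ n" using carrier_matD[OF T] by auto
    have "((\<lambda>t. tensor_pow (F t) n $$ (i, j)) has_vector_derivative (tensor_pow (F 0) n * collective d n A) $$ (i, j)) (at 0)"
      using A by (intro tensor_pow_has_vector_derivative[OF deriv ev D _ _ ij]) (auto simp: F0)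
    then show "partial_at_0 (d ^ n) (\<lambda>\<theta>. tensor_pow (\<rho> \<theta>) n) \<nu> $$ (i, j) = (tensor_pow (\<rho> 0) n * collective d n A) $$ (i, j)"
      using ij by (simp add: partial_at_0_def F0[symmetric] vector_derivative_at del: index_mult_mat) (simp add: F_def vector_derivative_at)
  qed (use carrier_matD[OF T] in \<open>auto simp: partial_at_0_def\<close>)
qed

section \<open>Positive semidefinite operator kernels\<close>

lemma sum_swap4:
  "(\<Sum>a\<in>A. \<Sum>b\<in>B. \<Sum>i\<in>I. \<Sum>j\<in>J. f a b i j) = (\<Sum>i\<in>I. \<Sum>j\<in>J. \<Sum>a\<in>A. \<Sum>b\<in>B. f a b i j)"
proof -
  have "(\<Sum>a\<in>A. \<Sum>b\<in>B. \<Sum>i\<in>I. \<Sum>j\<in>J. f a b i j) = (\<Sum>i\<in>I. \<Sum>a\<in>A. \<Sum>b\<in>B. \<Sum>j\<in>J. f a b i j)"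
    by (rule sum_rotate)
  also have "\<dots> = (\<Sum>i\<in>I. \<Sum>j\<in>J. \<Sum>a\<in>A. \<Sum>b\<in>B. f a b i j)"
    by (intro sum.cong refl sum_rotate)
  finally show ?thesis .
qed

text \<open>\<open>G\<close> is read as a block matrix over the parameters with operator entries,
  and this is its sesquilinear form on families of vectors.\<close>

definition kernel_form ::
    "nat \<Rightarrow> ('p::finite \<Rightarrow> 'p \<Rightarrow> complex mat) \<Rightarrow> ('p \<Rightarrow> nat \<Rightarrow> complex) \<Rightarrow> ('p \<Rightarrow> nat \<Rightarrow> complex) \<Rightarrow> complex" where
  "kernel_form N G x y = (\<Sum>\<mu>\<in>UNIV. \<Sum>\<nu>\<in>UNIV. \<Sum>a<N. \<Sum>b<N. cnj (x \<mu> a) * G \<mu> \<nu> $$ (a, b) * y \<nu> b)"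

definition psd_kernel :: "nat \<Rightarrow> ('p::finite \<Rightarrow> 'p \<Rightarrow> complex mat) \<Rightarrow> bool" where
  "psd_kernel N G \<longleftrightarrow> (\<forall>x. 0 \<le> Re (kernel_form N G x x))"

text \<open>Hermiticity lets the left factor act on the left vector, so the form is the squared norm
  of the sum of all \<open>R \<nu>\<close> applied to \<open>x \<nu>\<close>.\<close>

lemma kernel_form_gram:
  assumes R: "\<And>\<mu>. hermitian_op N (R \<mu>)"
  shows "kernel_form N (\<lambda>\<mu> \<nu>. R \<mu> * R \<nu>) x x
    = (\<Sum>c<N. cnj (\<Sum>\<nu>\<in>UNIV. \<Sum>b<N. R \<nu> $$ (c, b) * x \<nu> b) * (\<Sum>\<nu>\<in>UNIV. \<Sum>b<N. R \<nu> $$ (c, b) * x \<nu> b))"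
proof -
  define v where "v \<nu> c = (\<Sum>b<N. R \<nu> $$ (c, b) * x \<nu> b)" for \<nu> c
  have RC: "R \<mu> \<in> carrier_mat N N" for \<mu> using R by simp
  have "(\<Sum>a<N. \<Sum>b<N. cnj (x \<mu> a) * (R \<mu> * R \<nu>) $$ (a, b) * x \<nu> b) = (\<Sum>c<N. cnj (v \<mu> c) * v \<nu> c)" for \<mu> \<nu>
  proof -
    have "(\<Sum>a<N. \<Sum>b<N. cnj (x \<mu> a) * (R \<mu> * R \<nu>) $$ (a, b) * x \<nu> b)
        = (\<Sum>a<N. \<Sum>b<N. \<Sum>c<N. (cnj (x \<mu> a) * R \<mu> $$ (a, c)) * (R \<nu> $$ (c, b) * x \<nu> b))"
      by (intro sum.cong refl)
         (simp add: mult_mat_sum[OF RC RC] sum_distrib_left sum_distrib_right mult_ac del: index_mult_mat)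
    also have "\<dots> = (\<Sum>c<N. (\<Sum>a<N. cnj (x \<mu> a) * R \<mu> $$ (a, c)) * v \<nu> c)"
      by (subst sum_rotate) (simp add: v_def sum_product)
    also have "\<dots> = (\<Sum>c<N. cnj (v \<mu> c) * v \<nu> c)"
      by (intro sum.cong refl) (auto simp: v_def hermitian_op_index[OF R] mult.commute intro!: sum.cong)
    finally show ?thesis .
  qed
  then have "kernel_form N (\<lambda>\<mu> \<nu>. R \<mu> * R \<nu>) x x = (\<Sum>\<mu>\<in>UNIV. \<Sum>\<nu>\<in>UNIV. \<Sum>c<N. cnj (v \<mu> c) * v \<nu> c)"
    by (simp add: kernel_form_def)
  also have "\<dots> = (\<Sum>c<N. cnj (\<Sum>\<nu>\<in>UNIV. v \<nu> c) * (\<Sum>\<nu>\<in>UNIV. v \<nu> c))"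
    by (subst sum_rotate) (simp add: sum_product)
  finally show ?thesis by (simp add: v_def)
qed

lemma cnj_mult_self_Re: "0 \<le> Re (cnj z * z)"
  by simp

lemma psd_kernel_gram:
  assumes R: "\<And>\<mu>. hermitian_op N (R \<mu>)"
  shows "psd_kernel N (\<lambda>\<mu> \<nu>. R \<mu> * R \<nu>)"
  unfolding psd_kernel_def kernel_form_gram[OF R] Re_sum by (intro allI sum_nonneg cnj_mult_self_Re)

section \<open>Mean and covariance of a measurement\<close>

definition est_mean :: "nat \<Rightarrow> nat \<Rightarrow> (nat \<Rightarrow> complex mat) \<Rightarrow> (nat \<Rightarrow> real ^ 'p) \<Rightarrow> 'p \<Rightarrow> complex mat" where
  "est_mean N K M th \<mu> = Matrix.mat N N (\<lambda>ij. \<Sum>k<K. complex_of_real (th k $ \<mu>) * M k $$ ij)"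

definition est_cov :: "nat \<Rightarrow> nat \<Rightarrow> (nat \<Rightarrow> complex mat) \<Rightarrow> (nat \<Rightarrow> real ^ 'p) \<Rightarrow> 'p \<Rightarrow> 'p \<Rightarrow> complex mat" where
  "est_cov N K M th \<mu> \<nu> = Matrix.mat N N (\<lambda>ij. (\<Sum>k<K. complex_of_real (th k $ \<mu> * th k $ \<nu>) * M k $$ ij)
     - (est_mean N K M th \<mu> * est_mean N K M th \<nu>) $$ ij)"

lemma est_mean_carrier [simp]: "est_mean N K M th \<mu> \<in> carrier_mat N N"
  by (simp add: est_mean_def)

lemma est_cov_carrier [simp]: "est_cov N K M th \<mu> \<nu> \<in> carrier_mat N N"
  by (simp add: est_cov_def)

lemma povm_hermitian: "povm N K M \<Longrightarrow> k < K \<Longrightarrow> hermitian_op N (M k)"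
  by (simp add: povm_def pos_semidef_op_def)

lemma povm_sum:
  assumes "povm N K M" "a < N" "b < N"
  shows "(\<Sum>k<K. M k $$ (a, b)) = (if a = b then 1 else 0)"
proof -
  have "mat_sum N M {..<K} $$ (a, b) = 1\<^sub>m N $$ (a, b)" using assms by (simp add: povm_def)
  then show ?thesis using assms by (simp add: mat_sum_def)
qed

lemma est_mean_hermitian:
  assumes "povm N K M"
  shows "hermitian_op N (est_mean N K M th \<mu>)"
  unfolding hermitian_op_iff
proof (intro conjI allI impI)
  fix i j assume "i < N" "j < N"
  then show "est_mean N K M th \<mu> $$ (j, i) = cnj (est_mean N K M th \<mu> $$ (i, j))"
    by (auto simp: est_mean_def hermitian_op_index[OF povm_hermitian[OF assms]] intro!: sum.cong)
qed simp

text \<open>The covariance kernel is \<open>\<Sum>\<^sub>k (\<theta>\<^sub>\<mu>(k) - X\<^sub>\<mu>) M\<^sub>k (\<theta>\<^sub>\<nu>(k) - X\<^sub>\<nu>)\<close>; this is the operator form of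
  the Kadison--Schwarz inequality for the measurement.\<close>

lemma psd_kernel_est_cov:
  assumes P: "povm N K M"
  shows "psd_kernel N (est_cov N K M th)"
  unfolding psd_kernel_def
proof
  fix x :: "'a \<Rightarrow> nat \<Rightarrow> complex"
  let ?X = "est_mean N K M th"
  define t where "t k \<mu> = complex_of_real (th k $ \<mu>)" for k \<mu>
  \<comment> \<open>With y_k the sum of the vectors \<open>x \<nu>\<close> weighted by the estimates
    and \<open>w\<close> the same sum with the estimates replaced by their operator means, the
    kernel form is the sum over \<open>k\<close> of the quadratic form of M_k at y_k - w.\<close>
  define y where "y k a = (\<Sum>\<nu>\<in>UNIV. t k \<nu> * x \<nu> a)" for k a
  define w where "w a = (\<Sum>\<nu>\<in>UNIV. \<Sum>b<N. ?X \<nu> $$ (a, b) * x \<nu> b)" for a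
  have F1: "(\<Sum>k<K. \<Sum>b<N. M k $$ (a, b) * y k b) = w a" if "a < N" for a
  proof -
    have "(\<Sum>k<K. \<Sum>b<N. M k $$ (a, b) * y k b) = (\<Sum>k<K. \<Sum>b<N. \<Sum>\<nu>\<in>UNIV. t k \<nu> * M k $$ (a, b) * x \<nu> b)"
      by (simp add: y_def sum_distrib_left mult_ac)
    also have "\<dots> = (\<Sum>\<nu>\<in>UNIV. \<Sum>k<K. \<Sum>b<N. t k \<nu> * M k $$ (a, b) * x \<nu> b)" by (rule sum_rotate)
    also have "\<dots> = (\<Sum>\<nu>\<in>UNIV. \<Sum>b<N. \<Sum>k<K. t k \<nu> * M k $$ (a, b) * x \<nu> b)" by (intro sum.cong refl sum.swap)
    also have "\<dots> = w a" using that by (simp add: w_def est_mean_def t_def sum_distrib_right)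
    finally show ?thesis .
  qed
  have F2: "(\<Sum>k<K. \<Sum>a<N. cnj (y k a) * M k $$ (a, b)) = cnj (w b)" if "b < N" for b
    unfolding F1[OF that, symmetric]
    using that by (auto simp: hermitian_op_index[OF povm_hermitian[OF P]] mult.commute intro!: sum.cong)
  \<comment> \<open>Both cross terms and the last term equal \<open>Q\<close>, because the vectors
    M_k y_k sum to \<open>w\<close> and the M_k sum to 1. The signs -, -, + leave E - Q.\<close>
  define Q where "Q = (\<Sum>a<N. cnj (w a) * w a)"
  have P2: "(\<Sum>k<K. \<Sum>a<N. \<Sum>b<N. cnj (y k a) * M k $$ (a, b) * w b) = Q"
  proof -
    have "(\<Sum>k<K. \<Sum>a<N. \<Sum>b<N. cnj (y k a) * M k $$ (a, b) * w b)
       = (\<Sum>b<N. \<Sum>k<K. \<Sum>a<N. cnj (y k a) * M k $$ (a, b) * w b)" by (rule sum_rotate)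
    also have "\<dots> = (\<Sum>b<N. (\<Sum>k<K. \<Sum>a<N. cnj (y k a) * M k $$ (a, b)) * w b)" by (simp only: sum_distrib_right)
    finally show ?thesis by (simp add: F2 Q_def)
  qed
  have P3: "(\<Sum>k<K. \<Sum>a<N. \<Sum>b<N. cnj (w a) * M k $$ (a, b) * y k b) = Q"
  proof -
    have "(\<Sum>k<K. \<Sum>a<N. \<Sum>b<N. cnj (w a) * M k $$ (a, b) * y k b)
       = (\<Sum>a<N. cnj (w a) * (\<Sum>k<K. \<Sum>b<N. M k $$ (a, b) * y k b))"
      by (subst sum.swap) (simp add: sum_distrib_left mult_ac)
    then show ?thesis by (simp add: F1 Q_def)
  qed
  have P4: "(\<Sum>k<K. \<Sum>a<N. \<Sum>b<N. cnj (w a) * M k $$ (a, b) * w b) = Q"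
  proof -
    have "(\<Sum>k<K. \<Sum>a<N. \<Sum>b<N. cnj (w a) * M k $$ (a, b) * w b)
       = (\<Sum>a<N. \<Sum>b<N. cnj (w a) * (\<Sum>k<K. M k $$ (a, b)) * w b)"
      by (subst sum_rotate[symmetric]) (simp add: sum_distrib_left sum_distrib_right)
    also have "\<dots> = (\<Sum>a<N. \<Sum>b<N. if b = a then cnj (w a) * w b else 0)"
      by (intro sum.cong refl) (simp add: povm_sum[OF P])
    finally show ?thesis by (simp add: Q_def)
  qed
  define E where "E = (\<Sum>k<K. \<Sum>a<N. \<Sum>b<N. cnj (y k a) * M k $$ (a, b) * y k b)"
  have "(\<Sum>k<K. \<Sum>a<N. \<Sum>b<N. cnj (y k a - w a) * M k $$ (a, b) * (y k b - w b))
     = E - (\<Sum>k<K. \<Sum>a<N. \<Sum>b<N. cnj (y k a) * M k $$ (a, b) * w b)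
         - (\<Sum>k<K. \<Sum>a<N. \<Sum>b<N. cnj (w a) * M k $$ (a, b) * y k b)
         + (\<Sum>k<K. \<Sum>a<N. \<Sum>b<N. cnj (w a) * M k $$ (a, b) * w b)"
    by (simp add: E_def algebra_simps sum.distrib sum_subtractf)
  then have pos: "(\<Sum>k<K. \<Sum>a<N. \<Sum>b<N. cnj (y k a - w a) * M k $$ (a, b) * (y k b - w b)) = E - Q"
    by (simp add: P2 P3 P4)
  have "0 \<le> Re (\<Sum>k<K. \<Sum>a<N. \<Sum>b<N. cnj (y k a - w a) * M k $$ (a, b) * (y k b - w b))"
    unfolding Re_sum[of _ "{..<K}"] using P
    by (intro sum_nonneg pos_semidef_op_quadratic) (auto simp: povm_def)
  then have "0 \<le> Re (E - Q)" by (simp only: pos)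
  moreover have "kernel_form N (est_cov N K M th) x x = E - Q"
  proof -
    have "E = (\<Sum>k<K. \<Sum>\<mu>\<in>UNIV. \<Sum>\<nu>\<in>UNIV. \<Sum>a<N. \<Sum>b<N. cnj (x \<mu> a) * (t k \<mu> * t k \<nu> * M k $$ (a, b)) * x \<nu> b)"
    proof -
      have "(\<Sum>a<N. \<Sum>b<N. cnj (y k a) * M k $$ (a, b) * y k b)
          = (\<Sum>\<mu>\<in>UNIV. \<Sum>\<nu>\<in>UNIV. \<Sum>a<N. \<Sum>b<N. cnj (x \<mu> a) * (t k \<mu> * t k \<nu> * M k $$ (a, b)) * x \<nu> b)" for k
      proof -
        have entry: "cnj (y k a) * M k $$ (a, b) * y k b
            = (\<Sum>\<mu>\<in>UNIV. \<Sum>\<nu>\<in>UNIV. cnj (x \<mu> a) * (t k \<mu> * t k \<nu> * M k $$ (a, b)) * x \<nu> b)" for a b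
        proof -
          have "cnj (y k a) * M k $$ (a, b) * y k b = M k $$ (a, b) * ((\<Sum>\<mu>\<in>UNIV. t k \<mu> * cnj (x \<mu> a)) * (\<Sum>\<nu>\<in>UNIV. t k \<nu> * x \<nu> b))"
            by (simp add: y_def t_def)
          also have "\<dots> = (\<Sum>\<mu>\<in>UNIV. \<Sum>\<nu>\<in>UNIV. cnj (x \<mu> a) * (t k \<mu> * t k \<nu> * M k $$ (a, b)) * x \<nu> b)"
            unfolding sum_product unfolding sum_distrib_left by (intro sum.cong refl) (simp add: mult_ac)
          finally show ?thesis .
        qed
        show ?thesis unfolding entry by (rule sum_swap4)
      qed
      then show ?thesis by (simp only: E_def)
    qed
    also have "\<dots> = (\<Sum>\<mu>\<in>UNIV. \<Sum>\<nu>\<in>UNIV. \<Sum>k<K. \<Sum>a<N. \<Sum>b<N. cnj (x \<mu> a) * (t k \<mu> * t k \<nu> * M k $$ (a, b)) * x \<nu> b)"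
      by (rule sum_rotate[symmetric])
    also have "\<dots> = (\<Sum>\<mu>\<in>UNIV. \<Sum>\<nu>\<in>UNIV. \<Sum>a<N. \<Sum>b<N. \<Sum>k<K. cnj (x \<mu> a) * (t k \<mu> * t k \<nu> * M k $$ (a, b)) * x \<nu> b)"
      by (intro sum.cong refl sum_rotate[symmetric])
    finally have E: "E = (\<Sum>\<mu>\<in>UNIV. \<Sum>\<nu>\<in>UNIV. \<Sum>a<N. \<Sum>b<N. cnj (x \<mu> a) * (\<Sum>k<K. t k \<mu> * t k \<nu> * M k $$ (a, b)) * x \<nu> b)"
      by (simp only: sum_distrib_left sum_distrib_right)
    have "kernel_form N (est_cov N K M th) x x = E - kernel_form N (\<lambda>\<mu> \<nu>. ?X \<mu> * ?X \<nu>) x x"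
      unfolding E kernel_form_def sum_subtractf[symmetric]
      by (intro sum.cong refl) (simp add: est_cov_def t_def algebra_simps del: index_mult_mat)
    also have "kernel_form N (\<lambda>\<mu> \<nu>. ?X \<mu> * ?X \<nu>) x x = Q"
      unfolding kernel_form_gram[OF est_mean_hermitian[OF P]] by (simp add: Q_def w_def)
    finally show ?thesis .
  qed
  ultimately show "0 \<le> Re (kernel_form N (est_cov N K M th) x x)" by simp
qed

section \<open>Pairing kernels with the dual matrix\<close>

lemma mat_trace_mult_sum:
  assumes T: "T \<in> carrier_mat N N" and G: "\<And>a b. G a b \<in> carrier_mat N N"
  shows "mat_trace (T * Matrix.mat N N (\<lambda>ij. \<Sum>a\<in>A. \<Sum>b\<in>B. z a b * G a b $$ ij))
    = (\<Sum>a\<in>A. \<Sum>b\<in>B. z a b * mat_trace (T * G a b))"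
proof -
  have "mat_trace (T * Matrix.mat N N (\<lambda>ij. \<Sum>a\<in>A. \<Sum>b\<in>B. z a b * G a b $$ ij))
      = (\<Sum>i<N. \<Sum>j<N. \<Sum>a\<in>A. \<Sum>b\<in>B. z a b * (T $$ (i, j) * G a b $$ (j, i)))"
    using T by (subst mat_trace_mult[of _ N N]) (auto simp: sum_distrib_left mult_ac intro!: sum.cong)
  also have "\<dots> = (\<Sum>a\<in>A. \<Sum>b\<in>B. \<Sum>i<N. \<Sum>j<N. z a b * (T $$ (i, j) * G a b $$ (j, i)))"
    by (rule sum_swap4)
  finally show ?thesis by (simp only: mat_trace_mult[OF T G] sum_distrib_left)
qed

text \<open>The real part of the pairing of \<open>Y\<close> with \<open>Q\<close>, where
  \<open>Y\<close> is given by its rank-one pieces. Keeping the pieces apart lets positivity of a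
  kernel be used for each \<open>c r\<close> separately.\<close>

definition dual_cost :: "('p::finite \<Rightarrow> 'p \<Rightarrow> complex) \<Rightarrow> ('p \<Rightarrow> 'p \<Rightarrow> complex) \<Rightarrow> real" where
  "dual_cost c Q = (\<Sum>r\<in>UNIV. \<Sum>a\<in>UNIV. \<Sum>b\<in>UNIV. Re (cnj (c r a) * c r b * Q a b))"

text \<open>A real matrix pairs only with Re Y, which is \<open>W\<close>. This serves both the
  classical second moments and the plain traces of a kernel.\<close>

lemma dual_cost_real:
  fixes W :: "real ^ 'p ^ 'p"
  assumes c: "\<And>a b. (\<Sum>r\<in>UNIV. Re (cnj (c r a) * c r b)) = W $ a $ b" and "\<And>a b. Im (Q a b) = 0"
  shows "dual_cost c Q = (\<Sum>a\<in>UNIV. \<Sum>b\<in>UNIV. W $ a $ b * Re (Q a b))"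
proof -
  have "dual_cost c Q = (\<Sum>r\<in>UNIV. \<Sum>a\<in>UNIV. \<Sum>b\<in>UNIV. Re (cnj (c r a) * c r b) * Re (Q a b))"
    unfolding dual_cost_def using assms(2) by simp
  also have "\<dots> = (\<Sum>a\<in>UNIV. \<Sum>b\<in>UNIV. \<Sum>r\<in>UNIV. Re (cnj (c r a) * c r b) * Re (Q a b))"
    by (rule sum_rotate[symmetric])
  finally show ?thesis by (simp only: sum_distrib_right[symmetric] c)
qed

lemma dual_cost_add: "dual_cost c (\<lambda>a b. P a b + Q a b) = dual_cost c P + dual_cost c Q"
  by (simp add: dual_cost_def algebra_simps sum.distrib sum_subtractf)

lemma dual_cost_scale: "dual_cost c (\<lambda>a b. complex_of_real z * Q a b) = z * dual_cost c Q"
  unfolding dual_cost_def sum_distrib_left by (intro sum.cong refl) (simp add: algebra_simps)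

text \<open>The imaginary part of the dual matrix \<open>\<Sum>\<^sub>r c\<^sub>r\<^sup>* c\<^sub>r\<close> is antisymmetric, so it does not
  contribute to the plain trace; comparing with the trace weighted by a full-rank state makes
  the whole diagonal of the kernel controlled by the cost.\<close>

lemma psd_kernel_dual_cost:
  fixes W :: "real ^ 'p ^ 'p"
  assumes T: "T \<in> carrier_mat N N" and l: "trace_coercive N T l" and w: "weight_coercive W w"
    and c: "\<And>a b. (\<Sum>r\<in>UNIV. Re (cnj (c r a) * c r b)) = W $ a $ b"
    and G: "\<And>a b. G a b \<in> carrier_mat N N" "psd_kernel N G" "\<And>a b. Im (mat_trace (G a b)) = 0"
  shows "l * w * (\<Sum>\<mu>\<in>UNIV. Re (mat_trace (G \<mu> \<mu>))) \<le> dual_cost c (\<lambda>a b. mat_trace (T * G a b))"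
proof -
  have l0: "0 < l" using l by (simp add: trace_coercive_def)
  \<comment> \<open>Contracting the kernel with a coefficient vector \<open>z\<close> leaves one
    positive operator. The rank-one pieces of the dual matrix enter as z = c r, real vectors
    \<open>z\<close> give the quadratic form for \<open>weight_coercive\<close>.\<close>
  define H where "H z = Matrix.mat N N (\<lambda>ij. \<Sum>a\<in>UNIV. \<Sum>b\<in>UNIV. cnj (z a) * z b * G a b $$ ij)" for z
  have HC: "H z \<in> carrier_mat N N" for z by (simp add: H_def)
  have Hpos: "0 \<le> Re (\<Sum>i<N. \<Sum>j<N. cnj (x i) * H z $$ (i, j) * x j)" for z x
  proof -
    have "(\<Sum>i<N. \<Sum>j<N. cnj (x i) * H z $$ (i, j) * x j)
        = (\<Sum>i<N. \<Sum>j<N. \<Sum>a\<in>UNIV. \<Sum>b\<in>UNIV. cnj (z a * x i) * G a b $$ (i, j) * (z b * x j))"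
      by (intro sum.cong refl) (simp add: H_def sum_distrib_left sum_distrib_right mult_ac)
    also have "\<dots> = kernel_form N G (\<lambda>a i. z a * x i) (\<lambda>a i. z a * x i)"
      unfolding kernel_form_def by (rule sum_swap4)
    finally show ?thesis using G(2) by (simp add: psd_kernel_def)
  qed
  have trTH: "mat_trace (T * H z) = (\<Sum>a\<in>UNIV. \<Sum>b\<in>UNIV. cnj (z a) * z b * mat_trace (T * G a b))" for z
    unfolding H_def by (rule mat_trace_mult_sum[OF T G(1)])
  have trH: "mat_trace (H z) = (\<Sum>a\<in>UNIV. \<Sum>b\<in>UNIV. cnj (z a) * z b * mat_trace (G a b))" for z
    using mat_trace_mult_sum[OF one_carrier_mat G(1), where A = UNIV and B = UNIV and z = "\<lambda>a b. cnj (z a) * z b"]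
      left_mult_one_mat[OF G(1)] left_mult_one_mat[OF HC[of z]] by (simp add: H_def)
  have "0 \<le> Re (mat_trace (H z))" for z
  proof -
    have "0 \<le> Re (H z $$ (m, m))" if "m < N" for m
    proof -
      have "(\<Sum>i<N. \<Sum>j<N. cnj (if i = m then 1 else 0) * H z $$ (i, j) * (if j = m then 1 else 0))
          = (\<Sum>i<N. \<Sum>j<N. if j = m then if i = m then H z $$ (i, j) else 0 else 0)"
        by (intro sum.cong refl) auto
      also have "\<dots> = H z $$ (m, m)" using that by simp
      finally show ?thesis using Hpos[of "\<lambda>i. if i = m then 1 else 0" z] by simp
    qed
    then have "0 \<le> (\<Sum>m<N. Re (H z $$ (m, m)))" by (intro sum_nonneg) simp
    then show ?thesis using HC[of z] by (simp add: mat_trace_def)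
  qed
  then have "0 \<le> Re (mat_trace (H (\<lambda>a. complex_of_real (x a))))" for x by blast
  then have g: "0 \<le> (\<Sum>a\<in>UNIV. \<Sum>b\<in>UNIV. x a * x b * Re (mat_trace (G a b)))" for x :: "'p \<Rightarrow> real"
    unfolding trH by (simp add: mult_ac)
  have "l * w * (\<Sum>\<mu>\<in>UNIV. Re (mat_trace (G \<mu> \<mu>))) \<le> l * (\<Sum>a\<in>UNIV. \<Sum>b\<in>UNIV. W $ a $ b * Re (mat_trace (G a b)))"
  proof -
    have "w * (\<Sum>\<mu>\<in>UNIV. Re (mat_trace (G \<mu> \<mu>))) \<le> (\<Sum>a\<in>UNIV. \<Sum>b\<in>UNIV. W $ a $ b * Re (mat_trace (G a b)))"
      using w[unfolded weight_coercive_def, THEN conjunct2, THEN spec, of "\<lambda>a b. Re (mat_trace (G a b))"] g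
      by blast
    then show ?thesis using l0 unfolding mult.assoc by (intro mult_left_mono) auto
  qed
  also have "\<dots> = l * dual_cost c (\<lambda>a b. mat_trace (G a b))"
    by (simp add: dual_cost_real[OF c G(3)])
  also have "\<dots> = (\<Sum>r\<in>UNIV. l * Re (mat_trace (H (c r))))"
    unfolding dual_cost_def trH by (simp add: sum_distrib_left)
  also have "\<dots> \<le> (\<Sum>r\<in>UNIV. Re (mat_trace (T * H (c r))))"
    using l HC Hpos by (intro sum_mono) (auto simp: trace_coercive_def)
  also have "\<dots> = dual_cost c (\<lambda>a b. mat_trace (T * G a b))"
    unfolding dual_cost_def trTH by simp
  finally show ?thesis .
qed

text \<open>As for a positive semidefinite matrix, entries are controlled by the diagonal: testing
  the form on e + z f for two coordinate vectors with z = 1, -1, i, -i bounds the real and the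
  imaginary part by the total trace each, whence the factor 2.\<close>

lemma psd_kernel_entry_bound:
  assumes G: "psd_kernel N G" "\<And>\<mu> \<nu>. G \<mu> \<nu> \<in> carrier_mat N N"
    and H: "\<And>\<mu> \<nu> a b. a < N \<Longrightarrow> b < N \<Longrightarrow> G \<nu> \<mu> $$ (b, a) = cnj (G \<mu> \<nu> $$ (a, b))"
    and ab: "a < N" "b < N"
  shows "cmod (G \<mu> \<nu> $$ (a, b)) \<le> 2 * (\<Sum>\<mu>\<in>UNIV. Re (mat_trace (G \<mu> \<mu>)))"
proof -
  define D :: "'a \<Rightarrow> nat \<Rightarrow> 'a \<Rightarrow> nat \<Rightarrow> complex" where "D \<mu> a = (\<lambda>\<mu>' a'. if \<mu>' = \<mu> then if a' = a then 1 else 0 else 0)" for \<mu> a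
  have D: "kernel_form N G (D \<mu> a) (D \<nu> b) = G \<mu> \<nu> $$ (a, b)" if "a < N" "b < N" for \<mu> \<nu> a b
  proof -
    have "kernel_form N G (D \<mu> a) (D \<nu> b)
      = (\<Sum>\<mu>'\<in>UNIV. \<Sum>\<nu>'\<in>UNIV. \<Sum>a'<N. \<Sum>b'<N. if b' = b then if a' = a then if \<nu>' = \<nu> then if \<mu>' = \<mu>
           then G \<mu>' \<nu>' $$ (a', b') else 0 else 0 else 0 else 0)"
      unfolding kernel_form_def by (intro sum.cong refl) (auto simp: D_def)
    then show ?thesis using that by simp
  qed
  have exp: "kernel_form N G (\<lambda>m i. x m i + z * y m i) (\<lambda>m i. x m i + z * y m i)
      = kernel_form N G x x + z * kernel_form N G x y + cnj z * kernel_form N G y x + cnj z * z * kernel_form N G y y"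
    for x y z
    unfolding kernel_form_def sum_distrib_left sum.distrib[symmetric]
    by (intro sum.cong refl) (simp add: algebra_simps)
  have diag0: "0 \<le> Re (G \<mu> \<mu> $$ (a, a))" if "a < N" for \<mu> a
    using G(1) D[OF that that, of \<mu> \<mu>] by (metis psd_kernel_def)
  define t where "t = (\<Sum>\<mu>\<in>UNIV. Re (mat_trace (G \<mu> \<mu>)))"
  have diag: "Re (G \<mu> \<mu> $$ (a, a)) \<le> t" if "a < N" for \<mu> a
  proof -
    have tr: "Re (mat_trace (G \<mu> \<mu>)) = (\<Sum>i<N. Re (G \<mu> \<mu> $$ (i, i)))" for \<mu>
      using G(2)[of \<mu> \<mu>] by (simp add: mat_trace_def)
    have "Re (G \<mu> \<mu> $$ (a, a)) \<le> Re (mat_trace (G \<mu> \<mu>))"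
      unfolding tr using that diag0 by (intro member_le_sum) auto
    also have "\<dots> \<le> t"
      unfolding t_def by (rule member_le_sum[of \<mu> UNIV "\<lambda>\<mu>. Re (mat_trace (G \<mu> \<mu>))"])
        (auto simp: tr diag0 intro!: sum_nonneg)
    finally show ?thesis .
  qed
  have key: "0 \<le> 2 * t + 2 * Re (z * G \<mu> \<nu> $$ (a, b))" if "cnj z * z = 1" for z
  proof -
    have "0 \<le> Re (kernel_form N G (\<lambda>m i. D \<mu> a m i + z * D \<nu> b m i) (\<lambda>m i. D \<mu> a m i + z * D \<nu> b m i))"
      using G(1) by (simp add: psd_kernel_def)
    also have "\<dots> = Re (G \<mu> \<mu> $$ (a, a)) + Re (z * G \<mu> \<nu> $$ (a, b)) + Re (cnj z * cnj (G \<mu> \<nu> $$ (a, b))) + Re (G \<nu> \<nu> $$ (b, b))"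
      unfolding exp that D[OF ab] D[OF ab(2,1)] D[OF ab(1,1)] D[OF ab(2,2)] H[OF ab] by simp
    also have "\<dots> \<le> 2 * t + 2 * Re (z * G \<mu> \<nu> $$ (a, b))"
      using diag[OF ab(1), of \<mu>] diag[OF ab(2), of \<nu>] by simp
    finally show ?thesis .
  qed
  have "\<bar>Re (G \<mu> \<nu> $$ (a, b))\<bar> \<le> t" "\<bar>Im (G \<mu> \<nu> $$ (a, b))\<bar> \<le> t"
    using key[of 1] key[of "-1"] key[of \<i>] key[of "-\<i>"] by auto
  then show ?thesis using cmod_le[of "G \<mu> \<nu> $$ (a, b)"] by (simp add: t_def)
qed

lemma hermitian_trace_mult_real:
  assumes "hermitian_op N A" "hermitian_op N B"
  shows "Im (mat_trace (A * B)) = 0"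
proof -
  have AB: "A \<in> carrier_mat N N" "B \<in> carrier_mat N N" using assms by auto
  have "cnj (mat_trace (A * B)) = mat_trace (mat_adjoint (A * B))"
    using AB by (simp add: mat_trace_adjoint[of _ N])
  also have "mat_adjoint (A * B) = B * A"
    using assms by (simp add: mat_adjoint_mult[OF AB] hermitian_op_def)
  also have "mat_trace (B * A) = mat_trace (A * B)" by (rule mat_trace_comm[OF AB(2,1)])
  finally show ?thesis by (metis Reals_cnj_iff complex_is_Real_iff)
qed

lemma hermitian_trace_square:
  assumes A: "hermitian_op N A"
  shows "Re (mat_trace (A * A)) = (\<Sum>a<N. \<Sum>b<N. (cmod (A $$ (a, b)))\<^sup>2)"
proof -
  have AC: "A \<in> carrier_mat N N" using A by simp
  have "mat_trace (A * A) = (\<Sum>a<N. \<Sum>b<N. complex_of_real ((cmod (A $$ (a, b)))\<^sup>2))"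
    unfolding mat_trace_mult[OF AC AC] complex_norm_square
    by (intro sum.cong refl arg_cong[where f = "(*) (A $$ (_, _))"]) (auto simp: hermitian_op_index[OF A])
  then have "Re (mat_trace (A * A)) = Re (\<Sum>a<N. \<Sum>b<N. complex_of_real ((cmod (A $$ (a, b)))\<^sup>2))"
    by (rule arg_cong)
  then show ?thesis by (simp only: Re_sum Re_complex_of_real)
qed

section \<open>The cost of an estimator\<close>

lemma tensor_pow_1: "tensor_pow A 1 = A"
  by (simp add: kronecker_one_right[simplified])

text \<open>Measure in a joint eigenbasis and report the joint eigenvalues. Products of the
  observables are then diagonal in the same basis, so the mean-square error is exactly Re Z, with no
  covariance left over.\<close>

lemma commuting_observables_attain:
  fixes \<rho> :: "real ^ 'p \<Rightarrow> complex mat" and W :: "real ^ 'p ^ 'p"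
  assumes r: "\<rho> 0 \<in> carrier_mat d d" and S: "holevo_feasible d \<rho> S"
    and comm: "\<And>\<mu> \<nu>. S \<mu> * S \<nu> = S \<nu> * S \<mu>"
  shows "copy_optimum d \<rho> 1 W \<le> ereal (Determinants.trace (W ** Re_matrix (holevo_Z (\<rho> 0) S)))"
proof -
  have SH: "hermitian_op d (S \<mu>)" for \<mu> using S by (simp add: holevo_feasible_def)
  have SC: "S \<mu> \<in> carrier_mat d d" for \<mu> using SH by simp
  obtain e l where c: "\<And>a b. a < d \<Longrightarrow> b < d \<Longrightarrow> (\<Sum>m<d. e m a * cnj (e m b)) = (if a = b then 1 else 0)"
    and o: "\<And>m m'. m < d \<Longrightarrow> m' < d \<Longrightarrow> (\<Sum>a<d. e m a * cnj (e m' a)) = (if m = m' then 1 else 0)"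
    and s: "\<And>\<mu> a b. a < d \<Longrightarrow> b < d \<Longrightarrow> S \<mu> $$ (a, b) = (\<Sum>m<d. complex_of_real (l m \<mu>) * (e m a * cnj (e m b)))"
    by (rule joint_eigenbasis[of d S, OF SH comm]) (rule that; assumption)
  define M where "M m = Matrix.mat d d (\<lambda>(a, b). e m a * cnj (e m b))" for m
  define est :: "nat \<Rightarrow> real ^ 'p" where "est m = (\<chi> \<mu>. l m \<mu>)" for m
  have MC: "M m \<in> carrier_mat d d" for m by (simp add: M_def)
  have MH: "hermitian_op d (M m)" for m
    unfolding hermitian_op_iff by (auto simp: M_def)
  have Mpos: "pos_semidef_op d (M m)" for m
    unfolding pos_semidef_op_def
  proof (intro conjI ballI MH)
    fix v :: "complex Matrix.vec" assume v: "v \<in> carrier_vec d"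
    have "(M m *\<^sub>v v) \<bullet>c v = (\<Sum>a<d. \<Sum>b<d. (cnj (vec_index v a) * e m a) * (cnj (e m b) * vec_index v b))"
      unfolding quadratic_form_sum[OF MC v] by (intro sum.cong refl) (simp add: M_def)
    also have "\<dots> = cnj (\<Sum>b<d. cnj (e m b) * vec_index v b) * (\<Sum>b<d. cnj (e m b) * vec_index v b)"
      unfolding sum_product[symmetric] by (simp add: mult.commute)
    finally show "0 \<le> Re ((M m *\<^sub>v v) \<bullet>c v)" by (simp only: cnj_mult_self_Re)
  qed
  have "povm d d M"
    unfolding povm_def
  proof (intro conjI allI impI Mpos)
    show "mat_sum d M {..<d} = 1\<^sub>m d"
      by (rule eq_matI) (auto simp: mat_sum_def M_def c)
  qed
  \<comment> \<open>Averaging outcome values \<open>z\<close> against \<open>B\<close> is the trace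
    of \<open>B\<close> with the operator having these eigenvalues. It is used with the state and
    the derivatives for unbiasedness, and with products of eigenvalues for the error matrix.\<close>
  have sumM: "(\<Sum>m<d. mat_trace (B * M m) * z m) = mat_trace (B * P)"
    if "B \<in> carrier_mat d d" "P \<in> carrier_mat d d"
      "\<And>a b. a < d \<Longrightarrow> b < d \<Longrightarrow> P $$ (a, b) = (\<Sum>m<d. z m * (e m a * cnj (e m b)))" for B P z
  proof -
    have "mat_trace (B * P) = (\<Sum>a<d. \<Sum>b<d. \<Sum>m<d. B $$ (a, b) * M m $$ (b, a) * z m)"
      unfolding mat_trace_mult[OF that(1,2)]
      by (intro sum.cong refl) (simp add: that(3) M_def sum_distrib_left mult_ac)
    also have "\<dots> = (\<Sum>m<d. \<Sum>a<d. \<Sum>b<d. B $$ (a, b) * M m $$ (b, a) * z m)" by (rule sum_rotate)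
    finally show ?thesis by (simp only: mat_trace_mult[OF that(1) MC] sum_distrib_right)
  qed
  have "locally_unbiased d \<rho> 1 d M est"
    unfolding locally_unbiased_def tensor_pow_1 power_one_right
  proof (intro conjI allI \<open>povm d d M\<close>)
    fix \<mu> \<nu>
    show "(\<Sum>k<d. mat_trace (\<rho> 0 * M k) * complex_of_real (est k $ \<mu>)) = 0"
      using S by (subst sumM[OF r SC[of \<mu>]]) (auto simp: s est_def holevo_feasible_def)
    show "(\<Sum>k<d. mat_trace (partial_at_0 d \<rho> \<nu> * M k) * complex_of_real (est k $ \<mu>)) = (if \<mu> = \<nu> then 1 else 0)"
      using S by (subst sumM[OF _ SC[of \<mu>]]) (auto simp: s est_def holevo_feasible_def partial_at_0_def)
  qed
  then have "copy_optimum d \<rho> 1 W \<le> ereal 1 * ereal (Determinants.trace (W ** mse_matrix (\<rho> 0) 1 d M est))"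
    unfolding copy_optimum_def of_nat_1
    by (intro ereal_mult_left_mono INF_lower2[of "(d, M, est)"]) auto
  also have "mse_matrix (\<rho> 0) 1 d M est = Re_matrix (holevo_Z (\<rho> 0) S)"
  proof -
    have "(\<Sum>k<d. Re (mat_trace (\<rho> 0 * M k)) * est k $ \<mu> * est k $ \<nu>) = Re (mat_trace (\<rho> 0 * S \<mu> * S \<nu>))" for \<mu> \<nu>
    proof -
      have "(S \<mu> * S \<nu>) $$ (a, b) = (\<Sum>m<d. complex_of_real (l m \<mu> * l m \<nu>) * (e m a * cnj (e m b)))"
        if ab: "a < d" "b < d" for a b
      proof -
        have "(S \<mu> * S \<nu>) $$ (a, b) = (\<Sum>i<d. (\<Sum>m<d. complex_of_real (l m \<mu>) * (e m a * cnj (e m i)))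
            * (\<Sum>m'<d. complex_of_real (l m' \<nu>) * (e m' i * cnj (e m' b))))"
          unfolding mult_mat_sum[OF SC SC ab] using ab by (intro sum.cong refl) (simp add: s)
        also have "\<dots> = (\<Sum>i<d. \<Sum>m<d. \<Sum>m'<d. (complex_of_real (l m \<mu>) * e m a * complex_of_real (l m' \<nu>) * cnj (e m' b))
            * (e m' i * cnj (e m i)))"
          unfolding sum_product by (intro sum.cong refl) (simp add: mult_ac)
        also have "\<dots> = (\<Sum>m<d. \<Sum>m'<d. (complex_of_real (l m \<mu>) * e m a * complex_of_real (l m' \<nu>) * cnj (e m' b))
            * (\<Sum>i<d. e m' i * cnj (e m i)))"
          by (subst sum_rotate[symmetric]) (simp only: sum_distrib_left)
        also have "\<dots> = (\<Sum>m<d. \<Sum>m'<d. if m' = m then complex_of_real (l m \<mu>) * e m a * complex_of_real (l m' \<nu>) * cnj (e m' b) else 0)"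
          by (intro sum.cong refl) (simp add: o)
        finally show ?thesis by (simp add: mult_ac)
      qed
      then have "(\<Sum>m<d. mat_trace (\<rho> 0 * M m) * complex_of_real (l m \<mu> * l m \<nu>)) = mat_trace (\<rho> 0 * (S \<mu> * S \<nu>))"
        by (intro sumM[OF r mult_carrier_mat[OF SC SC]])
      then have "Re (\<Sum>m<d. mat_trace (\<rho> 0 * M m) * complex_of_real (l m \<mu> * l m \<nu>)) = Re (mat_trace (\<rho> 0 * S \<mu> * S \<nu>))"
        using assoc_mult_mat[OF r SC SC] by simp
      then show ?thesis by (simp add: est_def mult_ac)
    qed
    then show ?thesis
      unfolding mse_matrix_def Re_matrix_def holevo_Z_def tensor_pow_1 by simp
  qed
  finally show ?thesis by simp
qed

definition holevo_cost :: "complex mat \<Rightarrow> real ^ 'p ^ 'p \<Rightarrow> ('p \<Rightarrow> complex mat) \<Rightarrow> real" where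
  "holevo_cost r W X = Determinants.trace (W ** Re_matrix (holevo_Z r X))
     + trace_norm (psd_sqrt W ** Im_matrix (holevo_Z r X) ** psd_sqrt W)"

lemma povm_trace_sum:
  assumes T: "T \<in> carrier_mat N N" and P: "povm N K M"
  shows "(\<Sum>a<N. \<Sum>b<N. \<Sum>k<K. T $$ (a, b) * M k $$ (b, a) * z k) = (\<Sum>k<K. mat_trace (T * M k) * z k)"
proof (subst sum_rotate, intro sum.cong refl)
  fix k assume "k \<in> {..<K}"
  then have "M k \<in> carrier_mat N N" using povm_hermitian[OF P] by simp
  then show "(\<Sum>a<N. \<Sum>b<N. T $$ (a, b) * M k $$ (b, a) * z k) = mat_trace (T * M k) * z k"
    by (simp only: mat_trace_mult[OF T] sum_distrib_right)
qed

lemma mat_trace_est_mean: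
  assumes T: "T \<in> carrier_mat N N" and P: "povm N K M"
  shows "mat_trace (T * est_mean N K M th \<mu>) = (\<Sum>k<K. mat_trace (T * M k) * complex_of_real (th k $ \<mu>))"
  unfolding mat_trace_mult[OF T est_mean_carrier] povm_trace_sum[OF T P, symmetric]
  by (intro sum.cong refl) (simp add: est_mean_def sum_distrib_left mult_ac)

lemma mat_trace_est_cov:
  assumes T: "T \<in> carrier_mat N N" and P: "povm N K M"
  shows "mat_trace (T * est_cov N K M th \<mu> \<nu>)
    = (\<Sum>k<K. mat_trace (T * M k) * complex_of_real (th k $ \<mu> * th k $ \<nu>))
      - mat_trace (T * (est_mean N K M th \<mu> * est_mean N K M th \<nu>))"
  unfolding mat_trace_mult[OF T est_cov_carrier] povm_trace_sum[OF T P, symmetric]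
    mat_trace_mult[OF T mult_carrier_mat[OF est_mean_carrier est_mean_carrier]] sum_subtractf[symmetric]
  by (intro sum.cong refl)
     (simp add: est_cov_def right_diff_distrib sum_distrib_left mult_ac del: index_mult_mat)

lemma est_cov_hermitian:
  assumes P: "povm N K M" and ab: "a < N" "b < N"
  shows "est_cov N K M th \<nu> \<mu> $$ (b, a) = cnj (est_cov N K M th \<mu> \<nu> $$ (a, b))"
proof -
  note H = est_mean_hermitian[OF P]
  have "(est_mean N K M th \<nu> * est_mean N K M th \<mu>) $$ (b, a) = cnj ((est_mean N K M th \<mu> * est_mean N K M th \<nu>) $$ (a, b))"
    unfolding mult_mat_sum[OF est_mean_carrier est_mean_carrier ab] mult_mat_sum[OF est_mean_carrier est_mean_carrier ab(2,1)]
    using ab by (auto simp: hermitian_op_index[OF H] mult.commute intro!: sum.cong)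
  moreover have "(\<Sum>k<K. complex_of_real (th k $ \<nu> * th k $ \<mu>) * M k $$ (b, a))
      = cnj (\<Sum>k<K. complex_of_real (th k $ \<mu> * th k $ \<nu>) * M k $$ (a, b))"
    using ab by (auto simp: hermitian_op_index[OF povm_hermitian[OF P]] mult_ac intro!: sum.cong)
  ultimately show ?thesis using ab by (simp add: est_cov_def del: index_mult_mat)
qed

lemma est_cov_trace_real:
  assumes P: "povm N K M"
  shows "Im (mat_trace (est_cov N K M th \<mu> \<nu>)) = 0"
proof -
  have one: "hermitian_op N (1\<^sub>m N)" by (simp add: hermitian_op_def mat_adjoint_one)
  have "Im (mat_trace (1\<^sub>m N * est_cov N K M th \<mu> \<nu>)) = 0"
    unfolding mat_trace_est_cov[OF one_carrier_mat P]
      left_mult_one_mat[OF mult_carrier_mat[OF est_mean_carrier est_mean_carrier]]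
    using hermitian_trace_mult_real[OF one povm_hermitian[OF P]]
      hermitian_trace_mult_real[OF est_mean_hermitian[OF P] est_mean_hermitian[OF P]] by simp
  then show ?thesis by (simp add: left_mult_one_mat[OF est_cov_carrier])
qed

lemma holevo_Z_hermitian:
  assumes r: "hermitian_op d r" and S: "\<And>\<mu>. hermitian_op d (S \<mu>)"
  shows "holevo_Z r S $ b $ a = cnj (holevo_Z r S $ a $ b)"
proof -
  have rC: "r \<in> carrier_mat d d" and SC: "S \<mu> \<in> carrier_mat d d" for \<mu> using r S by auto
  have "mat_adjoint (r * S a * S b) = S b * (S a * r)"
    using r S mat_adjoint_mult[OF mult_carrier_mat[OF rC SC[of a]] SC[of b]] mat_adjoint_mult[OF rC SC[of a]]
    by (simp add: hermitian_op_def)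
  then have "cnj (mat_trace (r * S a * S b)) = mat_trace (S b * (S a * r))"
    using mat_trace_adjoint[OF mult_carrier_mat[OF mult_carrier_mat[OF rC SC[of a]] SC[of b]]] by simp
  also have "\<dots> = mat_trace (r * (S b * S a))" by (rule mat_trace_cycle[OF rC SC SC, symmetric])
  also have "\<dots> = mat_trace (r * S b * S a)" by (simp only: assoc_mult_mat[OF rC SC SC])
  finally show ?thesis by (simp add: holevo_Z_def)
qed

text \<open>What the limit argument retains of an estimator. The bounds are entrywise so that they
  pass to limits directly; as the defect tends to 0, \<open>X\<close> approaches a multiple of a
  collective observable and its components approach commutation.\<close>

definition collective_approx ::
    "nat \<Rightarrow> nat \<Rightarrow> ('p \<Rightarrow> complex mat) \<Rightarrow> ('p \<Rightarrow> complex mat) \<Rightarrow> ('p \<Rightarrow> complex mat) \<Rightarrow> real \<Rightarrow> bool" where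
  "collective_approx d n S R X \<delta> \<longleftrightarrow> 0 \<le> \<delta> \<and>
       (\<forall>\<mu>. X \<mu> \<in> carrier_mat (d ^ n) (d ^ n)) \<and>
       (\<forall>\<mu>. \<forall>a<d ^ n. \<forall>b<d ^ n. X \<mu> $$ (a, b) = R \<mu> $$ (a, b) + collective d n (S \<mu>) $$ (a, b) / of_nat n) \<and>
       (\<forall>\<mu>. \<forall>a<d ^ n. \<forall>b<d ^ n. (cmod (R \<mu> $$ (a, b)))\<^sup>2 \<le> \<delta>) \<and>
       (\<forall>\<mu> \<nu>. \<forall>a<d ^ n. \<forall>b<d ^ n. cmod ((X \<mu> * X \<nu>) $$ (a, b) - (X \<nu> * X \<mu>) $$ (a, b)) \<le> 4 * \<delta>)"

text \<open>The defect \<open>\<delta>\<close> adds up the trace of the covariance kernel, which controls the commutators, and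
  the squared distance of \<open>X\<close> to the collective observables.\<close>

lemma estimator_cost_decomposition:
  fixes \<rho> :: "real ^ 'p \<Rightarrow> complex mat" and W :: "real ^ 'p ^ 'p"
  assumes \<Theta>: "\<forall>\<theta>\<in>\<Theta>. density_op d (\<rho> \<theta>)" and 0: "0 \<in> interior \<Theta>"
    and smooth: "\<forall>i<d. \<forall>j<d. smooth_on (interior \<Theta>) (\<lambda>\<theta>. \<rho> \<theta> $$ (i, j))"
    and pd: "pos_def_op d (\<rho> 0)" and tr: "mat_trace (\<rho> 0) = 1" and W: "sym_pos_def W" and n: "1 \<le> n"
  shows "\<exists>\<kappa> \<kappa>'. 0 < \<kappa> \<and> 0 < \<kappa>' \<and>
    (\<forall>K M est. locally_unbiased d \<rho> n K M est \<longrightarrow> (\<exists>S R X \<delta>. holevo_feasible d \<rho> S \<and>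
       holevo_cost (\<rho> 0) W S + \<kappa> * \<delta> \<le> real n * Determinants.trace (W ** mse_matrix (\<rho> 0) n K M est) \<and>
       \<kappa>' * (\<Sum>\<mu>\<in>UNIV. \<Sum>a<d. \<Sum>b<d. (cmod (S \<mu> $$ (a, b)))\<^sup>2) \<le> holevo_cost (\<rho> 0) W S \<and>
       collective_approx d n S R X \<delta>))"
proof -
  define N where "N = d ^ n"
  define \<tau> where "\<tau> = tensor_pow (\<rho> 0) n"
  have rH: "hermitian_op d (\<rho> 0)" using pd by (simp add: pos_def_op_def)
  then have rC: "\<rho> 0 \<in> carrier_mat d d" by simp
  have \<tau>pd: "pos_def_op N \<tau>" unfolding N_def \<tau>_def by (rule pos_def_op_tensor_pow[OF pd])
  then have \<tau>H: "hermitian_op N \<tau>" by (simp add: pos_def_op_def)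
  then have \<tau>C: "\<tau> \<in> carrier_mat N N" by simp
  \<comment> \<open>Trace one excludes dimension 0, so (0, 0) is a valid matrix position when the
    signs of \<open>tG\<close> and \<open>tR\<close> are read off below.\<close>
  have "d \<noteq> 0"
  proof
    assume "d = 0"
    then have "mat_trace (\<rho> 0) = 0" using rC by (simp add: mat_trace_def)
    then show False using tr by simp
  qed
  then have N0: "0 < N" by (simp add: N_def)
  obtain ri where ri: "ri \<in> carrier_mat d d" "\<rho> 0 * ri = 1\<^sub>m d" "ri * \<rho> 0 = 1\<^sub>m d" using pos_def_op_inverse[OF pd] .
  obtain l where l: "trace_coercive N \<tau> l" using pos_def_op_trace_coercive[OF \<tau>pd] by blast
  obtain l' where l': "trace_coercive d (\<rho> 0) l'" using pos_def_op_trace_coercive[OF pd] by blast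
  obtain w where w: "weight_coercive W w" using sym_pos_def_coercive[OF W] by blast
  show ?thesis
  \<comment> \<open>Both constants are fixed before the estimator is given. The factor
    \<open>n\<close> is the normalisation of the n-copy optimum, \<open>l\<close> and
    \<open>l'\<close> come from the spectra of the n-copy and one-copy states, and \<open>w\<close>
    from that of the weight.\<close>
  proof (rule exI[of _ "real n * (l * w)"], rule exI[of _ "l' * w"], intro conjI allI impI)
    show "0 < real n * (l * w)" "0 < l' * w" using n l l' w by (auto simp: trace_coercive_def weight_coercive_def)
    fix K M and est :: "nat \<Rightarrow> real ^ 'p"
    assume lu: "locally_unbiased d \<rho> n K M est"
    have P: "povm N K M" using lu by (simp add: locally_unbiased_def N_def)
    define X where "X = est_mean N K M est"
    define G where "G = est_cov N K M est"
    have XH: "hermitian_op N (X \<mu>)" for \<mu> unfolding X_def by (rule est_mean_hermitian[OF P])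
    then have XC: "X \<mu> \<in> carrier_mat N N" for \<mu> by simp
    have X0: "mat_trace (\<tau> * X \<mu>) = 0" for \<mu>
      using lu unfolding X_def mat_trace_est_mean[OF \<tau>C P] by (simp add: locally_unbiased_def \<tau>_def)
    have XD: "mat_trace (partial_at_0 N (\<lambda>\<theta>. tensor_pow (\<rho> \<theta>) n) \<nu> * X \<mu>) = (if \<mu> = \<nu> then 1 else 0)" for \<mu> \<nu>
    proof -
      have "partial_at_0 N (\<lambda>\<theta>. tensor_pow (\<rho> \<theta>) n) \<nu> \<in> carrier_mat N N" by (simp add: partial_at_0_def)
      note mean = mat_trace_est_mean[OF this P]
      show ?thesis
        unfolding X_def mean using lu unfolding locally_unbiased_def N_def by blast
    qed
    have "\<exists>S. hermitian_op d S \<and>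
      (\<forall>A\<in>carrier_mat d d. mat_trace (\<tau> * (collective d n A * X \<mu>)) = mat_trace (\<rho> 0 * (A * S))) \<and>
      (\<forall>A\<in>carrier_mat d d. mat_trace (\<tau> * (X \<mu> * collective d n A)) = mat_trace (\<rho> 0 * (S * A)))" for \<mu>
      using collective_projection[OF pd XH[of \<mu>, unfolded N_def]] unfolding \<tau>_def by metis
    then obtain S where SH: "\<And>\<mu>. hermitian_op d (S \<mu>)"
      and left: "\<And>\<mu> A. A \<in> carrier_mat d d \<Longrightarrow> mat_trace (\<tau> * (collective d n A * X \<mu>)) = mat_trace (\<rho> 0 * (A * S \<mu>))"
      and right: "\<And>\<mu> A. A \<in> carrier_mat d d \<Longrightarrow> mat_trace (\<tau> * (X \<mu> * collective d n A)) = mat_trace (\<rho> 0 * (S \<mu> * A))"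
      by metis
    have SC: "S \<mu> \<in> carrier_mat d d" for \<mu> using SH by simp
    have JC: "collective d n (S \<mu>) \<in> carrier_mat N N" for \<mu> unfolding N_def by (rule collective_carrier[OF SC])
    \<comment> \<open>The projection identity is used with A = 1, where J(1) is \<open>n\<close>
      times the identity.\<close>
    have S0: "mat_trace (\<rho> 0 * S \<mu>) = 0" for \<mu>
    proof -
      have "mat_trace (\<tau> * (collective d n (1\<^sub>m d) * X \<mu>)) = of_nat n * mat_trace (\<tau> * X \<mu>)"
        unfolding collective_one N_def[symmetric] mult_smult_assoc_mat[OF one_carrier_mat XC]
          left_mult_one_mat[OF XC] mult_smult_distrib[OF \<tau>C XC]
        by (rule mat_trace_smult[OF mult_carrier_mat[OF \<tau>C XC]])
      then show ?thesis using left[OF one_carrier_mat, of \<mu>] left_mult_one_mat[OF SC] by (simp add: X0)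
    qed
    \<comment> \<open>The projection identity is used with A = r^-1 D, for which the n-copy
      derivative is the n-copy state times J(A).\<close>
    have SD: "mat_trace (partial_at_0 d \<rho> \<nu> * S \<mu>) = (if \<mu> = \<nu> then 1 else 0)" for \<mu> \<nu>
    proof -
      define D where "D = partial_at_0 d \<rho> \<nu>"
      have D: "D \<in> carrier_mat d d" by (simp add: D_def partial_at_0_def)
      define A where "A = ri * D"
      have A: "A \<in> carrier_mat d d" using ri D by (simp add: A_def)
      have rA: "\<rho> 0 * A = D"
        unfolding A_def using assoc_mult_mat[OF rC ri(1) D] left_mult_one_mat[OF D] by (simp add: ri)
      have JA: "collective d n A \<in> carrier_mat N N" unfolding N_def by (rule collective_carrier[OF A])
      have "partial_at_0 N (\<lambda>\<theta>. tensor_pow (\<rho> \<theta>) n) \<nu> = \<tau> * collective d n A"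
        unfolding N_def \<tau>_def using rA by (intro partial_tensor_pow[OF \<Theta> 0 smooth A]) (simp add: D_def)
      then have "(if \<mu> = \<nu> then 1 else 0) = mat_trace (\<tau> * (collective d n A * X \<mu>))"
        using XD[of \<nu> \<mu>] assoc_mult_mat[OF \<tau>C JA XC] by simp
      also have "\<dots> = mat_trace (D * S \<mu>)"
        unfolding left[OF A] using assoc_mult_mat[OF rC A SC] by (simp add: rA)
      finally show ?thesis by (simp add: D_def)
    qed
    have feas: "holevo_feasible d \<rho> S" using SH S0 SD by (simp add: holevo_feasible_def)
    define z where "z = - (1 / complex_of_nat n)"
    have nz: "complex_of_nat n \<noteq> 0" using n by simp
    define R where "R \<mu> = X \<mu> + z \<cdot>\<^sub>m collective d n (S \<mu>)" for \<mu>
    have RC: "R \<mu> \<in> carrier_mat N N" for \<mu> using XC JC by (simp add: R_def)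
    have RH: "hermitian_op N (R \<mu>)" for \<mu>
    proof -
      have "mat_adjoint (R \<mu>) = R \<mu>"
        using XH[of \<mu>] SH[of \<mu>] unfolding R_def mat_adjoint_add[OF XC smult_carrier_mat[OF JC]]
          mat_adjoint_smult collective_adjoint[OF SC] by (simp add: hermitian_op_def z_def)
      then show ?thesis using RC by (simp add: hermitian_op_def)
    qed
    have XR: "X \<mu> $$ (a, b) = R \<mu> $$ (a, b) + collective d n (S \<mu>) $$ (a, b) / of_nat n" if "a < N" "b < N" for \<mu> a b
      using that carrier_matD[OF XC] carrier_matD[OF JC] by (simp add: R_def z_def)
    \<comment> \<open>Subtracting J(S) / n produces two cross terms and one square, each equal to Tr
      (r S S) / n up to sign; the signs -, -, + leave a single subtraction.\<close>
    have RR: "mat_trace (\<tau> * (R \<mu> * R \<nu>)) = mat_trace (\<tau> * (X \<mu> * X \<nu>)) - mat_trace (\<rho> 0 * (S \<mu> * S \<nu>)) / of_nat n" for \<mu> \<nu>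
    proof -
      have JJ: "mat_trace (\<tau> * (collective d n (S \<mu>) * collective d n (S \<nu>))) = of_nat n * mat_trace (\<rho> 0 * (S \<mu> * S \<nu>))"
        unfolding \<tau>_def by (rule collective_trace_mult[OF SC S0 SC S0 rC tr])
      show ?thesis
        unfolding R_def mat_trace_mult_affine[OF \<tau>C XC XC JC JC] JJ left[OF SC] right[OF SC] z_def
        using nz by (simp add: field_simps)
    qed
    define Q where "Q \<mu> \<nu> = (\<Sum>k<K. mat_trace (\<tau> * M k) * complex_of_real (est k $ \<mu> * est k $ \<nu>))" for \<mu> \<nu>
    have Q: "Q \<mu> \<nu> = mat_trace (\<tau> * G \<mu> \<nu>) + mat_trace (\<tau> * (R \<mu> * R \<nu>))
        + complex_of_real (1 / real n) * mat_trace (\<rho> 0 * (S \<mu> * S \<nu>))" for \<mu> \<nu>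
      unfolding G_def mat_trace_est_cov[OF \<tau>C P] RR Q_def X_def by simp
    have Qreal: "Im (Q \<mu> \<nu>) = 0" for \<mu> \<nu>
      using hermitian_trace_mult_real[OF \<tau>H povm_hermitian[OF P]] by (simp add: Q_def)
    have ZH: "holevo_Z (\<rho> 0) S $ b $ a = cnj (holevo_Z (\<rho> 0) S $ a $ b)" for a b
      by (rule holevo_Z_hermitian[OF rH SH])
    \<comment> \<open>The dual family is optimal for this particular \<open>S\<close>. Its pairing
      with Z(S) is therefore the exact Holevo cost, while the lower bounds for the other two terms
      depend on it only through \<open>W\<close>.\<close>
    obtain c :: "'p \<Rightarrow> 'p \<Rightarrow> complex" where c: "\<And>a b. (\<Sum>r\<in>UNIV. Re (cnj (c r a) * c r b)) = W $ a $ b"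
      and cost: "(\<Sum>r\<in>UNIV. \<Sum>a\<in>UNIV. \<Sum>b\<in>UNIV. Re (cnj (c r a) * c r b * holevo_Z (\<rho> 0) S $ a $ b)) = holevo_cost (\<rho> 0) W S"
      unfolding holevo_cost_def
      using holevo_dual_family[OF W ZH] by blast
    have cS: "dual_cost c (\<lambda>\<mu> \<nu>. mat_trace (\<rho> 0 * (S \<mu> * S \<nu>))) = holevo_cost (\<rho> 0) W S"
      unfolding cost[symmetric] dual_cost_def holevo_Z_def by (simp only: vec_lambda_beta assoc_mult_mat[OF rC SC SC])
    have cQ: "dual_cost c Q = Determinants.trace (W ** mse_matrix (\<rho> 0) n K M est)"
    proof -
      have "Finite_Cartesian_Product.transpose W = W" using W by (simp add: sym_pos_def_def)
      moreover have "Re (Q \<mu> \<nu>) = mse_matrix (\<rho> 0) n K M est $ \<mu> $ \<nu>" for \<mu> \<nu>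
        by (simp add: Q_def mse_matrix_def \<tau>_def mult_ac)
      ultimately show ?thesis by (simp add: dual_cost_real[OF c Qreal] trace_mult_symmetric)
    qed
    have dec: "dual_cost c Q = dual_cost c (\<lambda>\<mu> \<nu>. mat_trace (\<tau> * G \<mu> \<nu>)) + dual_cost c (\<lambda>\<mu> \<nu>. mat_trace (\<tau> * (R \<mu> * R \<nu>)))
        + 1 / real n * holevo_cost (\<rho> 0) W S"
    proof -
      have "dual_cost c Q = dual_cost c (\<lambda>\<mu> \<nu>. mat_trace (\<tau> * G \<mu> \<nu>) + mat_trace (\<tau> * (R \<mu> * R \<nu>))
        + complex_of_real (1 / real n) * mat_trace (\<rho> 0 * (S \<mu> * S \<nu>)))"
        by (simp only: Q[abs_def])
      then show ?thesis by (simp only: dual_cost_add dual_cost_scale cS)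
    qed
    define tG where "tG = (\<Sum>\<mu>\<in>UNIV. Re (mat_trace (G \<mu> \<mu>)))"
    define tR where "tR = (\<Sum>\<mu>\<in>UNIV. Re (mat_trace (R \<mu> * R \<mu>)))"
    have kG: "psd_kernel N G" unfolding G_def by (rule psd_kernel_est_cov[OF P])
    have bG: "l * w * tG \<le> dual_cost c (\<lambda>\<mu> \<nu>. mat_trace (\<tau> * G \<mu> \<nu>))"
      unfolding tG_def
      by (rule psd_kernel_dual_cost[OF \<tau>C l w c _ kG]) (auto simp: G_def est_cov_trace_real[OF P])
    have bR: "l * w * tR \<le> dual_cost c (\<lambda>\<mu> \<nu>. mat_trace (\<tau> * (R \<mu> * R \<nu>)))"
      unfolding tR_def
      by (rule psd_kernel_dual_cost[OF \<tau>C l w c mult_carrier_mat[OF RC RC] psd_kernel_gram[OF RH] hermitian_trace_mult_real[OF RH RH]])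
    have bS: "l' * w * (\<Sum>\<mu>\<in>UNIV. Re (mat_trace (S \<mu> * S \<mu>))) \<le> holevo_cost (\<rho> 0) W S"
      unfolding cS[symmetric]
      by (rule psd_kernel_dual_cost[OF rC l' w c mult_carrier_mat[OF SC SC] psd_kernel_gram[OF SH] hermitian_trace_mult_real[OF SH SH]])
    have GC: "G \<mu> \<nu> \<in> carrier_mat N N" for \<mu> \<nu> by (simp add: G_def)
    have GH: "G \<nu> \<mu> $$ (b, a) = cnj (G \<mu> \<nu> $$ (a, b))" if "a < N" "b < N" for \<mu> \<nu> a b
      unfolding G_def by (rule est_cov_hermitian[OF P that])
    have eG: "cmod (G \<mu> \<nu> $$ (a, b)) \<le> 2 * tG" if "a < N" "b < N" for \<mu> \<nu> a b
      unfolding tG_def by (rule psd_kernel_entry_bound[OF kG GC GH that])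
    \<comment> \<open>A norm at some index is bounded by twice \<open>tG\<close>;
      \<open>undefined\<close> merely names one parameter.\<close>
    have tG0: "0 \<le> tG" using eG[OF N0 N0, of undefined undefined] norm_ge_zero[of "G undefined undefined $$ (0, 0)"] by linarith
    have eR: "(cmod (R \<mu> $$ (a, b)))\<^sup>2 \<le> tR" if ab: "a < N" "b < N" for \<mu> a b
    proof -
      have "(cmod (R \<mu> $$ (a, b)))\<^sup>2 \<le> (\<Sum>b<N. (cmod (R \<mu> $$ (a, b)))\<^sup>2)"
        using ab by (intro member_le_sum) auto
      also have "\<dots> \<le> (\<Sum>a<N. \<Sum>b<N. (cmod (R \<mu> $$ (a, b)))\<^sup>2)"
        using ab by (intro member_le_sum[of a "{..<N}" "\<lambda>a. \<Sum>b<N. (cmod (R \<mu> $$ (a, b)))\<^sup>2"]) (auto intro: sum_nonneg)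
      also have "\<dots> = Re (mat_trace (R \<mu> * R \<mu>))" by (simp only: hermitian_trace_square[OF RH])
      also have "\<dots> \<le> tR"
        unfolding tR_def by (rule member_le_sum[of \<mu> UNIV "\<lambda>\<mu>. Re (mat_trace (R \<mu> * R \<mu>))"])
          (auto simp: hermitian_trace_square[OF RH] intro!: sum_nonneg)
      finally show ?thesis .
    qed
    have tR0: "0 \<le> tR" using eR[OF N0 N0, of undefined] zero_le_power2[of "cmod (R undefined $$ (0, 0))"] by linarith
    \<comment> \<open>The products of estimates in \<open>est_cov\<close> are symmetric in the two
      parameters and cancel. Two kernel entries remain, each at most 2 \<open>tG\<close>, which is
      the origin of the 4.\<close>
    have comm: "cmod ((X \<mu> * X \<nu>) $$ (a, b) - (X \<nu> * X \<mu>) $$ (a, b)) \<le> 4 * tG" if ab: "a < N" "b < N" for \<mu> \<nu> a b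
    proof -
      have "(X \<mu> * X \<nu>) $$ (a, b) - (X \<nu> * X \<mu>) $$ (a, b) = G \<nu> \<mu> $$ (a, b) - G \<mu> \<nu> $$ (a, b)"
        using ab by (simp add: G_def est_cov_def X_def mult.commute del: index_mult_mat)
      also have "cmod \<dots> \<le> cmod (G \<nu> \<mu> $$ (a, b)) + cmod (G \<mu> \<nu> $$ (a, b))" by (rule norm_triangle_ineq4)
      finally show ?thesis using eG[OF ab, of \<nu> \<mu>] eG[OF ab, of \<mu> \<nu>] by linarith
    qed
    have "real n * dual_cost c Q \<ge> real n * (l * w * (tG + tR) + 1 / real n * holevo_cost (\<rho> 0) W S)"
      using bG bR unfolding dec by (intro mult_left_mono) (auto simp: algebra_simps)
    then have main: "holevo_cost (\<rho> 0) W S + real n * (l * w) * (tG + tR) \<le> real n * Determinants.trace (W ** mse_matrix (\<rho> 0) n K M est)"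
      using n unfolding cQ by (simp add: algebra_simps)
    show "\<exists>S R X \<delta>. holevo_feasible d \<rho> S \<and>
       holevo_cost (\<rho> 0) W S + real n * (l * w) * \<delta> \<le> real n * Determinants.trace (W ** mse_matrix (\<rho> 0) n K M est) \<and>
       l' * w * (\<Sum>\<mu>\<in>UNIV. \<Sum>a<d. \<Sum>b<d. (cmod (S \<mu> $$ (a, b)))\<^sup>2) \<le> holevo_cost (\<rho> 0) W S \<and>
       collective_approx d n S R X \<delta>"
      unfolding collective_approx_def
    proof (intro exI conjI allI impI)
      show "holevo_feasible d \<rho> S" by (rule feas)
      show "0 \<le> tG + tR" using tG0 tR0 by simp
      show "holevo_cost (\<rho> 0) W S + real n * (l * w) * (tG + tR) \<le> real n * Determinants.trace (W ** mse_matrix (\<rho> 0) n K M est)"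
        by (rule main)
      show "l' * w * (\<Sum>\<mu>\<in>UNIV. \<Sum>a<d. \<Sum>b<d. (cmod (S \<mu> $$ (a, b)))\<^sup>2) \<le> holevo_cost (\<rho> 0) W S"
        using bS by (simp only: hermitian_trace_square[OF SH])
      fix \<mu> \<nu> a b
      show "X \<mu> \<in> carrier_mat (d ^ n) (d ^ n)" using XC by (simp add: N_def)
      assume "a < d ^ n" "b < d ^ n"
      then have ab: "a < N" "b < N" by (auto simp: N_def)
      show "X \<mu> $$ (a, b) = R \<mu> $$ (a, b) + collective d n (S \<mu>) $$ (a, b) / of_nat n" by (rule XR[OF ab])
      show "(cmod (R \<mu> $$ (a, b)))\<^sup>2 \<le> tG + tR" using eR[OF ab, of \<mu>] tG0 by linarith
      show "cmod ((X \<mu> * X \<nu>) $$ (a, b) - (X \<nu> * X \<mu>) $$ (a, b)) \<le> 4 * (tG + tR)" by (rule order_trans[OF comm[OF ab]]) (use tR0 in simp)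
    qed
  qed
qed

section \<open>Limits of near-optimal estimators\<close>

text \<open>Bolzano-Weierstrass one coordinate at a time: refining the subsequence keeps the limits
  already found.\<close>

lemma finite_pointwise_subsequence:
  fixes f :: "nat \<Rightarrow> 'i \<Rightarrow> complex"
  assumes "finite I" "\<And>i. i \<in> I \<Longrightarrow> bounded (range (\<lambda>j. f j i))"
  shows "\<exists>r g. strict_mono (r :: nat \<Rightarrow> nat) \<and> (\<forall>i\<in>I. (\<lambda>j. f (r j) i) \<longlonglongrightarrow> g i)"
  using assms
proof (induction I)
  case empty
  show ?case using strict_mono_id by blast
next
  case (insert i I)
  then obtain r g where r: "strict_mono (r :: nat \<Rightarrow> nat)" and g: "\<forall>k\<in>I. (\<lambda>j. f (r j) k) \<longlonglongrightarrow> g k" by auto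
  have "bounded (range (\<lambda>j. f (r j) i))"
    by (rule bounded_subset[OF insert.prems[of i]]) auto
  then obtain l r' where r': "strict_mono (r' :: nat \<Rightarrow> nat)" and l: "((\<lambda>j. f (r j) i) \<circ> r') \<longlonglongrightarrow> l"
    using bounded_imp_convergent_subsequence by blast
  have "(\<lambda>j. f (r (r' j)) k) \<longlonglongrightarrow> g k" if "k \<in> I" for k
    using LIMSEQ_subseq_LIMSEQ[OF _ r', of "\<lambda>j. f (r j) k" "g k"] g that by (simp add: comp_def)
  then have "\<forall>k\<in>insert i I. (\<lambda>j. f ((r \<circ> r') j) k) \<longlonglongrightarrow> (g(i := l)) k"
    using l insert.hyps by (auto simp: comp_def)
  moreover have "strict_mono (r \<circ> r')" using r r' by (rule strict_mono_o)
  ultimately show ?case by blast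
qed

definition mat_tendsto :: "nat \<Rightarrow> (nat \<Rightarrow> complex mat) \<Rightarrow> complex mat \<Rightarrow> bool" where
  "mat_tendsto N A B \<longleftrightarrow> (\<forall>j. A j \<in> carrier_mat N N) \<and> B \<in> carrier_mat N N \<and>
     (\<forall>a<N. \<forall>b<N. (\<lambda>j. A j $$ (a, b)) \<longlonglongrightarrow> B $$ (a, b))"

lemma mat_tendsto_const: "A \<in> carrier_mat N N \<Longrightarrow> mat_tendsto N (\<lambda>_. A) A"
  by (simp add: mat_tendsto_def)

lemma mat_tendsto_mult:
  assumes "mat_tendsto N A A'" "mat_tendsto N B B'"
  shows "mat_tendsto N (\<lambda>j. A j * B j) (A' * B')"
proof -
  have C: "A j \<in> carrier_mat N N" "A' \<in> carrier_mat N N" "B j \<in> carrier_mat N N" "B' \<in> carrier_mat N N" for j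
    using assms by (auto simp: mat_tendsto_def)
  have "(\<lambda>j. (A j * B j) $$ (a, b)) \<longlonglongrightarrow> (A' * B') $$ (a, b)" if ab: "a < N" "b < N" for a b
    unfolding mult_mat_sum[OF C(1,3) ab] mult_mat_sum[OF C(2,4) ab]
    using assms ab by (intro tendsto_sum tendsto_mult) (auto simp: mat_tendsto_def)
  moreover have "A j * B j \<in> carrier_mat N N" "A' * B' \<in> carrier_mat N N" for j
    by (rule mult_carrier_mat[OF C(1,3)], rule mult_carrier_mat[OF C(2,4)])
  ultimately show ?thesis by (simp add: mat_tendsto_def)
qed

lemma mat_tendsto_trace:
  assumes "mat_tendsto N A A'"
  shows "(\<lambda>j. mat_trace (A j)) \<longlonglongrightarrow> mat_trace A'"
proof -
  have C: "dim_row (A j) = N" "dim_row A' = N" for j using assms by (auto simp: mat_tendsto_def)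
  show ?thesis unfolding mat_trace_def C
    using assms by (intro tendsto_sum) (auto simp: mat_tendsto_def)
qed

lemma mat_tendsto_collective:
  assumes "mat_tendsto d A A'"
  shows "mat_tendsto (d ^ n) (\<lambda>j. collective d n (A j)) (collective d n A')"
proof -
  have C: "A j \<in> carrier_mat d d" "A' \<in> carrier_mat d d" for j using assms by (auto simp: mat_tendsto_def)
  have "(\<lambda>j. collective d n (A j) $$ (x, y)) \<longlonglongrightarrow> collective d n A' $$ (x, y)" if "x < d ^ n" "y < d ^ n" for x y
    unfolding collective_index[OF C(1) that] collective_index[OF C(2) that]
    using assms by (intro tendsto_sum tendsto_mult tendsto_const) (auto simp: mat_tendsto_def)
  then show ?thesis using collective_carrier[OF C(1)] collective_carrier[OF C(2)] by (simp add: mat_tendsto_def)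
qed

lemma holevo_feasible_limit:
  assumes S: "\<And>j. holevo_feasible d \<rho> (S j)" and lim: "\<And>\<mu>. mat_tendsto d (\<lambda>j. S j \<mu>) (L \<mu>)"
    and r: "\<rho> 0 \<in> carrier_mat d d"
  shows "holevo_feasible d \<rho> L"
  unfolding holevo_feasible_def
proof (intro conjI allI)
  fix \<mu> \<nu>
  have SH: "hermitian_op d (S j \<mu>)" for j using S by (simp add: holevo_feasible_def)
  have LC: "L \<mu> \<in> carrier_mat d d" using lim by (simp add: mat_tendsto_def)
  have limab: "(\<lambda>j. S j \<mu> $$ (a, b)) \<longlonglongrightarrow> L \<mu> $$ (a, b)" if "a < d" "b < d" for a b
    using lim that by (simp add: mat_tendsto_def)
  show "hermitian_op d (L \<mu>)"
    unfolding hermitian_op_iff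
  proof (intro conjI allI impI LC)
    fix a b assume ab: "a < d" "b < d"
    have "(\<lambda>j. S j \<mu> $$ (b, a)) \<longlonglongrightarrow> cnj (L \<mu> $$ (a, b))"
      unfolding hermitian_op_index[OF SH ab, symmetric] by (intro tendsto_cnj limab ab)
    then show "L \<mu> $$ (b, a) = cnj (L \<mu> $$ (a, b))" using limab[OF ab(2,1)] by (rule LIMSEQ_unique[rotated])
  qed
  have "(\<lambda>j. mat_trace (\<rho> 0 * S j \<mu>)) \<longlonglongrightarrow> mat_trace (\<rho> 0 * L \<mu>)"
    by (intro mat_tendsto_trace[where N = d] mat_tendsto_mult mat_tendsto_const r lim)
  then show "mat_trace (\<rho> 0 * L \<mu>) = 0"
    using S by (simp add: holevo_feasible_def LIMSEQ_const_iff)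
  have "(\<lambda>j. mat_trace (partial_at_0 d \<rho> \<nu> * S j \<mu>)) \<longlonglongrightarrow> mat_trace (partial_at_0 d \<rho> \<nu> * L \<mu>)"
    by (intro mat_tendsto_trace[where N = d] mat_tendsto_mult mat_tendsto_const lim) (simp add: partial_at_0_def)
  moreover have "mat_trace (partial_at_0 d \<rho> \<nu> * S j \<mu>) = (if \<mu> = \<nu> then 1 else 0)" for j
    using S by (simp add: holevo_feasible_def)
  ultimately show "mat_trace (partial_at_0 d \<rho> \<nu> * L \<mu>) = (if \<mu> = \<nu> then 1 else 0)"
    by (simp only: LIMSEQ_const_iff)
qed

text \<open>The commutators of \<open>X\<close> and \<open>Y\<close> tend to z^2 [J(A'), J(B')] =
  z^2 J([A', B']) and also to 0, so J([A', B']) = 0 and injectivity of \<open>J\<close>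
  finishes.\<close>

lemma collective_limit_commute:
  assumes r: "pos_def_op d r" "mat_trace r = 1" and n: "0 < n"
    and S: "mat_tendsto d A A'" "mat_tendsto d B B'"
    and X: "mat_tendsto (d ^ n) X (z \<cdot>\<^sub>m collective d n A')" "mat_tendsto (d ^ n) Y (z \<cdot>\<^sub>m collective d n B')" and z: "z \<noteq> 0"
    and comm: "\<And>a b. a < d ^ n \<Longrightarrow> b < d ^ n \<Longrightarrow> (\<lambda>j. (X j * Y j) $$ (a, b) - (Y j * X j) $$ (a, b)) \<longlonglongrightarrow> 0"
  shows "A' * B' = B' * A'"
proof -
  have C: "A' \<in> carrier_mat d d" "B' \<in> carrier_mat d d" using S by (auto simp: mat_tendsto_def)
  note J = collective_carrier[OF C(1), of n] collective_carrier[OF C(2), of n]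
  note zJ = smult_carrier_mat[OF J(1), of z] smult_carrier_mat[OF J(2), of z]
  have mult: "((z \<cdot>\<^sub>m P) * (z \<cdot>\<^sub>m Q)) $$ (a, b) = z * z * (P * Q) $$ (a, b)"
    if P: "P \<in> carrier_mat N N" and Q: "Q \<in> carrier_mat N N" and ab: "a < N" "b < N" for P Q N a b
    using ab P Q unfolding mult_mat_sum[OF smult_carrier_mat[OF P] smult_carrier_mat[OF Q] ab] mult_mat_sum[OF P Q ab]
    by (auto simp: sum_distrib_left mult_ac intro!: sum.cong)
  have "collective d n (A' * B' - B' * A') = 0\<^sub>m (d ^ n) (d ^ n)"
  proof (rule eq_matI)
    fix a b assume "a < dim_row (0\<^sub>m (d ^ n) (d ^ n))" "b < dim_col (0\<^sub>m (d ^ n) (d ^ n))"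
    then have ab: "a < d ^ n" "b < d ^ n" by auto
    have "(\<lambda>j. (X j * Y j) $$ (a, b) - (Y j * X j) $$ (a, b)) \<longlonglongrightarrow>
        z * z * (collective d n A' * collective d n B') $$ (a, b) - z * z * (collective d n B' * collective d n A') $$ (a, b)"
      unfolding mult[OF J ab, symmetric] mult[OF J(2,1) ab, symmetric]
      using mat_tendsto_mult[OF X] mat_tendsto_mult[OF X(2,1)] ab
      by (intro tendsto_diff) (auto simp: mat_tendsto_def simp del: index_mult_mat)
    from LIMSEQ_unique[OF this comm[OF ab]] z
    have "(collective d n A' * collective d n B') $$ (a, b) - (collective d n B' * collective d n A') $$ (a, b) = 0"
      by simp
    then show "collective d n (A' * B' - B' * A') $$ (a, b) = 0\<^sub>m (d ^ n) (d ^ n) $$ (a, b)"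
      unfolding collective_commutator[OF C, symmetric]
      using ab carrier_matD[OF mult_carrier_mat[OF J(2,1)]] by (simp del: index_mult_mat(1))
  next
    have "A' * B' - B' * A' \<in> carrier_mat d d" using C by (intro minus_carrier_mat mult_carrier_mat)
    from collective_carrier[OF this, of n]
    show "dim_row (collective d n (A' * B' - B' * A')) = dim_row (0\<^sub>m (d ^ n) (d ^ n))"
      "dim_col (collective d n (A' * B' - B' * A')) = dim_col (0\<^sub>m (d ^ n) (d ^ n))" by auto
  qed
  moreover have "A' * B' - B' * A' \<in> carrier_mat d d" using C by (intro minus_carrier_mat mult_carrier_mat)
  ultimately have zero: "A' * B' - B' * A' = 0\<^sub>m d d"
    by (intro collective_eq_zero_imp[OF r n])
  show ?thesis
  proof (rule eq_matI)
    fix a b assume "a < dim_row (B' * A')" "b < dim_col (B' * A')"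
    then have ab: "a < d" "b < d" using C by auto
    have "(A' * B' - B' * A') $$ (a, b) = 0" using ab by (simp add: zero)
    then show "(A' * B') $$ (a, b) = (B' * A') $$ (a, b)"
      using ab C by (simp del: index_mult_mat(1))
  qed (use C in auto)
qed

theorem theorem1:
  fixes d n :: nat
    and \<Theta> :: "(real ^ 'p) set"
    and \<rho> :: "real ^ 'p \<Rightarrow> complex mat"
    and W :: "real ^ 'p ^ 'p"
  assumes "\<forall>\<theta>\<in>\<Theta>. density_op d (\<rho> \<theta>)"
    and "0 \<in> interior \<Theta>"
    and "\<forall>i<d. \<forall>j<d. smooth_on (interior \<Theta>) (\<lambda>\<theta>. \<rho> \<theta> $$ (i, j))"
    and "locally_identifiable d \<rho>"
    and "pos_def_op d (\<rho> 0)"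
    and "sym_pos_def W"
    and "n \<ge> 1"
    and "copy_optimum d \<rho> 1 W > holevo_bound d \<rho> W"
  shows "copy_optimum d \<rho> n W > holevo_bound d \<rho> W"
proof (rule ccontr)
  assume "\<not> copy_optimum d \<rho> n W > holevo_bound d \<rho> W"
  then have le: "copy_optimum d \<rho> n W \<le> holevo_bound d \<rho> W" by simp
  have tr: "mat_trace (\<rho> 0) = 1"
    using assms(1,2) interior_subset unfolding density_op_def by blast
  have rC: "\<rho> 0 \<in> carrier_mat d d" using assms(5) by (simp add: pos_def_op_def)
  have sym: "Finite_Cartesian_Product.transpose W = W" using assms(6) by (simp add: sym_pos_def_def)
  let ?V = "\<lambda>K M est. real n * Determinants.trace (W ** mse_matrix (\<rho> 0) n K M est)"
  \<comment> \<open>The infimum over estimators may not be attained, so only values below any number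
    above the bound are available.\<close>
  have near: "\<exists>K M est. locally_unbiased d \<rho> n K M est \<and> ?V K M est < B" if "holevo_bound d \<rho> W < ereal B" for B
  proof -
    let ?A = "{(K, M, est). locally_unbiased d \<rho> n K M est}"
    let ?f = "\<lambda>(K, M, est). ereal (Determinants.trace (W ** mse_matrix (\<rho> 0) n K M est))"
    have lt: "ereal (real n) * (INF t\<in>?A. ?f t) < ereal B"
      using le that unfolding copy_optimum_def by (rule order.strict_trans1)
    have "(INF t\<in>?A. ?f t) < ereal (B / real n)"
    proof (rule ccontr)
      assume "\<not> ?thesis"
      then have "ereal (real n) * ereal (B / real n) \<le> ereal (real n) * (INF t\<in>?A. ?f t)"
        by (intro ereal_mult_left_mono) auto
      with lt assms(7) show False by simp
    qed
    then obtain t where "t \<in> ?A" "?f t < ereal (B / real n)" unfolding INF_less_iff by blast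
    then obtain K M est where "locally_unbiased d \<rho> n K M est"
      "Determinants.trace (W ** mse_matrix (\<rho> 0) n K M est) < B / real n" by auto
    then show ?thesis using assms(7) by (intro exI[of _ K] exI[of _ M] exI[of _ est]) (simp add: pos_less_divide_eq mult.commute)
  qed
  obtain \<kappa> \<kappa>' :: real where \<kappa>: "0 < \<kappa>" "0 < \<kappa>'" and
    dec': "\<forall>K M est. locally_unbiased d \<rho> n K M est \<longrightarrow> (\<exists>S R X \<delta>. holevo_feasible d \<rho> S \<and>
       holevo_cost (\<rho> 0) W S + \<kappa> * \<delta> \<le> ?V K M est \<and>
       \<kappa>' * (\<Sum>\<mu>\<in>UNIV. \<Sum>a<d. \<Sum>b<d. (cmod (S \<mu> $$ (a, b)))\<^sup>2) \<le> holevo_cost (\<rho> 0) W S \<and>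
       collective_approx d n S R X \<delta>)"
    using estimator_cost_decomposition[OF assms(1-3,5) tr assms(6,7)] by (elim exE conjE)
  note dec = dec'[rule_format]
  \<comment> \<open>Nonnegativity rules out the value minus infinity for the bound, which would
    otherwise yield an estimator of negative cost.\<close>
  have cost_nonneg: "0 \<le> ?V K M est" if "locally_unbiased d \<rho> n K M est" for K M est
  proof -
    from dec[OF that] obtain S R X \<delta> where S: "collective_approx d n S R X \<delta>" "holevo_cost (\<rho> 0) W S + \<kappa> * \<delta> \<le> ?V K M est"
      "\<kappa>' * (\<Sum>\<mu>\<in>UNIV. \<Sum>a<d. \<Sum>b<d. (cmod (S \<mu> $$ (a, b)))\<^sup>2) \<le> holevo_cost (\<rho> 0) W S" by blast
    have "0 \<le> \<delta>" using S(1) by (simp add: collective_approx_def)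
    have "0 \<le> \<kappa>' * (\<Sum>\<mu>\<in>UNIV. \<Sum>a<d. \<Sum>b<d. (cmod (S \<mu> $$ (a, b)))\<^sup>2)"
      using \<kappa> by (intro mult_nonneg_nonneg sum_nonneg) auto
    moreover have "0 \<le> \<kappa> * \<delta>" using \<kappa> \<open>0 \<le> \<delta>\<close> by simp
    ultimately show ?thesis using S by linarith
  qed
  have "holevo_bound d \<rho> W \<noteq> - \<infinity>"
  proof
    assume "holevo_bound d \<rho> W = - \<infinity>"
    then have "holevo_bound d \<rho> W < ereal 0" by simp
    from near[OF this] cost_nonneg show False by fastforce
  qed
  \<comment> \<open>The one-copy optimum lies strictly above the bound by assumption, so the bound
    is not infinite.\<close>
  moreover have "holevo_bound d \<rho> W \<noteq> \<infinity>" using assms(8) by auto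
  ultimately obtain h where h: "holevo_bound d \<rho> W = ereal h" by (cases "holevo_bound d \<rho> W") auto
  have h_le: "h \<le> holevo_cost (\<rho> 0) W S" if "holevo_feasible d \<rho> S" for S
  proof -
    have "holevo_bound d \<rho> W \<le> ereal (holevo_cost (\<rho> 0) W S)"
      unfolding holevo_bound_def holevo_cost_def using that by (intro INF_lower) simp
    then show ?thesis by (simp add: h)
  qed
  define \<epsilon> where "\<epsilon> j = 1 / real (Suc j)" for j
  have \<epsilon>0: "\<epsilon> \<longlonglongrightarrow> 0" unfolding \<epsilon>_def by (rule LIMSEQ_Suc[OF lim_1_over_n, unfolded of_nat_Suc[symmetric]])
  have \<epsilon>: "0 < \<epsilon> j" "\<epsilon> j \<le> 1" for j by (auto simp: \<epsilon>_def)
  have "\<exists>S R X \<delta>. holevo_feasible d \<rho> S \<and> \<kappa> * \<delta> \<le> \<epsilon> j \<and> holevo_cost (\<rho> 0) W S \<le> h + \<epsilon> j \<and>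
       \<kappa>' * (\<Sum>\<mu>\<in>UNIV. \<Sum>a<d. \<Sum>b<d. (cmod (S \<mu> $$ (a, b)))\<^sup>2) \<le> h + 1 \<and>
       collective_approx d n S R X \<delta>"
    (is "\<exists>S R X \<delta>. ?Q j S R X \<delta>") for j
  proof -
    have "holevo_bound d \<rho> W < ereal (h + \<epsilon> j)" using \<epsilon>(1)[of j] by (simp add: h)
    from near[OF this] obtain K M est where est: "locally_unbiased d \<rho> n K M est" "?V K M est < h + \<epsilon> j" by blast
    from dec[OF est(1)] obtain S R X \<delta> where S: "holevo_feasible d \<rho> S"
      and D: "collective_approx d n S R X \<delta>" "holevo_cost (\<rho> 0) W S + \<kappa> * \<delta> \<le> ?V K M est"
      "\<kappa>' * (\<Sum>\<mu>\<in>UNIV. \<Sum>a<d. \<Sum>b<d. (cmod (S \<mu> $$ (a, b)))\<^sup>2) \<le> holevo_cost (\<rho> 0) W S"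
      by blast
    have "0 \<le> \<kappa> * \<delta>" using \<kappa> D(1) by (simp add: collective_approx_def)
    \<comment> \<open>\<open>S\<close> is feasible and costs at least \<open>h\<close>, so the loss
      \<open>\<kappa> * \<delta>\<close> must fit into the slack \<open>\<epsilon> j\<close>. The
      third estimate, uniform in \<open>j\<close> because \<open>\<epsilon> j \<le> 1\<close>,
      supplies the compactness.\<close>
    then have "\<kappa> * \<delta> \<le> \<epsilon> j" "holevo_cost (\<rho> 0) W S \<le> h + \<epsilon> j"
      "\<kappa>' * (\<Sum>\<mu>\<in>UNIV. \<Sum>a<d. \<Sum>b<d. (cmod (S \<mu> $$ (a, b)))\<^sup>2) \<le> h + 1"
      using h_le[OF S] D(2,3) est(2) \<epsilon>(2)[of j] by linarith+
    then have "?Q j S R X \<delta>" using S D(1) by (intro conjI)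
    then show ?thesis by blast
  qed
  then obtain S R X \<delta> where Q: "\<And>j. ?Q j (S j) (R j) (X j) (\<delta> j)" by metis
  have Qx: "collective_approx d n (S j) (R j) (X j) (\<delta> j)" for j using Q[of j] by blast
  note Qx = Qx[unfolded collective_approx_def]
  define I where "I = (UNIV :: 'p set) \<times> {..<d} \<times> {..<d}"
  have "bounded (range (\<lambda>j. (\<lambda>(\<mu>, a, b). S j \<mu> $$ (a, b)) i))" if "i \<in> I" for i
  proof -
    obtain \<mu> a b where i: "i = (\<mu>, a, b)" "a < d" "b < d" using \<open>i \<in> I\<close> by (auto simp: I_def)
    have "cmod (S j \<mu> $$ (a, b)) \<le> sqrt ((h + 1) / \<kappa>')" for j
    proof (rule real_le_rsqrt)
      have "(cmod (S j \<mu> $$ (a, b)))\<^sup>2 \<le> (\<Sum>b<d. (cmod (S j \<mu> $$ (a, b)))\<^sup>2)"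
        using i by (intro member_le_sum) auto
      also have "\<dots> \<le> (\<Sum>a<d. \<Sum>b<d. (cmod (S j \<mu> $$ (a, b)))\<^sup>2)"
        using i by (intro member_le_sum[of a "{..<d}" "\<lambda>a. \<Sum>b<d. (cmod (S j \<mu> $$ (a, b)))\<^sup>2"]) (auto intro: sum_nonneg)
      also have "\<dots> \<le> (\<Sum>\<mu>\<in>UNIV. \<Sum>a<d. \<Sum>b<d. (cmod (S j \<mu> $$ (a, b)))\<^sup>2)"
        by (rule member_le_sum[of \<mu> UNIV "\<lambda>\<mu>. \<Sum>a<d. \<Sum>b<d. (cmod (S j \<mu> $$ (a, b)))\<^sup>2"]) (auto intro!: sum_nonneg)
      also have "\<dots> \<le> (h + 1) / \<kappa>'" using Q[of j] \<kappa>(2) by (simp add: pos_le_divide_eq mult.commute)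
      finally show "(cmod (S j \<mu> $$ (a, b)))\<^sup>2 \<le> (h + 1) / \<kappa>'" .
    qed
    then show ?thesis unfolding bounded_iff i(1) by auto
  qed
  then obtain r :: "nat \<Rightarrow> nat" and g where r: "strict_mono r"
    and g: "\<forall>i\<in>I. (\<lambda>j. (\<lambda>(\<mu>, a, b). S (r j) \<mu> $$ (a, b)) i) \<longlonglongrightarrow> g i"
    using finite_pointwise_subsequence[of I "\<lambda>j (\<mu>, a, b). S j \<mu> $$ (a, b)"] by (auto simp: I_def)
  define L where "L \<mu> = Matrix.mat d d (\<lambda>(a, b). g (\<mu>, a, b))" for \<mu>
  have SC: "S j \<mu> \<in> carrier_mat d d" for j \<mu> using Q[of j] by (simp add: holevo_feasible_def)
  have limS: "mat_tendsto d (\<lambda>j. S (r j) \<mu>) (L \<mu>)" for \<mu>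
    unfolding mat_tendsto_def using SC g by (auto simp: L_def I_def)
  then have LC: "L \<mu> \<in> carrier_mat d d" for \<mu> by (simp add: mat_tendsto_def)
  have feas: "holevo_feasible d \<rho> L"
    by (rule holevo_feasible_limit[where S = "\<lambda>j. S (r j)" and L = L and \<rho> = \<rho>, OF _ limS rC]) (use Q in blast)
  have \<epsilon>r: "(\<lambda>j. \<epsilon> (r j)) \<longlonglongrightarrow> 0" using LIMSEQ_subseq_LIMSEQ[OF \<epsilon>0 r] by (simp add: comp_def)
  have \<delta>0: "(\<lambda>j. \<delta> (r j)) \<longlonglongrightarrow> 0"
  proof (rule tendsto_sandwich[of "\<lambda>_. 0" _ _ "\<lambda>j. \<epsilon> (r j) / \<kappa>"])
    show "\<forall>\<^sub>F j in sequentially. 0 \<le> \<delta> (r j)" using Qx by (intro always_eventually allI) blast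
    show "\<forall>\<^sub>F j in sequentially. \<delta> (r j) \<le> \<epsilon> (r j) / \<kappa>"
      using Q \<kappa>(1) by (intro always_eventually allI) (simp add: pos_le_divide_eq mult.commute)
    show "(\<lambda>j. \<epsilon> (r j) / \<kappa>) \<longlonglongrightarrow> 0" using tendsto_divide[OF \<epsilon>r tendsto_const, of \<kappa>] \<kappa>(1) by simp
  qed simp
  have R0: "(\<lambda>j. R (r j) \<mu> $$ (a, b)) \<longlonglongrightarrow> 0" if ab: "a < d ^ n" "b < d ^ n" for \<mu> a b
  proof (rule Lim_null_comparison[of _ "\<lambda>j. sqrt (\<delta> (r j))"])
    have "(cmod (R j \<mu> $$ (a, b)))\<^sup>2 \<le> \<delta> j" for j using Qx[of j] ab by blast
    then show "\<forall>\<^sub>F j in sequentially. cmod (R (r j) \<mu> $$ (a, b)) \<le> sqrt (\<delta> (r j))"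
      by (intro always_eventually allI real_le_rsqrt)
    show "(\<lambda>j. sqrt (\<delta> (r j))) \<longlonglongrightarrow> 0" using tendsto_real_sqrt[OF \<delta>0] by simp
  qed
  define z where "z = 1 / complex_of_nat n"
  have z: "z \<noteq> 0" using assms(7) by (simp add: z_def)
  have limX: "mat_tendsto (d ^ n) (\<lambda>j. X (r j) \<mu>) (z \<cdot>\<^sub>m collective d n (L \<mu>))" for \<mu>
    unfolding mat_tendsto_def
  proof (intro conjI allI impI)
    show "X (r j) \<mu> \<in> carrier_mat (d ^ n) (d ^ n)" for j using Qx[of "r j"] by blast
    show "z \<cdot>\<^sub>m collective d n (L \<mu>) \<in> carrier_mat (d ^ n) (d ^ n)" using LC by simp
    fix a b assume ab: "a < d ^ n" "b < d ^ n"
    have "X j \<mu> $$ (a, b) = R j \<mu> $$ (a, b) + collective d n (S j \<mu>) $$ (a, b) / of_nat n" for j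
      using Qx[of j] ab by blast
    moreover have "(\<lambda>j. R (r j) \<mu> $$ (a, b) + collective d n (S (r j) \<mu>) $$ (a, b) / of_nat n)
        \<longlonglongrightarrow> 0 + collective d n (L \<mu>) $$ (a, b) / of_nat n"
      using mat_tendsto_collective[OF limS, of n \<mu>] ab assms(7)
      by (intro tendsto_add R0 ab tendsto_divide tendsto_const) (auto simp: mat_tendsto_def)
    ultimately show "(\<lambda>j. X (r j) \<mu> $$ (a, b)) \<longlonglongrightarrow> (z \<cdot>\<^sub>m collective d n (L \<mu>)) $$ (a, b)"
      using ab carrier_matD[OF collective_carrier[OF LC[of \<mu>], of n]] by (simp add: z_def)
  qed
  have comm: "L \<mu> * L \<nu> = L \<nu> * L \<mu>" for \<mu> \<nu>
  proof (rule collective_limit_commute[where A = "\<lambda>j. S (r j) \<mu>" and B = "\<lambda>j. S (r j) \<nu>" and A' = "L \<mu>" and B' = "L \<nu>" and X = "\<lambda>j. X (r j) \<mu>" and Y = "\<lambda>j. X (r j) \<nu>",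
        OF assms(5) tr _ limS limS limX limX z])
    show "0 < n" using assms(7) by simp
    fix a b assume ab: "a < d ^ n" "b < d ^ n"
    show "(\<lambda>j. (X (r j) \<mu> * X (r j) \<nu>) $$ (a, b) - (X (r j) \<nu> * X (r j) \<mu>) $$ (a, b)) \<longlonglongrightarrow> 0"
    proof (rule Lim_null_comparison[of _ "\<lambda>j. 4 * \<delta> (r j)"])
      have "cmod ((X j \<mu> * X j \<nu>) $$ (a, b) - (X j \<nu> * X j \<mu>) $$ (a, b)) \<le> 4 * \<delta> j" for j
        using Qx[of j] ab by blast
      then show "\<forall>\<^sub>F j in sequentially. cmod ((X (r j) \<mu> * X (r j) \<nu>) $$ (a, b) - (X (r j) \<nu> * X (r j) \<mu>) $$ (a, b)) \<le> 4 * \<delta> (r j)"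
        by (intro always_eventually allI)
      show "(\<lambda>j. 4 * \<delta> (r j)) \<longlonglongrightarrow> 0" using tendsto_mult[OF tendsto_const \<delta>0, of 4] by simp
    qed
  qed
  \<comment> \<open>The nonnegative trace norm is dropped before the limit. What remains is
    polynomial in the entries, hence continuous, and is precisely the cost that commuting
    observables attain on one copy.\<close>
  have "Determinants.trace (W ** Re_matrix (holevo_Z (\<rho> 0) L)) \<le> h"
  proof (rule LIMSEQ_le)
    show "(\<lambda>j. Determinants.trace (W ** Re_matrix (holevo_Z (\<rho> 0) (S (r j))))) \<longlonglongrightarrow> Determinants.trace (W ** Re_matrix (holevo_Z (\<rho> 0) L))"
      unfolding trace_mult_symmetric[OF sym] Re_matrix_def holevo_Z_def vec_lambda_beta
      by (intro tendsto_sum tendsto_mult tendsto_const tendsto_Re mat_tendsto_trace[where N = d] mat_tendsto_mult mat_tendsto_const rC limS)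
    show "(\<lambda>j. h + \<epsilon> (r j)) \<longlonglongrightarrow> h" using tendsto_add[OF tendsto_const \<epsilon>r, of h] by simp
    have "Determinants.trace (W ** Re_matrix (holevo_Z (\<rho> 0) (S j))) \<le> h + \<epsilon> j" for j
      using Q[of j] trace_norm_nonneg[of "psd_sqrt W ** Im_matrix (holevo_Z (\<rho> 0) (S j)) ** psd_sqrt W"]
      by (simp add: holevo_cost_def)
    then show "\<exists>N. \<forall>j\<ge>N. Determinants.trace (W ** Re_matrix (holevo_Z (\<rho> 0) (S (r j)))) \<le> h + \<epsilon> (r j)" by blast
  qed
  then have "copy_optimum d \<rho> 1 W \<le> ereal h"
    using commuting_observables_attain[OF rC feas comm, of W] by (meson ereal_less_eq(3) order_trans)
  with assms(8) show False by (simp add: h)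
qed

end
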